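(* Let $d\ge2$ be an integer and let $X$ be the translation surface obtained from a regular $2d$-gon by identifying parallel opposite sides by translation. There exists a dense $G_\delta$ subset of the circle of directions, of positive Hausdorff dimension, such that for every direction $\theta$ in this set the linear flow in direction $\theta$ on $X$ (with normalized Lebesgue area measure) is rigid.
   Context: The surface $X$ arises by unfolding the billiard in the right-angled triangle with angles $\left(\frac{\pi}{2d},\frac{\pi}{2},\frac{(d-1)\pi}{2d}\right)$. The linear flow in direction $\theta$ moves points at unit speed along straight lines of direction $\theta$: a path that hits the boundary of the polygon re-enters at the corresponding point of the parallel side and continues with the same velocity. A measure-preserving flow $(S_t)$ on a probability space $(X,\mu)$ is rigid if there is a sequence of real numbers $Q_n\to\infty$ such that $\mu(S_{Q_n}A\,\Delta\,A)\to 0$ for every measurable set $A$. *)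

theory Defs
  imports "HOL-Analysis.Analysis" "HOL-Probability.Probability"
begin

section \<open>Hausdorff dimension\<close>

text \<open>Boundedness is required explicitly because \<open>diameter\<close> is unspecified on unbounded sets. Since
  \<open>0 powr 0 = 0\<close>, the outer measures below are only meaningful for positive exponents, and only
  those enter the definition of the dimension.\<close>

definition hausdorff_premeasure :: "real \<Rightarrow> real \<Rightarrow> 'a::metric_space set \<Rightarrow> ennreal" where
  "hausdorff_premeasure s \<delta> A =
    (INF U \<in> {U :: nat \<Rightarrow> 'a set. A \<subseteq> (\<Union>i. U i) \<and> (\<forall>i. bounded (U i) \<and> diameter (U i) \<le> \<delta>)}.
      \<Sum>i. ennreal (diameter (U i) powr s))"

definition hausdorff_outer_measure :: "real \<Rightarrow> 'a::metric_space set \<Rightarrow> ennreal" where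
  "hausdorff_outer_measure s A = (SUP \<delta> \<in> {0<..}. hausdorff_premeasure s \<delta> A)"

definition hausdorff_dim :: "'a::metric_space set \<Rightarrow> ennreal" where
  "hausdorff_dim A = Inf {ennreal s | s. s > 0 \<and> hausdorff_outer_measure s A = 0}"


section \<open>Measure-preserving flows and rigidity\<close>

definition measure_preserving_flow :: "'a measure \<Rightarrow> (real \<Rightarrow> 'a \<Rightarrow> 'a) \<Rightarrow> bool" where
  "measure_preserving_flow M S \<longleftrightarrow>
    (\<lambda>(t, x). S t x) \<in> borel \<Otimes>\<^sub>M M \<rightarrow>\<^sub>M M \<and>
    (\<forall>x \<in> space M. S 0 x = x) \<and>
    (\<forall>s t. \<forall>x \<in> space M. S (s + t) x = S s (S t x)) \<and>
    (\<forall>t. \<forall>A \<in> sets M. emeasure M (S t -` A \<inter> space M) = emeasure M A)"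

text \<open>For a measure-preserving flow the images \<open>S t ` A\<close> of measurable sets are measurable,
  being the preimages under \<open>S (- t)\<close>.\<close>

definition rigid_flow :: "'a measure \<Rightarrow> (real \<Rightarrow> 'a \<Rightarrow> 'a) \<Rightarrow> bool" where
  "rigid_flow M S \<longleftrightarrow>
    prob_space M \<and> measure_preserving_flow M S \<and>
    (\<exists>Q :: nat \<Rightarrow> real. filterlim Q at_top sequentially \<and>
      (\<forall>A \<in> sets M. (\<lambda>n. measure M (sym_diff (S (Q n) ` A) A)) \<longlonglongrightarrow> 0))"


section \<open>The translation surface of the regular \<open>2d\<close>-gon\<close>

text \<open>Vertices and sides are indexed by all natural numbers, periodically with period \<open>2d\<close>.\<close>

definition vertex :: "nat \<Rightarrow> nat \<Rightarrow> complex" where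
  "vertex d k = cis (pi * real k / real d)"

definition polygon :: "nat \<Rightarrow> complex set" where
  "polygon d = convex hull (range (vertex d))"

definition side :: "nat \<Rightarrow> nat \<Rightarrow> complex set" where
  "side d k = closed_segment (vertex d k) (vertex d (k + 1))"

text \<open>The translation by \<open>side_shift d k\<close> carries side \<open>k\<close> onto the opposite side \<open>k + d\<close>. As the
  boundary is traversed in opposite directions along the two sides, it maps \<open>vertex d k\<close> to
  \<open>vertex d (k + d + 1)\<close> and \<open>vertex d (k + 1)\<close> to \<open>vertex d (k + d)\<close>.\<close>

definition side_shift :: "nat \<Rightarrow> nat \<Rightarrow> complex" where
  "side_shift d k = vertex d (k + d + 1) - vertex d k"

text \<open>The relation \<open>side_pairing d\<close> is symmetric, so \<open>glue d\<close> is an equivalence relation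
  on \<open>polygon d\<close>.\<close>

definition side_pairing :: "nat \<Rightarrow> complex rel" where
  "side_pairing d = {(p, p + side_shift d k) | p k. p \<in> side d k}"

definition glue :: "nat \<Rightarrow> complex rel" where
  "glue d = (side_pairing d)\<^sup>* \<inter> polygon d \<times> polygon d"

definition surface :: "nat \<Rightarrow> complex set set" where
  "surface d = polygon d // glue d"

definition proj :: "nat \<Rightarrow> complex \<Rightarrow> complex set" where
  "proj d p = glue d `` {p}"

definition cone_points :: "nat \<Rightarrow> complex set set" where
  "cone_points d = proj d ` range (vertex d)"

text \<open>Normalized area on the surface: the image of the uniform distribution on the polygon under the
  quotient map, on the quotient of the Borel sigma-algebra.\<close>

definition surface_measure :: "nat \<Rightarrow> complex set measure" where
  "surface_measure d =
    distr (uniform_measure (restrict_space lborel (polygon d)) (polygon d))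
      (sigma (surface d) {E. E \<subseteq> surface d \<and> {p \<in> polygon d. proj d p \<in> E} \<in> sets borel})
      (proj d)"


section \<open>The linear flow\<close>

text \<open>A direction is a unit complex number \<open>u\<close>. A unit-speed trajectory in direction \<open>u\<close> avoids the
  vertices and, at each time \<open>t\<close>, leaves \<open>\<gamma> t\<close> along a segment of direction \<open>u\<close> that starts at
  some representative \<open>p\<close> of \<open>\<gamma> t\<close> and runs inside the polygon, and arrives along such
  a segment ending at some representative \<open>q\<close>. When \<open>\<gamma> t\<close> lies on a side, \<open>p\<close> and \<open>q\<close> are in general
  two different points, related by the side pairing.\<close>

definition linear_trajectory :: "nat \<Rightarrow> complex \<Rightarrow> (real \<Rightarrow> complex set) \<Rightarrow> bool" where
  "linear_trajectory d u \<gamma> \<longleftrightarrow>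
    (\<forall>t. \<gamma> t \<in> surface d - cone_points d \<and>
      (\<exists>\<epsilon>>0.
        (\<exists>p \<in> \<gamma> t. \<forall>s \<in> {0..<\<epsilon>}. p + s *\<^sub>R u \<in> polygon d \<and> \<gamma> (t + s) = proj d (p + s *\<^sub>R u)) \<and>
        (\<exists>q \<in> \<gamma> t. \<forall>s \<in> {0..<\<epsilon>}. q - s *\<^sub>R u \<in> polygon d \<and> \<gamma> (t - s) = proj d (q - s *\<^sub>R u))))"

text \<open>There is at most one trajectory through a given point. The points through which there is none
  are those whose straight line in direction \<open>u\<close> runs into a vertex, forwards or backwards in time.
  They form a flow-invariant null set, on which the flow is set to be the identity.\<close>

definition linear_flow :: "nat \<Rightarrow> complex \<Rightarrow> real \<Rightarrow> complex set \<Rightarrow> complex set" where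
  "linear_flow d u t x =
    (if \<exists>\<gamma>. linear_trajectory d u \<gamma> \<and> \<gamma> 0 = x
     then (THE \<gamma>. linear_trajectory d u \<gamma> \<and> \<gamma> 0 = x) t
     else x)"

end

theory Submission
  imports Defs
begin

text \<open>In the direction of a side the surface decomposes into cylinders that all have inverse modulus
  \<open>2 cot (pi / (2 d))\<close> or half of it. Hence, besides the rotations by multiples of \<open>pi / d\<close>, it admits a parabolic affine
  automorphism, and every image of this direction under the group generated by them is completely periodic. A
  Farey-type subdivision shows that every direction lies within \<open>O(1 / N)\<close> of an image under an automorphism
  with derivative \<open>m\<close> of norm at most \<open>N\<close>. If a direction is even \<open>N\<close> to the power \<open>- (4 d + 7)\<close> close to such an
  image, then \<open>m\<close> pulls its flow back to an almost horizontal one. Simultaneous Diophantine approximation of the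
  circumferences of the horizontal cylinders gives a time after which every point not too close to the boundary of its
  cylinder has returned so close to itself that it stays close when mapped back by \<open>m\<close>. Trajectories that run into
  a vertex do no harm, as the flow is the identity on them. The directions that admit such approximations for
  arbitrarily large \<open>N\<close> form a dense \<open>G_delta\<close> set, which contains a Cantor set with a surjection onto the unit
  interval that satisfies a Hoelder condition.\<close>

section \<open>Area-preserving maps of the plane\<close>

text \<open>The circumferences of the horizontal cylinders can have irrational ratios
  (\<open>sqrt 2\<close> for \<open>d = 4\<close>), so even in a completely periodic direction no
  single time need close up the flow; this is why Diophantine approximation enters. The exponent
  \<open>4 d + 7\<close> is a budget of powers of \<open>n\<close>, a bound for the norm of
  \<open>m\<close>. Dirichlet's theorem gives denominators up to \<open>n^(4d)\<close> with error
  \<open>n^-4\<close>. Multiplying the time by \<open>n^2\<close> makes it diverge and leaves an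
  error of order \<open>n^-2\<close>, which \<open>m\<close> enlarges to \<open>n^-1\<close>. The
  time is of order at most \<open>n^(4d+2)\<close>, and \<open>n^(4d+3)\<close> after division by a
  horizontal speed that is at least of order \<open>1/n\<close>. The vertical speed is at most
  \<open>n\<close> times the distance to the periodic direction, and \<open>m\<close> costs one more
  factor \<open>n\<close>; with radius \<open>n^-(4d+7)\<close> the drift becomes
  \<open>n^-2\<close>. The geometric device throughout is uniqueness of straight paths: two
  descriptions of a path with the same start and velocity agree until a cone point is met.
  Directions parallel to a side are discarded; for the others each non-cone point has one
  representative from which the flow enters the polygon, which makes measurability
  tractable.\<close>

definition area_preserving :: "(complex \<Rightarrow> complex) \<Rightarrow> bool" where
  "area_preserving f \<longleftrightarrow> f \<in> borel \<rightarrow>\<^sub>M borel \<and> distr lborel borel f = lborel"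

lemma area_preserving_measurable: "area_preserving f \<Longrightarrow> f \<in> borel \<rightarrow>\<^sub>M borel"
  by (simp add: area_preserving_def)

lemma area_preserving_emeasure:
  assumes "area_preserving f" "A \<in> sets borel"
  shows "emeasure lborel (f -` A) = emeasure lborel A"
proof -
  have "emeasure lborel A = emeasure (distr lborel borel f) A"
    using assms by (simp add: area_preserving_def)
  also have "\<dots> = emeasure lborel (f -` A)"
    using assms by (subst emeasure_distr) (auto simp: area_preserving_def)
  finally show ?thesis by simp
qed

lemma area_preserving_comp:
  assumes "area_preserving f" "area_preserving g"
  shows "area_preserving (f \<circ> g)"
proof -
  have m: "f \<in> borel \<rightarrow>\<^sub>M borel" "g \<in> borel \<rightarrow>\<^sub>M borel"
    using assms by (auto simp: area_preserving_def)
  have "distr lborel borel (f \<circ> g) = distr (distr lborel borel g) borel f"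
    using m by (subst distr_distr) auto
  also have "\<dots> = lborel"
    using assms by (simp add: area_preserving_def)
  finally show ?thesis
    using m by (simp add: area_preserving_def measurable_comp)
qed

lemma lborel_complex_eq: "(lborel :: complex measure) = distr (lborel \<Otimes>\<^sub>M lborel) borel (\<lambda>(x, y). Complex x y)"
proof (rule lborel_eqI)
  have m: "(\<lambda>(x, y). Complex x y) \<in> (lborel \<Otimes>\<^sub>M lborel) \<rightarrow>\<^sub>M borel"
    unfolding Complex_eq by measurable
  fix l u :: complex
  assume le: "\<And>b. b \<in> Basis \<Longrightarrow> l \<bullet> b \<le> u \<bullet> b"
  have le': "Re l \<le> Re u" "Im l \<le> Im u"
    using le[of 1] le[of \<i>] by (auto simp: Basis_complex_def)
  have eq: "(\<lambda>(x, y). Complex x y) -` box l u \<inter> space (lborel \<Otimes>\<^sub>M lborel)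
      = box (Re l) (Re u) \<times> box (Im l) (Im u)"
    by (auto simp: box_def Basis_complex_def space_pair_measure)
  have "emeasure (distr (lborel \<Otimes>\<^sub>M lborel) borel (\<lambda>(x, y). Complex x y)) (box l u)
     = emeasure (lborel \<Otimes>\<^sub>M lborel) (box (Re l) (Re u) \<times> box (Im l) (Im u))"
    by (subst emeasure_distr[OF m]) (auto simp: eq)
  also have "\<dots> = ennreal (Re u - Re l) * ennreal (Im u - Im l)"
    using le' by (subst lborel.emeasure_pair_measure_Times) auto
  also have "\<dots> = (\<Prod>b\<in>Basis. (u - l) \<bullet> b)"
    using le' by (simp add: Basis_complex_def ennreal_mult)
  finally show "emeasure (distr (lborel \<Otimes>\<^sub>M lborel) borel (\<lambda>(x, y). Complex x y)) (box l u)
     = (\<Prod>b\<in>Basis. (u - l) \<bullet> b)" .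
qed simp

text \<open>Cavalieri's principle in both orders: one order reduces a shear to translations of the
  sections, and comparing the two orders gives the swap of coordinates.\<close>

lemma emeasure_complex_alt:
  assumes A: "A \<in> sets borel"
  shows "emeasure lborel A = (\<integral>\<^sup>+ y. emeasure lborel {x. Complex x y \<in> A} \<partial>lborel)"
    and "emeasure lborel A = (\<integral>\<^sup>+ x. emeasure lborel {y. Complex x y \<in> A} \<partial>lborel)"
proof -
  have m: "(\<lambda>(x, y). Complex x y) \<in> (lborel \<Otimes>\<^sub>M lborel) \<rightarrow>\<^sub>M borel"
    unfolding Complex_eq by measurable
  let ?B = "(\<lambda>(x, y). Complex x y) -` A \<inter> space (lborel \<Otimes>\<^sub>M lborel)"
  have e: "emeasure lborel A = emeasure (lborel \<Otimes>\<^sub>M lborel) ?B"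
    by (subst lborel_complex_eq, subst emeasure_distr[OF m]) (use A in auto)
  have B: "?B \<in> sets (lborel \<Otimes>\<^sub>M lborel)"
    using m A by (rule measurable_sets)
  show "emeasure lborel A = (\<integral>\<^sup>+ y. emeasure lborel {x. Complex x y \<in> A} \<partial>lborel)"
    unfolding e by (subst lborel_pair.emeasure_pair_measure_alt2[OF B])
      (auto intro!: nn_integral_cong arg_cong2[where f=emeasure] simp: space_pair_measure)
  show "emeasure lborel A = (\<integral>\<^sup>+ x. emeasure lborel {y. Complex x y \<in> A} \<partial>lborel)"
    unfolding e by (subst lborel.emeasure_pair_measure_alt[OF B])
      (auto intro!: nn_integral_cong arg_cong2[where f=emeasure] simp: space_pair_measure)
qed

lemma emeasure_lborel_translate_real:
  fixes S :: "real set"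
  assumes "S \<in> sets borel"
  shows "emeasure lborel {x. x + c \<in> S} = emeasure lborel S"
proof -
  have "emeasure lborel S = emeasure (distr lborel borel ((+) c)) S"
    by (simp add: lborel_distr_plus)
  also have "\<dots> = emeasure lborel {x. x + c \<in> S}"
    using assms by (subst emeasure_distr) (auto intro!: arg_cong2[where f=emeasure] simp: add.commute)
  finally show ?thesis by simp
qed

text \<open>Each horizontal section is merely translated, so its length is unchanged.\<close>

lemma area_preserving_shear_x: "area_preserving (\<lambda>z. Complex (Re z + c * Im z) (Im z))" (is "area_preserving ?f")
proof -
  have m: "?f \<in> borel \<rightarrow>\<^sub>M borel" unfolding Complex_eq by measurable
  have "distr lborel borel ?f = lborel"
  proof (rule measure_eqI)
    fix A assume "A \<in> sets (distr lborel borel ?f)"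
    hence A: "A \<in> sets borel" by simp
    have fA: "?f -` A \<in> sets borel" using measurable_sets[OF m A] by simp
    have sl: "{x. Complex x y \<in> A} \<in> sets borel" for y
    proof -
      have "(\<lambda>x. Complex x y) \<in> borel \<rightarrow>\<^sub>M borel" unfolding Complex_eq by measurable
      from measurable_sets[OF this A] show ?thesis by (simp add: vimage_def)
    qed
    have "emeasure (distr lborel borel ?f) A = emeasure lborel (?f -` A)"
      using m A by (subst emeasure_distr) auto
    also have "\<dots> = (\<integral>\<^sup>+ y. emeasure lborel {x. Complex x y \<in> ?f -` A} \<partial>lborel)"
      by (rule emeasure_complex_alt(1)[OF fA])
    also have "\<dots> = (\<integral>\<^sup>+ y. emeasure lborel {x. Complex x y \<in> A} \<partial>lborel)"
    proof (rule nn_integral_cong)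
      fix y
      show "emeasure lborel {x. Complex x y \<in> ?f -` A} = emeasure lborel {x. Complex x y \<in> A}"
        using emeasure_lborel_translate_real[OF sl[of y], of "c * y"] by simp
    qed
    also have "\<dots> = emeasure lborel A"
      by (rule emeasure_complex_alt(1)[OF A, symmetric])
    finally show "emeasure (distr lborel borel ?f) A = emeasure lborel A" .
  qed simp
  with m show ?thesis by (simp add: area_preserving_def)
qed

lemma area_preserving_swap: "area_preserving (\<lambda>z. Complex (Im z) (Re z))" (is "area_preserving ?f")
proof -
  have m: "?f \<in> borel \<rightarrow>\<^sub>M borel" unfolding Complex_eq by measurable
  have "distr lborel borel ?f = lborel"
  proof (rule measure_eqI)
    fix A assume "A \<in> sets (distr lborel borel ?f)"
    hence A: "A \<in> sets borel" by simp
    have fA: "?f -` A \<in> sets borel" using measurable_sets[OF m A] by simp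
    have "emeasure (distr lborel borel ?f) A = emeasure lborel (?f -` A)"
      using m A by (subst emeasure_distr) auto
    also have "\<dots> = emeasure lborel A"
      using emeasure_complex_alt(1)[OF fA] emeasure_complex_alt(2)[OF A] by simp
    finally show "emeasure (distr lborel borel ?f) A = emeasure lborel A" .
  qed simp
  with m show ?thesis by (simp add: area_preserving_def)
qed

lemma area_preserving_shear_y: "area_preserving (\<lambda>z. Complex (Re z) (Im z + c * Re z))"
proof -
  let ?s = "\<lambda>z. Complex (Im z) (Re z)"
  have "area_preserving (?s \<circ> (\<lambda>z. Complex (Re z + c * Im z) (Im z)) \<circ> ?s)"
    by (intro area_preserving_comp area_preserving_swap area_preserving_shear_x)
  thus ?thesis by (simp add: comp_def)
qed

text \<open>A rotation is a product of three shears.\<close>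

lemma area_preserving_rotation:
  assumes w: "norm w = 1"
  shows "area_preserving (\<lambda>z. w * z)"
proof -
  have main: "area_preserving (\<lambda>z. w * z)" if w: "norm w = 1" and ne: "Re w \<noteq> -1" for w
  proof -
    \<comment> \<open>For \<open>w = cis \<theta>\<close> this is minus the tangent of
      \<open>\<theta> / 2\<close>, the coefficient of the two outer shears.\<close>
    define c where "c = - Im w / (1 + Re w)"
    let ?X = "\<lambda>z. Complex (Re z + c * Im z) (Im z)"
    let ?Y = "\<lambda>z. Complex (Re z) (Im z + Im w * Re z)"
    have sq: "Re w ^ 2 + Im w ^ 2 = 1" using w cmod_power2[of w] by simp
    have ne': "1 + Re w \<noteq> 0" using ne by auto
    have "Im w * c = - (Im w ^ 2) / (1 + Re w)" by (simp add: c_def power2_eq_square)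
    also have "Im w ^ 2 = (1 + Re w) * (1 - Re w)" using sq by (simp add: power2_eq_square algebra_simps)
    also have "- ((1 + Re w) * (1 - Re w)) / (1 + Re w) = Re w - 1" using ne' by (simp add: field_simps)
    finally have 1: "Im w * c = Re w - 1" .
    have 2: "c * (1 + Re w) = - Im w" using ne' by (simp add: c_def)
    have "(?X \<circ> ?Y \<circ> ?X) z = w * z" for z
    proof (rule complex_eqI)
      have "Re ((?X \<circ> ?Y \<circ> ?X) z) = (1 + Im w * c) * Re z + c * (2 + Im w * c) * Im z"
        by (simp add: algebra_simps)
      also have "2 + Im w * c = 1 + Re w" using 1 by simp
      also have "c * (1 + Re w) = - Im w" by (rule 2)
      finally show "Re ((?X \<circ> ?Y \<circ> ?X) z) = Re (w * z)" by (simp add: 1)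
      have "Im ((?X \<circ> ?Y \<circ> ?X) z) = Im w * Re z + (1 + Im w * c) * Im z"
        by (simp add: algebra_simps)
      thus "Im ((?X \<circ> ?Y \<circ> ?X) z) = Im (w * z)" by (simp add: 1)
    qed
    hence "(\<lambda>z. w * z) = ?X \<circ> ?Y \<circ> ?X" by (intro ext) simp
    thus ?thesis
      by (simp only: area_preserving_comp area_preserving_shear_x area_preserving_shear_y)
  qed
  show ?thesis
  proof (cases "Re w = -1")
    case False
    thus ?thesis using main w by blast
  next
    case True
    hence "Im w = 0" using w cmod_power2[of w] by simp
    \<comment> \<open>The half turn, where the tangent of the half angle is infinite, is the square
      of a quarter turn.\<close>
    hence "w = -1" using True by (simp add: complex_eq_iff)
    hence "(\<lambda>z. w * z) = (\<lambda>z. \<i> * z) \<circ> (\<lambda>z. \<i> * z)" by (auto simp flip: mult.assoc)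
    moreover have "area_preserving ((\<lambda>z. \<i> * z) \<circ> (\<lambda>z. \<i> * z))"
      by (intro area_preserving_comp main) auto
    ultimately show ?thesis by (simp only:)
  qed
qed

text \<open>Injectivity makes the images of the disjointed pieces disjoint, so that their areas add up to at
  most that of \<open>B\<close>.\<close>

lemma emeasure_vimage_piecewise_affine_le:
  fixes f m m' :: "complex \<Rightarrow> complex" and A :: "nat \<Rightarrow> complex set"
  assumes m': "area_preserving m'" and minv: "\<And>z. m' (m z) = z" "\<And>z. m (m' z) = z"
    and mm: "area_preserving m"
    and A: "\<And>i. A i \<in> sets borel" and f: "\<And>i z. z \<in> A i \<Longrightarrow> f z = m z + c i"
    and inj: "inj_on f (\<Union>i. A i)" and B: "B \<in> sets borel"
  shows "emeasure lborel {z \<in> \<Union>i. A i. f z \<in> B} \<le> emeasure lborel B"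
    and "{z \<in> \<Union>i. A i. f z \<in> B} \<in> sets borel"
proof -
  define D where "D = disjointed A"
  have "range D \<subseteq> sets borel"
    unfolding D_def by (rule sets.range_disjointed_sets) (use A in auto)
  hence D: "D i \<in> sets borel" for i by auto
  have DA: "D i \<subseteq> A i" for i by (simp add: D_def disjointed_subset)
  have UD: "(\<Union>i. D i) = (\<Union>i. A i)" by (simp add: D_def UN_disjointed_eq)
  have disj: "disjoint_family D" by (simp add: D_def disjoint_family_disjointed)
  define E where "E i = {z \<in> D i. f z \<in> B}" for i
  have mb[measurable]: "m \<in> borel \<rightarrow>\<^sub>M borel" "m' \<in> borel \<rightarrow>\<^sub>M borel" using m' mm by (auto simp: area_preserving_measurable)
  have Eq: "E i = D i \<inter> (\<lambda>z. m z + c i) -` B" for i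
  proof -
    have "f z = m z + c i" if "z \<in> D i" for z using f DA[of i] that by blast
    thus ?thesis by (auto simp: E_def)
  qed
  have E: "E i \<in> sets borel" for i
  proof -
    have "(\<lambda>z. m z + c i) \<in> borel \<rightarrow>\<^sub>M borel" by measurable
    from measurable_sets[OF this B] show ?thesis using D unfolding Eq by auto
  qed
  have set_eq: "{z \<in> \<Union>i. A i. f z \<in> B} = (\<Union>i. E i)" unfolding UD[symmetric] E_def by auto
  show "{z \<in> \<Union>i. A i. f z \<in> B} \<in> sets borel" unfolding set_eq using E by auto
  have disjE: "disjoint_family E" using disj by (auto simp: disjoint_family_on_def E_def)
  have im: "f ` E i = (\<lambda>z. m' (z - c i)) -` E i" for i
  proof -
    have "f ` E i = (\<lambda>z. m z + c i) ` E i" using f DA by (intro image_cong) (auto simp: E_def)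
    also have "\<dots> = (\<lambda>z. m' (z - c i)) -` E i"
    proof (intro equalityI subsetI)
      fix z assume "z \<in> (\<lambda>z. m' (z - c i)) -` E i"
      hence "m' (z - c i) \<in> E i" by simp
      moreover have "z = m (m' (z - c i)) + c i" by (simp add: minv)
      ultimately show "z \<in> (\<lambda>z. m z + c i) ` E i" by (rule rev_image_eqI)
    qed (auto simp: minv)
    finally show ?thesis .
  qed
  have imb: "f ` E i \<in> sets borel" for i
  proof -
    have "(\<lambda>z. m' (z - c i)) \<in> borel \<rightarrow>\<^sub>M borel" by measurable
    from measurable_sets[OF this E[of i]] show ?thesis unfolding im by simp
  qed
  have em: "emeasure lborel (f ` E i) = emeasure lborel (E i)" for i
  proof -
    have "emeasure lborel (f ` E i) = emeasure lborel ((\<lambda>z. - c i + z) -` (m' -` E i))"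
      unfolding im by (intro arg_cong2[where f=emeasure]) (auto simp: algebra_simps)
    also have "\<dots> = emeasure (distr lborel borel ((+) (- c i))) (m' -` E i)"
      using measurable_sets[OF mb(2) E[of i]] by (subst emeasure_distr) auto
    also have "\<dots> = emeasure lborel (m' -` E i)" by (simp add: lborel_distr_plus)
    also have "\<dots> = emeasure lborel (E i)" by (rule area_preserving_emeasure[OF m' E])
    finally show ?thesis .
  qed
  have disjF: "disjoint_family (\<lambda>i. f ` E i)"
    unfolding disjoint_family_on_def
  proof (intro ballI impI)
    fix i j :: nat assume "i \<noteq> j"
    hence "E i \<inter> E j = {}" using disjE by (auto simp: disjoint_family_on_def)
    moreover have "E i \<subseteq> (\<Union>i. A i)" "E j \<subseteq> (\<Union>i. A i)" using DA by (auto simp: E_def)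
    ultimately show "f ` E i \<inter> f ` E j = {}" using inj_on_image_Int[OF inj, of "E i" "E j"] by simp
  qed
  have "emeasure lborel (\<Union>i. E i) = (\<Sum>i. emeasure lborel (E i))"
    using E disjE by (intro suminf_emeasure[symmetric]) auto
  also have "\<dots> = (\<Sum>i. emeasure lborel (f ` E i))" by (simp add: em)
  also have "\<dots> = emeasure lborel (\<Union>i. f ` E i)"
    using imb disjF by (intro suminf_emeasure) auto
  also have "\<dots> \<le> emeasure lborel B"
    using B by (intro emeasure_mono) (auto simp: E_def)
  finally show "emeasure lborel {z \<in> \<Union>i. A i. f z \<in> B} \<le> emeasure lborel B"
    by (simp only: set_eq)
qed

section \<open>Limsup sets of ubiquitous families on the circle\<close>

text \<open>The hypothesis says that the inverse of \<open>f\<close> is Hoelder with exponent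
  \<open>1 / m\<close>. If the dimension were smaller, a cover of \<open>G\<close> with a small sum
  of \<open>s\<close>-th powers of diameters would pull back to a cover of the unit interval by
  intervals of total length below 1.\<close>

lemma hausdorff_dim_pos:
  fixes f :: "real \<Rightarrow> 'a::metric_space" and m :: nat
  assumes fG: "\<And>y. 0 \<le> y \<Longrightarrow> y < 1 \<Longrightarrow> f y \<in> G"
    and hol: "\<And>y z. 0 \<le> y \<Longrightarrow> y < 1 \<Longrightarrow> 0 \<le> z \<Longrightarrow> z < 1 \<Longrightarrow> \<bar>y - z\<bar> ^ m \<le> B * dist (f y) (f z)"
    and m: "0 < m" and B: "0 < B"
  shows "0 < hausdorff_dim G"
proof -
  have "ennreal (1 / m) \<le> hausdorff_dim G"
    unfolding hausdorff_dim_def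
  proof (rule Inf_greatest)
    fix x assume "x \<in> {ennreal s |s. s > 0 \<and> hausdorff_outer_measure s G = 0}"
    then obtain s where s: "x = ennreal s" "0 < s" "hausdorff_outer_measure s G = 0" by auto
    have "1 / m \<le> s"
    proof (rule ccontr)
      assume "\<not> ?thesis"
      hence sm: "s \<le> 1 / m" by simp
      \<comment> \<open>The Hoelder constant of the inverse of \<open>f\<close>.\<close>
      define A where "A = B powr (1 / m)"
      have A: "0 < A" using B by (simp add: A_def)
      \<comment> \<open>Scale 1 suffices: for diameters at most 1 the power with exponent
        \<open>1 / m\<close> is at most the one with the smaller exponent \<open>s\<close>.\<close>
      have "hausdorff_premeasure s 1 G \<le> hausdorff_outer_measure s G"
        unfolding hausdorff_outer_measure_def by (rule SUP_upper) simp
      hence "hausdorff_premeasure s 1 G = 0" using s by simp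
      \<comment> \<open>The intervals below have radius \<open>A\<close> times the
        \<open>s\<close>-th power of a diameter, so this bound keeps their total length below
        \<open>1 / 2\<close>.\<close>
      hence "hausdorff_premeasure s 1 G < ennreal (1 / (4 * A))" using A by simp
      then obtain U :: "nat \<Rightarrow> 'a set" where U: "G \<subseteq> (\<Union>i. U i)" "\<And>i. bounded (U i)" "\<And>i. diameter (U i) \<le> 1"
        and sum: "(\<Sum>i. ennreal (diameter (U i) powr s)) < ennreal (1 / (4 * A))"
        unfolding hausdorff_premeasure_def INF_less_iff by auto
      define r where "r i = A * diameter (U i) powr s" for i
      define S where "S i = {y. 0 \<le> y \<and> y < 1 \<and> f y \<in> U i}" for i
      define c where "c i = (SOME y. y \<in> S i)" for i
      have close: "\<bar>y - z\<bar> \<le> r i" if "y \<in> S i" "z \<in> S i" for y z i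
      proof (cases "y = z")
        case True
        thus ?thesis using A by (simp add: r_def)
      next
        case False
        define D where "D = diameter (U i)"
        have D: "0 \<le> D" "D \<le> 1" using U diameter_ge_0 by (auto simp: D_def)
        have "dist (f y) (f z) \<le> D" unfolding D_def using that U(2) by (intro diameter_bounded_bound) (auto simp: S_def)
        hence le: "\<bar>y - z\<bar> ^ m \<le> B * D" using hol[of y z] that B by (auto simp: S_def intro: order_trans mult_left_mono)
        have "\<bar>y - z\<bar> = (\<bar>y - z\<bar> powr real m) powr (1 / m)" using False m by (simp add: powr_powr)
        also have "\<dots> = (\<bar>y - z\<bar> ^ m) powr (1 / m)" using False by (simp add: powr_realpow)
        also have "\<dots> \<le> (B * D) powr (1 / m)" using le by (intro powr_mono2) auto
        also have "\<dots> = A * D powr (1 / m)" using B D by (simp add: A_def powr_mult)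
        also have "D powr (1 / m) \<le> D powr s"
          using D sm by (cases "D = 0") (auto intro: powr_mono')
        finally show ?thesis using A by (simp add: r_def D_def)
      qed
      have cov: "{0..<1} \<subseteq> (\<Union>i. {c i - r i..c i + r i})"
      proof
        fix y :: real assume y: "y \<in> {0..<1}"
        hence "f y \<in> (\<Union>i. U i)" using fG[of y] U(1) by auto
        then obtain i where "y \<in> S i" using y by (auto simp: S_def)
        moreover from this have "c i \<in> S i" unfolding c_def by (rule someI)
        ultimately have "\<bar>y - c i\<bar> \<le> r i" by (rule close)
        thus "y \<in> (\<Union>i. {c i - r i..c i + r i})" by (intro UN_I[of i]) (auto simp: abs_le_iff)
      qed
      have r0: "0 \<le> r i" for i using A by (simp add: r_def)
      have "1 = emeasure lborel {0..<1::real}" by simp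
      also have "\<dots> \<le> emeasure lborel (\<Union>i. {c i - r i..c i + r i})" by (rule emeasure_mono[OF cov]) simp
      also have "\<dots> \<le> (\<Sum>i. emeasure lborel {c i - r i..c i + r i})" by (rule emeasure_subadditive_countably) auto
      also have "\<dots> = (\<Sum>i. ennreal (2 * A) * ennreal (diameter (U i) powr s))"
        using r0 A by (intro suminf_cong) (simp add: r_def ennreal_mult[symmetric])
      also have "\<dots> = ennreal (2 * A) * (\<Sum>i. ennreal (diameter (U i) powr s))" by simp
      also have "\<dots> \<le> ennreal (2 * A) * ennreal (1 / (4 * A))" using sum by (intro mult_left_mono) auto
      also have "\<dots> = ennreal (1 / 2)" using A by (simp add: ennreal_mult[symmetric])
      also have "\<dots> < ennreal 1" by (subst ennreal_less_iff) auto
      finally show False by simp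
    qed
    thus "ennreal (1 / m) \<le> x" using s by (simp add: ennreal_leI)
  qed
  moreover have "0 < ennreal (1 / m)" using m by simp
  ultimately show ?thesis by (rule less_le_trans[rotated])
qed

section \<open>Chords and arcs of the unit circle\<close>

lemma half_le_sin:
  fixes t :: real assumes t: "0 \<le> t" "t \<le> pi / 2" shows "t / 2 \<le> sin t"
proof (cases "t \<le> pi / 3")
  case True
  have "(\<lambda>x. sin x - x / 2) 0 \<le> (\<lambda>x. sin x - x / 2) t"
  proof (rule DERIV_nonneg_imp_nondecreasing[OF t(1)])
    fix x assume x: "0 \<le> x" "x \<le> t"
    have "cos (pi / 3) \<le> cos x" using x True by (intro cos_monotone_0_pi_le) auto
    hence "0 \<le> cos x - 1 / 2" by (simp add: cos_60)
    moreover have "((\<lambda>x. sin x - x / 2) has_real_derivative (cos x - 1 / 2)) (at x)"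
      by (auto intro!: derivative_eq_intros)
    ultimately show "\<exists>y. ((\<lambda>x. sin x - x / 2) has_real_derivative y) (at x) \<and> 0 \<le> y" by blast
  qed
  thus ?thesis by simp
next
  case False
  \<comment> \<open>Beyond \<open>pi / 3\<close> the sine is at least 0.85, whereas
    \<open>t / 2\<close> is at most \<open>pi / 4\<close>, which is below 0.8.\<close>
  have "sin (pi / 3) \<le> sin t" using False t by (intro sin_monotone_2pi_le) auto
  moreover have "(17/10)\<^sup>2 \<le> (3::real)" by (simp add: power2_eq_square)
  hence "17/10 \<le> sqrt 3" by (rule real_le_rsqrt)
  moreover have "pi < 32 / 10" using pi_approx by simp
  ultimately show ?thesis using t by (simp add: sin_60)
qed

lemma chord_le_arc: "dist (cis x) (cis y) \<le> \<bar>x - y\<bar>"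
proof -
  have "dist (cis x) (cis y) = norm (cis y * (cis (x - y) - 1))"
    by (simp add: dist_norm algebra_simps cis_mult)
  also have "\<dots> = norm (cis (x - y) - 1)" by (simp add: norm_mult)
  also have "\<dots> = 2 * \<bar>sin ((x - y) / 2)\<bar>"
  proof -
    have "norm (cis (x - y) - 1) ^ 2 = (2 * \<bar>sin ((x - y) / 2)\<bar>) ^ 2"
    proof -
      have "norm (cis (x - y) - 1) ^ 2 = (cos (x - y) - 1)^2 + sin (x - y) ^ 2"
        by (simp add: cmod_power2)
      also have "\<dots> = 2 - 2 * cos (x - y)" using sin_cos_squared_add[of "x - y"] by (simp add: power2_eq_square algebra_simps)
      also have "\<dots> = 4 * sin ((x - y) / 2) ^ 2" 
      proof -
        have "2 * ((x - y) / 2) = x - y" by simp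
        from cos_double_sin[of "(x - y) / 2", unfolded this] show ?thesis by simp
      qed
      finally show ?thesis by (simp add: power_mult_distrib)
    qed
    thus ?thesis by (rule power2_eq_imp_eq) simp_all
  qed
  also have "\<dots> \<le> \<bar>x - y\<bar>" using abs_sin_x_le_abs_x[of "(x - y) / 2"] by simp
  finally show ?thesis .
qed

lemma arc_le_chord:
  assumes "\<bar>x - y\<bar> \<le> pi" shows "\<bar>x - y\<bar> \<le> 2 * dist (cis x) (cis y)"
proof -
  define t where "t = \<bar>x - y\<bar> / 2"
  have t: "0 \<le> t" "t \<le> pi / 2" using assms by (auto simp: t_def)
  have "norm (cis x - cis y) ^ 2 = (cos x - cos y)^2 + (sin x - sin y) ^ 2"
    by (simp add: cmod_power2)
  also have "\<dots> = 2 - 2 * cos (x - y)" using sin_cos_squared_add[of x] sin_cos_squared_add[of y]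
    by (simp add: power2_eq_square algebra_simps cos_diff)
  also have "cos (x - y) = cos (2 * t)" by (simp add: t_def)
  also have "2 - 2 * cos (2 * t) = (2 * sin t) ^ 2" using cos_double_sin[of t] by (simp add: power_mult_distrib)
  finally have "dist (cis x) (cis y) = 2 * sin t"
    using t sin_ge_zero[of t] power2_eq_imp_eq[of "norm (cis x - cis y)" "2 * sin t"] by (simp add: dist_norm)
  moreover have "t / 2 \<le> sin t" using t by (rule half_le_sin)
  ultimately show ?thesis by (simp add: t_def)
qed

text \<open>An angle of \<open>p\<close> has to be chosen on the right sheet, next to the real
  number \<open>c\<close>; hence \<open>Arg\<close> is applied after rotating \<open>cis c\<close>
  to 1.\<close>

lemma near_cis:
  assumes p: "norm p = 1" obtains \<theta> where "p = cis \<theta>" "\<bar>\<theta> - c\<bar> \<le> 2 * dist p (cis c)"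
proof -
  define \<phi> where "\<phi> = Arg (p * cis (- c))"
  have n1: "norm (p * cis (- c)) = 1" using p by (simp add: norm_mult)
  hence "p * cis (- c) \<noteq> 0" by force
  with n1 have n: "p * cis (- c) = cis \<phi>" unfolding \<phi>_def using cis_Arg[of "p * cis (- c)"] by (auto simp: sgn_eq)
  have "p = p * (cis (- c) * cis c)" by (simp add: cis_mult)
  also have "\<dots> = cis (c + \<phi>)" unfolding mult.assoc[symmetric] n by (simp add: cis_mult add.commute)
  finally have e: "p = cis (c + \<phi>)" .
  have "\<bar>\<phi>\<bar> \<le> pi" unfolding \<phi>_def using Arg_bounded[of "p * cis (- c)"] by (simp add: abs_le_iff)
  hence "\<bar>c + \<phi> - c\<bar> \<le> 2 * dist (cis (c + \<phi>)) (cis c)" by (intro arc_le_chord) simp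
  thus ?thesis using that[of "c + \<phi>"] e by simp
qed

text \<open>An arc of length at most \<open>w / 8\<close> starting within \<open>w / 4\<close> of
  the midpoint of a cell of length \<open>w\<close> keeps clear of both ends of the cell. Arcs in
  different cells are therefore separated by a fixed fraction of \<open>w\<close>.\<close>

lemma cell_bounds:
  fixes c :: real assumes "\<bar>c - (\<alpha> + (i + 1/2) * w)\<bar> \<le> w / 4" "l \<le> w / 8"
  shows "\<alpha> + (i + 1/4) * w \<le> c \<and> c + l \<le> \<alpha> + (i + 7/8) * w"
proof -
  define x where "x = i * w"
  have e: "(i + 1/2) * w = x + w / 2" "(i + 1/4) * w = x + w / 4" "(i + 7/8) * w = x + 7/8 * w"
    by (simp_all add: x_def algebra_simps)
  show ?thesis using assms unfolding e abs_le_iff by linarith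
qed

lemma cell_gap:
  fixes w :: real assumes "x \<le> \<alpha> + (i + 7/8) * w" "\<alpha> + (j + 1/4) * w \<le> y" "(i + 1) * w \<le> j * w" "0 \<le> w"
  shows "w / 4 \<le> y - x"
proof -
  define p q where "p = i * w" and "q = j * w"
  have e: "(i + 7/8) * w = p + 7/8 * w" "(j + 1/4) * w = q + w / 4" "(i + 1) * w = p + w" "j * w = q"
    by (simp_all add: p_def q_def algebra_simps)
  show ?thesis using assms unfolding e by linarith
qed

section \<open>The limsup set is a dense G-delta set\<close>

locale ubiquitous =
  fixes R :: "real \<Rightarrow> complex set" and C :: real and \<tau> :: nat and F :: "complex set"
  assumes C: "1 \<le> C" and F: "finite F"
    and R1: "\<And>N p. p \<in> R N \<Longrightarrow> norm p = 1"
    and ub: "\<And>u N. norm u = 1 \<Longrightarrow> C \<le> N \<Longrightarrow> \<exists>p\<in>R N. dist p u \<le> C / N"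
begin

text \<open>The intersection of all \<open>U n\<close> consists of the directions that are
  approximated to order \<open>\<tau>\<close> by \<open>R N\<close> for arbitrarily large
  \<open>N\<close>.\<close>

definition U :: "nat \<Rightarrow> complex set" where
  "U n = sphere 0 1 \<inter> (\<Union>N\<in>{real n<..}. \<Union>p\<in>R N. ball p (1 / N ^ \<tau>))"

definition G :: "complex set" where "G = (\<Inter>n. U n) \<inter> (sphere 0 1 - F)"

lemma openin_U: "openin (top_of_set (sphere 0 1)) (U n)"
  unfolding U_def by (intro openin_open_Int open_UN ballI open_ball)

lemma openin_F: "openin (top_of_set (sphere 0 1)) (sphere 0 1 - F)"
  using F by (simp add: Diff_eq openin_open_Int finite_imp_closed open_Compl)

lemma gdelta_G: "gdelta_in (top_of_set (sphere 0 1)) G"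
proof -
  have "G = \<Inter> (insert (sphere 0 1 - F) (range U))" by (auto simp: G_def)
  moreover have "gdelta_in (top_of_set (sphere 0 1)) \<dots>"
    by (rule gdelta_in_Inter) (use openin_U openin_F open_imp_gdelta_in in auto)
  ultimately show ?thesis by simp
qed

text \<open>The centres of the balls alone are dense, by ubiquity with \<open>N\<close>
  large.\<close>

lemma dense_U: "sphere 0 1 \<subseteq> closure (U n)"
proof
  fix u :: complex assume u: "u \<in> sphere 0 1"
  show "u \<in> closure (U n)"
    unfolding closure_approachable
  proof (intro allI impI)
    fix e :: real assume e: "0 < e"
    define N where "N = C + real n + 1 + C / e"
    have N: "C \<le> N" "real n < N" "C / e < N" using C e by (auto simp: N_def intro!: add_nonneg_nonneg add_pos_nonneg add_pos_pos divide_pos_pos)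
    obtain p where p: "p \<in> R N" "dist p u \<le> C / N" using ub[of u N] u N by auto
    have "0 < N" using N C by linarith
    hence "C / N < e" using N e by (simp add: field_simps)
    moreover have "p \<in> U n" unfolding U_def using p N R1[of p N] \<open>0 < N\<close> by (auto intro!: bexI[of _ N] bexI[of _ p])
    ultimately show "\<exists>y\<in>U n. dist y u < e" using p by force
  qed
qed

text \<open>The circle is connected with more than one point, hence perfect, and a finite set can be
  removed without losing limit points.\<close>

lemma dense_F: "sphere 0 1 \<subseteq> closure (sphere 0 1 - F)"
proof
  fix u :: complex assume u: "u \<in> sphere 0 1"
  have "connected (sphere (0::complex) 1)" by (rule connected_sphere) simp
  moreover have "\<not> (\<exists>x. sphere (0::complex) 1 = {x})"
  proof
    assume "\<exists>x. sphere (0::complex) 1 = {x}"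
    then obtain x where "sphere (0::complex) 1 = {x}" by blast
    moreover have "(1::complex) \<in> sphere 0 1" "(-1::complex) \<in> sphere 0 1" by auto
    ultimately show False by auto
  qed
  ultimately have "u islimpt sphere 0 1" using u connected_imp_perfect by blast
  hence "u islimpt ((sphere 0 1 - F) \<union> F)" by (rule islimpt_subset) auto
  hence "u islimpt (sphere 0 1 - F)" using F islimpt_finite islimpt_Un by metis
  thus "u \<in> closure (sphere 0 1 - F)" by (simp add: closure_def)
qed

lemma dense_G: "top_of_set (sphere 0 1) closure_of G = sphere 0 1"
proof -
  have "sphere 0 1 \<subseteq> closure (\<Inter> (insert (sphere 0 1 - F) (range U)))"
    by (rule Baire) (use openin_U openin_F dense_U dense_F in auto)
  moreover have "\<Inter> (insert (sphere 0 1 - F) (range U)) = G" by (auto simp: G_def)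
  moreover have "sphere 0 1 \<inter> G = G" by (auto simp: G_def)
  ultimately show ?thesis by (auto simp: closure_of_subtopology)
qed

section \<open>A Cantor subset of positive dimension\<close>

definition K :: nat where "K = 2 * \<tau> + 3"

lemma avoid_F: "\<exists>\<alpha> \<eta>. 0 < \<eta> \<and> (\<forall>x. \<alpha> \<le> x \<longrightarrow> x \<le> \<alpha> + \<eta> \<longrightarrow> cis x \<notin> F)"
proof -
  have "(1::complex) \<in> closure (sphere 0 1 - F)" using dense_F by auto
  hence "sphere (0::complex) 1 - F \<noteq> {}" by (metis closure_empty empty_iff)
  then obtain p :: complex where "p \<in> sphere 0 1 - F" by blast
  hence p: "norm p = 1" "p \<notin> F" by auto
  obtain \<alpha> where \<alpha>: "p = cis \<alpha>" using near_cis[OF p(1)] by metis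
  have "open (- F)" using F by (simp add: finite_imp_closed open_Compl)
  then obtain e where e: "0 < e" "ball p e \<subseteq> - F" using p(2) openE[of "- F" p] by auto
  have "cis x \<notin> F" if "\<alpha> \<le> x" "x \<le> \<alpha> + e / 2" for x
  proof -
    have "dist p (cis x) < e" using chord_le_arc[of \<alpha> x] that e(1) unfolding \<alpha> by linarith
    thus ?thesis using e(2) by auto
  qed
  thus ?thesis using e(1) by (intro exI[of _ \<alpha>] exI[of _ "e / 2"]) auto
qed

text \<open>The initial arc avoids \<open>F\<close>. Its length is a power of \<open>1/2\<close>, so
  that cells can be addressed by binary digits; the bound \<open>1/8\<close> makes
  \<open>L k ^ 3\<close> at most \<open>L k ^ 2 / 8\<close>, and the third bound absorbs the
  constant \<open>(8 * C) ^ \<tau>\<close> from the radius of the balls in \<open>U\<close>.\<close>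

definition start :: "real \<times> nat" where
  "start = (SOME (\<alpha>, a). 1 \<le> a \<and> (1/2) ^ a \<le> (1/8 :: real) \<and> (1/2) ^ a < 1 / (8 * C) ^ \<tau> \<and>
     (\<forall>x. \<alpha> \<le> x \<longrightarrow> x \<le> \<alpha> + (1/2) ^ a \<longrightarrow> cis x \<notin> F))"
definition \<alpha>0 :: real where "\<alpha>0 = fst start"
definition a0 :: nat where "a0 = snd start"

lemma start: "1 \<le> a0" "(1/2) ^ a0 \<le> (1/8 :: real)" "(1/2) ^ a0 < 1 / (8 * C) ^ \<tau>"
  "\<And>x. \<alpha>0 \<le> x \<Longrightarrow> x \<le> \<alpha>0 + (1/2) ^ a0 \<Longrightarrow> cis x \<notin> F"
proof -
  obtain \<alpha> \<eta> where a: "0 < \<eta>" "\<And>x. \<alpha> \<le> x \<Longrightarrow> x \<le> \<alpha> + \<eta> \<Longrightarrow> cis x \<notin> F" using avoid_F by blast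
  define m where "m = Min {1/8, 1 / (8 * C) ^ \<tau>, \<eta>}"
  have m: "0 < m" "m \<le> 1/8" "m \<le> 1 / (8 * C) ^ \<tau>" "m \<le> \<eta>" using C a by (auto simp: m_def)
  obtain n where n: "(1/2) ^ n < m" using real_arch_pow_inv[OF m(1), of "1/2"] by auto
  have n': "(1/2) ^ Suc n < m" using n m(1) by (simp add: field_simps)
  have "\<exists>s. (\<lambda>(\<alpha>, a). 1 \<le> a \<and> (1/2) ^ a \<le> (1/8 :: real) \<and> (1/2) ^ a < 1 / (8 * C) ^ \<tau> \<and>
     (\<forall>x. \<alpha> \<le> x \<longrightarrow> x \<le> \<alpha> + (1/2) ^ a \<longrightarrow> cis x \<notin> F)) s"
    by (rule exI[of _ "(\<alpha>, Suc n)"]) (use n' m a in \<open>auto simp del: power_Suc\<close>)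
  from someI_ex[OF this] have "(\<lambda>(\<alpha>, a). 1 \<le> a \<and> (1/2) ^ a \<le> (1/8 :: real) \<and> (1/2) ^ a < 1 / (8 * C) ^ \<tau> \<and>
     (\<forall>x. \<alpha> \<le> x \<longrightarrow> x \<le> \<alpha> + (1/2) ^ a \<longrightarrow> cis x \<notin> F)) start" unfolding start_def .
  thus "1 \<le> a0" "(1/2) ^ a0 \<le> (1/8 :: real)" "(1/2) ^ a0 < 1 / (8 * C) ^ \<tau>"
    "\<And>x. \<alpha>0 \<le> x \<Longrightarrow> x \<le> \<alpha>0 + (1/2) ^ a0 \<Longrightarrow> cis x \<notin> F"
    by (auto simp: \<alpha>0_def a0_def case_prod_beta)
qed

text \<open>Arcs of generation \<open>k\<close> have length \<open>L k\<close> and are cut into \<open>2 ^ aa k\<close> cells of length \<open>L k ^ 2\<close>, each of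
  which contains an arc of generation \<open>k + 1\<close> starting at a point of \<open>R (NN k)\<close>.\<close>

definition aa :: "nat \<Rightarrow> nat" where "aa k = a0 * K ^ k"
definition L :: "nat \<Rightarrow> real" where "L k = (1/2) ^ aa k"
definition NN :: "nat \<Rightarrow> real" where "NN k = 8 * C / L k ^ 2"
definition center :: "nat \<Rightarrow> real \<Rightarrow> int \<Rightarrow> real" where "center k \<alpha> i = \<alpha> + (of_int i + 1/2) * L k ^ 2"
definition child :: "nat \<Rightarrow> real \<Rightarrow> int \<Rightarrow> real" where
  "child k \<alpha> i = (SOME \<theta>. cis \<theta> \<in> R (NN k) \<and> \<bar>\<theta> - center k \<alpha> i\<bar> \<le> L k ^ 2 / 4)"

lemma K_ge: "3 \<le> K" by (simp add: K_def)
lemma aa_Suc: "aa (Suc k) = K * aa k" by (simp add: aa_def)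
lemma L_pos [simp]: "0 < L k" by (simp add: L_def)
lemma L_Suc: "L (Suc k) = L k ^ K" by (simp add: L_def aa_Suc power_mult mult.commute[of K])
lemma aa_ge: "k < aa k"
proof (induction k)
  case 0
  show ?case using start(1) by (simp add: aa_def)
next
  case (Suc k)
  have "3 * aa k \<le> aa (Suc k)" unfolding aa_Suc using K_ge by (intro mult_right_mono) auto
  thus ?case using Suc by simp
qed
lemma aa_mono: "aa 0 \<le> aa k" using K_ge by (simp add: aa_def)
lemma L_le: "L k \<le> L 0" unfolding L_def using aa_mono by (intro power_decreasing) auto
lemma L_0: "L 0 = (1/2) ^ a0" by (simp add: L_def aa_def)
lemma L_small: "L k \<le> 1/8" using start(2) L_le[of k] unfolding L_0 by linarith
lemma L_small': "L k < 1 / (8 * C) ^ \<tau>" using start(3) L_le[of k] unfolding L_0 by linarith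
lemma L_cell: "2 ^ aa k * L k = 1" by (simp add: L_def power_mult_distrib[symmetric])

lemma NN_ge: "C \<le> NN k" "real k < NN k"
proof -
  have l: "0 < L k ^ 2" "L k ^ 2 \<le> L k" "L k \<le> 1" using L_pos[of k] L_small[of k] by (auto simp: power2_eq_square)
  have "C * L k ^ 2 \<le> C * 8" using l C by (intro mult_left_mono) auto
  thus "C \<le> NN k" using l by (simp add: NN_def field_simps)
  have "real k < real (2 ^ aa k)" using aa_ge[of k] less_exp[of "aa k"] by (metis less_trans of_nat_less_iff)
  also have "real (2 ^ aa k) = 1 / L k" using L_cell[of k] L_pos[of k] by (simp add: nonzero_eq_divide_eq del: L_pos)
  also have "\<dots> \<le> 1 / L k ^ 2" using l by (simp add: frac_le)
  also have "\<dots> \<le> NN k" unfolding NN_def using C l by (intro divide_right_mono) auto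
  finally show "real k < NN k" .
qed

lemma child: "cis (child k \<alpha> i) \<in> R (NN k)" "\<bar>child k \<alpha> i - center k \<alpha> i\<bar> \<le> L k ^ 2 / 4"
proof -
  obtain p where p: "p \<in> R (NN k)" "dist p (cis (center k \<alpha> i)) \<le> C / NN k"
    using ub[of "cis (center k \<alpha> i)" "NN k"] NN_ge by auto
  obtain \<theta> where t: "p = cis \<theta>" "\<bar>\<theta> - center k \<alpha> i\<bar> \<le> 2 * dist p (cis (center k \<alpha> i))"
    using near_cis[OF R1[OF p(1)]] by metis
  \<comment> \<open>The factor 8 in \<open>NN\<close> is chosen for this: the approximation error
    \<open>L k ^ 2 / 8\<close> at most doubles from chord to angle and so stays within a quarter of
    a cell.\<close>
  have e: "C / NN k = L k ^ 2 / 8" using C by (simp add: NN_def)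
  have "\<bar>\<theta> - center k \<alpha> i\<bar> \<le> L k ^ 2 / 4" using p(2) t(2) unfolding e by linarith
  hence "cis \<theta> \<in> R (NN k) \<and> \<bar>\<theta> - center k \<alpha> i\<bar> \<le> L k ^ 2 / 4" using p t by simp
  from someI[of "\<lambda>\<theta>. cis \<theta> \<in> R (NN k) \<and> \<bar>\<theta> - center k \<alpha> i\<bar> \<le> L k ^ 2 / 4", OF this]
  show "cis (child k \<alpha> i) \<in> R (NN k)" "\<bar>child k \<alpha> i - center k \<alpha> i\<bar> \<le> L k ^ 2 / 4"
    unfolding child_def by auto
qed

lemma L_Suc_le: "L (Suc k) \<le> L k ^ 2 / 8"
proof -
  have "L (Suc k) \<le> L k ^ 3" unfolding L_Suc using K_ge L_small[of k] L_pos[of k] by (intro power_decreasing) (auto simp del: L_pos)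
  also have "\<dots> = L k * L k ^ 2" by (simp add: eval_nat_numeral)
  also have "\<dots> \<le> 1/8 * L k ^ 2" using L_small by (intro mult_right_mono) auto
  finally show ?thesis by simp
qed

lemma child_bounds:
  "\<alpha> + (of_int i + 1/4) * L k ^ 2 \<le> child k \<alpha> i" "child k \<alpha> i + L (Suc k) \<le> \<alpha> + (of_int i + 7/8) * L k ^ 2"
  using cell_bounds[OF child(2)[of k \<alpha> i, unfolded center_def] L_Suc_le] by auto

text \<open>Addressing of the Cantor set: \<open>fl k y\<close> is the integer formed by the first
  \<open>AA k\<close> binary digits of \<open>y\<close>, and the next block of \<open>aa k\<close>
  digits, \<open>dig k y\<close>, selects the cell in which the arc starting at
  \<open>al k y\<close> is continued. \<open>X y\<close> is the common point of the nested
  arcs.\<close>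

definition AA :: "nat \<Rightarrow> nat" where "AA k = (\<Sum>i<k. aa i)"
definition fl :: "nat \<Rightarrow> real \<Rightarrow> int" where "fl k y = \<lfloor>2 ^ AA k * y\<rfloor>"
definition dig :: "nat \<Rightarrow> real \<Rightarrow> int" where "dig k y = fl (Suc k) y - 2 ^ aa k * fl k y"
primrec al :: "nat \<Rightarrow> real \<Rightarrow> real" where
  "al 0 y = \<alpha>0" | "al (Suc k) y = child k (al k y) (dig k y)"
definition X :: "real \<Rightarrow> real" where "X y = (SUP k. al k y)"

lemma AA_Suc: "AA (Suc k) = AA k + aa k" by (simp add: AA_def)

lemma dig_range: "0 \<le> dig k y" "dig k y < 2 ^ aa k"
proof -
  define x where "x = 2 ^ AA k * y"
  have e: "fl (Suc k) y = \<lfloor>2 ^ aa k * x\<rfloor>" "fl k y = \<lfloor>x\<rfloor>" by (simp_all add: fl_def AA_Suc x_def power_add mult_ac)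
  have "of_int \<lfloor>x\<rfloor> \<le> x" "x < of_int \<lfloor>x\<rfloor> + 1" by linarith+
  hence "2 ^ aa k * of_int \<lfloor>x\<rfloor> \<le> 2 ^ aa k * x" "2 ^ aa k * x < 2 ^ aa k * (of_int \<lfloor>x\<rfloor> + 1)" by auto
  hence "of_int (2 ^ aa k * \<lfloor>x\<rfloor>) \<le> 2 ^ aa k * x" "2 ^ aa k * x < of_int (2 ^ aa k * \<lfloor>x\<rfloor> + 2 ^ aa k)"
    by (simp_all add: algebra_simps)
  hence "2 ^ aa k * \<lfloor>x\<rfloor> \<le> \<lfloor>2 ^ aa k * x\<rfloor>" "\<lfloor>2 ^ aa k * x\<rfloor> < 2 ^ aa k * \<lfloor>x\<rfloor> + 2 ^ aa k"
    by (simp_all only: le_floor_iff floor_less_iff)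
  thus "0 \<le> dig k y" "dig k y < 2 ^ aa k" unfolding dig_def e by linarith+
qed

text \<open>The arcs are nested: the digit addresses one of the \<open>2 ^ aa k\<close> cells, whose
  lengths \<open>L k ^ 2\<close> add up to \<open>L k\<close>.\<close>

lemma al_step: "al k y \<le> al (Suc k) y" "al (Suc k) y + L (Suc k) \<le> al k y + L k"
proof -
  have w: "0 \<le> L k ^ 2" by simp
  have "0 \<le> (of_int (dig k y) + 1/4) * L k ^ 2" using dig_range(1)[of k y] by (intro mult_nonneg_nonneg) auto
  thus "al k y \<le> al (Suc k) y" using child_bounds(1)[where \<alpha> = "al k y" and i = "dig k y" and k = k] by simp
  have "dig k y + 1 \<le> 2 ^ aa k" using dig_range(2)[of k y] by simp
  hence "of_int (dig k y + 1) \<le> (of_int (2 ^ aa k) :: real)" by (simp only: of_int_le_iff)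
  hence "(of_int (dig k y) + 7/8) * L k ^ 2 \<le> 2 ^ aa k * L k ^ 2" by (intro mult_right_mono) auto
  also have "\<dots> = L k" using L_cell[of k] by (simp add: power2_eq_square flip: mult.assoc)
  finally show "al (Suc k) y + L (Suc k) \<le> al k y + L k"
    using child_bounds(2)[where \<alpha> = "al k y" and i = "dig k y" and k = k] by simp
qed

lemma al_mono:
  assumes "k \<le> j" shows "al k y \<le> al j y" "al j y + L j \<le> al k y + L k"
proof -
  have "al k y \<le> al j y \<and> al j y + L j \<le> al k y + L k"
    using assms
  proof (induction j rule: dec_induct)
    case (step n)
    thus ?case using al_step[of n y] by linarith
  qed simp
  thus "al k y \<le> al j y" "al j y + L j \<le> al k y + L k" by auto
qed

lemma X_bounds: "al k y \<le> X y" "X y \<le> al k y + L k"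
proof -
  have ub: "al j y \<le> al k y + L k" for j k
  proof (cases "k \<le> j")
    case True
    thus ?thesis using al_mono(2)[OF True, of y] L_pos[of j] by linarith
  next
    case False
    hence "al j y \<le> al k y" by (intro al_mono) auto
    thus ?thesis using L_pos[of k] by linarith
  qed
  have bdd: "bdd_above (range (\<lambda>k. al k y))" using ub[of _ 0] by (auto intro!: bdd_aboveI)
  show "al k y \<le> X y" unfolding X_def by (rule cSUP_upper[OF _ bdd]) simp
  show "X y \<le> al k y + L k" unfolding X_def using ub by (intro cSUP_least) auto
qed

lemma X_in_G: "cis (X y) \<in> G"
proof -
  have "cis (X y) \<in> U n" for n
  proof -
    have "dist (cis (al (Suc n) y)) (cis (X y)) \<le> L (Suc n)"
      using chord_le_arc[of "al (Suc n) y" "X y"] X_bounds(1)[of "Suc n" y] X_bounds(2)[of y "Suc n"] by linarith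
    \<comment> \<open>Origin of \<open>K\<close>: the factor \<open>L n ^ (2 * \<tau>)\<close> is
      the radius of the ball up to the constant \<open>(8 * C) ^ \<tau>\<close>, and the cube, being
      at most \<open>L n\<close>, beats that constant.\<close>
    also have "L (Suc n) = L n ^ (2 * \<tau>) * L n ^ 3" by (simp add: L_Suc K_def power_add)
    also have "\<dots> < L n ^ (2 * \<tau>) * (1 / (8 * C) ^ \<tau>)"
    proof (rule mult_strict_left_mono)
      have "L n ^ 3 \<le> L n ^ 1" using L_small[of n] less_imp_le[OF L_pos[of n]] by (intro power_decreasing) (simp_all del: L_pos)
      thus "L n ^ 3 < 1 / (8 * C) ^ \<tau>" using L_small'[of n] by simp
    qed simp
    also have "\<dots> = 1 / NN n ^ \<tau>" by (simp add: NN_def power_divide power_mult)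
    finally have "cis (X y) \<in> ball (cis (al (Suc n) y)) (1 / NN n ^ \<tau>)" by simp
    moreover have "cis (al (Suc n) y) \<in> R (NN n)" using child(1) by simp
    ultimately show ?thesis unfolding U_def using NN_ge(2)[of n] by auto
  qed
  moreover have "cis (X y) \<notin> F" using start(4)[of "X y"] X_bounds(1)[of 0 y] X_bounds(2)[of y 0] by (simp add: L_def aa_def)
  ultimately show ?thesis by (auto simp: G_def)
qed

text \<open>Let \<open>k + 1\<close> be the first generation at which the digits of \<open>y\<close>
  and \<open>z\<close> differ. The two points then lie in different cells of one arc of generation
  \<open>k\<close>, so their distance is at least a constant times \<open>L k ^ 2\<close>, hence at
  least \<open>L k ^ 3\<close>, the power \<open>3 * K\<close> of the previous length. The
  difference of \<open>y\<close> and \<open>z\<close> is at most that previous length. At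
  \<open>k = 0\<close> there is no previous arc, and the factor \<open>(1 / L 0) ^ (3 * K)\<close>
  compensates.\<close>

lemma X_holder:
  assumes y: "0 \<le> y" "y < 1" and z: "0 \<le> z" "z < 1"
  shows "\<bar>y - z\<bar> ^ (3 * K) \<le> (1 / L 0) ^ (3 * K) * dist (cis (X y)) (cis (X z))"
proof (cases "y = z")
  case True
  thus ?thesis using K_ge by (simp add: power_0_left)
next
  case False
  have close: "\<bar>y - z\<bar> < 1 / 2 ^ AA k" if "fl k y = fl k z" for k
  proof -
    have "\<bar>2 ^ AA k * y - 2 ^ AA k * z\<bar> < 1" using that unfolding fl_def by linarith
    hence "2 ^ AA k * \<bar>y - z\<bar> < 1" by (simp add: abs_mult flip: right_diff_distrib)
    thus ?thesis by (simp add: field_simps)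
  qed
  have "\<exists>k. fl k y \<noteq> fl k z"
  proof (rule ccontr)
    assume a: "\<not> ?thesis"
    obtain n where n: "(1/2) ^ n < \<bar>y - z\<bar>" using real_arch_pow_inv[of "\<bar>y - z\<bar>" "1/2"] False by auto
    have AA: "n \<le> AA (Suc n)" using aa_ge[of n] by (simp add: AA_Suc)
    have "\<bar>y - z\<bar> < (1/2) ^ AA (Suc n)" using close[of "Suc n"] a by (simp add: power_divide)
    also have "\<dots> \<le> (1/2) ^ n" using AA by (intro power_decreasing) auto
    finally show False using n by simp
  qed
  define j where "j = (LEAST k. fl k y \<noteq> fl k z)"
  have j: "fl j y \<noteq> fl j z" unfolding j_def using \<open>\<exists>k. _\<close> by (rule LeastI_ex)
  have jl: "fl i y = fl i z" if "i < j" for i using not_less_Least[of i "\<lambda>k. fl k y \<noteq> fl k z"] that unfolding j_def by blast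
  have "fl 0 y = fl 0 z" using y z floor_unique[of 0 y] floor_unique[of 0 z] by (simp add: fl_def AA_def)
  with j obtain k where k: "j = Suc k" by (cases j) auto
  have fk: "fl i y = fl i z" if "i \<le> k" for i using jl[of i] that k by simp
  have "al i y = al i z" if "i \<le> k" for i using that
  proof (induction i)
    case (Suc i)
    thus ?case using fk[of i] fk[of "Suc i"] by (simp add: dig_def)
  qed simp
  hence al: "al k y = al k z" by simp
  have dne: "dig k y \<noteq> dig k z" using j fk[of k] unfolding k dig_def by simp
  have sep: "L k ^ 2 / 4 \<le> X z - X y" if "al k y = al k z" "dig k y < dig k z" for y z
  proof -
    have "X y \<le> child k (al k y) (dig k y) + L (Suc k)" using X_bounds(2)[of y "Suc k"] by simp
    also have "\<dots> \<le> al k y + (of_int (dig k y) + 7/8) * L k ^ 2" by (rule child_bounds)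
    finally have 1: "X y \<le> al k y + (of_int (dig k y) + 7/8) * L k ^ 2" .
    have 2: "al k y + (of_int (dig k z) + 1/4) * L k ^ 2 \<le> X z"
      using child_bounds(1)[where \<alpha> = "al k z" and i = "dig k z" and k = k] X_bounds(1)[of "Suc k" z] that by simp
    have "of_int (dig k y) + 1 \<le> (of_int (dig k z) :: real)" using that(2) by linarith
    hence "(of_int (dig k y) + 1) * L k ^ 2 \<le> of_int (dig k z) * L k ^ 2" by (intro mult_right_mono) auto
    from cell_gap[OF 1 2 this] show ?thesis by simp
  qed
  have "L k ^ 2 / 4 \<le> \<bar>X y - X z\<bar>"
  proof (cases "dig k y < dig k z")
    case True
    have "L k ^ 2 / 4 \<le> - (X y - X z)" using sep[OF al True] by simp
    also have "\<dots> \<le> \<bar>X y - X z\<bar>" by (rule abs_ge_minus_self)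
    finally show ?thesis .
  next
    case False
    hence "dig k z < dig k y" using dne by simp
    from sep[OF al[symmetric] this] abs_ge_self[of "X y - X z"] show ?thesis by (rule order_trans)
  qed
  moreover have "\<bar>X y - X z\<bar> \<le> pi"
    using X_bounds(1)[of 0 y] X_bounds(2)[of y 0] X_bounds(1)[of 0 z] X_bounds(2)[of z 0] L_small[of 0] pi_gt3
    by (simp add: abs_le_iff)
  hence "\<bar>X y - X z\<bar> \<le> 2 * dist (cis (X y)) (cis (X z))" by (rule arc_le_chord)
  ultimately have D: "L k ^ 2 / 8 \<le> dist (cis (X y)) (cis (X z))" by linarith
  have "L k ^ 3 \<le> 1/8 * L k ^ 2"
    using mult_right_mono[OF L_small[of k], of "L k ^ 2"] by (simp add: eval_nat_numeral)
  hence D3: "L k ^ 3 \<le> dist (cis (X y)) (cis (X z))" using D by simp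
  have "\<bar>y - z\<bar> ^ (3 * K) \<le> (1 / L 0) ^ (3 * K) * L k ^ 3"
  proof (cases k)
    case 0
    have L1: "L 0 \<le> 1" using L_small[of 0] by simp
    have "\<bar>y - z\<bar> ^ (3 * K) \<le> 1" using y z by (intro power_le_one) auto
    also have "\<dots> \<le> (1 / L 0) ^ (3 * K) * L 0 ^ (3 * K)" using L_pos[of 0] by (simp add: power_divide del: L_pos)
    also have "\<dots> \<le> (1 / L 0) ^ (3 * K) * L 0 ^ 3"
      using L1 K_ge L_pos[of 0] by (intro mult_left_mono power_decreasing) (auto intro: less_imp_le)
    finally show ?thesis using 0 by simp
  next
    case (Suc i)
    have "\<bar>y - z\<bar> \<le> 1 / 2 ^ AA k" using close fk[of k] by (simp add: less_imp_le)
    \<comment> \<open>\<open>AA k\<close> includes the summand \<open>aa i\<close> of the preceding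
      generation.\<close>
    also have "\<dots> \<le> L i" unfolding L_def power_one_over Suc AA_Suc by (intro divide_left_mono power_increasing) auto
    finally have "\<bar>y - z\<bar> ^ (3 * K) \<le> L i ^ (3 * K)" by (intro power_mono) auto
    also have "\<dots> = L k ^ 3" unfolding Suc L_Suc by (simp add: power_mult[symmetric] mult.commute)
    also have "\<dots> \<le> (1 / L 0) ^ (3 * K) * L k ^ 3"
    proof -
      have "1 \<le> (1 / L 0) ^ (3 * K)" using L_small[of 0] L_pos[of 0] by (intro one_le_power) (simp add: field_simps)
      thus ?thesis using mult_right_mono[of 1 "(1 / L 0) ^ (3 * K)" "L k ^ 3"] L_pos[of k] by simp
    qed
    finally show ?thesis .
  qed
  also have "\<dots> \<le> (1 / L 0) ^ (3 * K) * dist (cis (X y)) (cis (X z))"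
    using D3 L_pos[of 0] by (intro mult_left_mono) (auto intro: less_imp_le)
  finally show ?thesis .
qed

lemma dim_G: "0 < hausdorff_dim G"
  by (rule hausdorff_dim_pos[of "\<lambda>y. cis (X y)" G "3 * K" "(1 / L 0) ^ (3 * K)"])
    (use X_in_G X_holder K_ge in auto)

end

section \<open>Preliminaries on vectors and limits\<close>

text \<open>The determinant of the two plane vectors, that is, their oriented area.\<close>

definition wedge :: "complex \<Rightarrow> complex \<Rightarrow> real" where "wedge z w = Im (cnj z * w)"

lemma wedge_le: "\<bar>wedge z w\<bar> \<le> norm z * norm w"
  unfolding wedge_def by (metis abs_Im_le_cmod complex_mod_cnj norm_mult)

lemma wedge_linear: "wedge z (x *\<^sub>R v + y *\<^sub>R w) = x * wedge z v + y * wedge z w"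
  by (simp add: wedge_def algebra_simps)

lemma wedge_self [simp]: "wedge z z = 0" by (simp add: wedge_def)

lemma wedge_scale: "wedge (x *\<^sub>R z) w = x * wedge z w" by (simp add: wedge_def algebra_simps)

lemma wedge_rotate: "norm w = 1 \<Longrightarrow> wedge (w * y) (w * z) = wedge y z"
proof -
  assume "norm w = 1"
  hence 1: "cnj w * w = 1" using complex_norm_square[of w] by (simp add: mult.commute)
  have "cnj (w * y) * (w * z) = (cnj w * w) * (cnj y * z)" by (simp add: mult_ac)
  hence "cnj (w * y) * (w * z) = cnj y * z" unfolding 1 by simp
  thus ?thesis unfolding wedge_def by (simp only:)
qed

text \<open>Inner product and wedge are the cosine and sine of the angle between the unit vectors. A
  small sine makes them close or nearly opposite; the sign of the cosine decides which.\<close>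

lemma unit_dist_wedge:
  assumes "norm p = 1" "norm u = 1" shows "norm (p - u) \<le> 2 * \<bar>wedge p u\<bar> \<or> norm (p + u) \<le> 2 * \<bar>wedge p u\<bar>"
proof -
  define c where "c = p \<bullet> u"
  define w where "w = wedge p u"
  have "c ^ 2 + w ^ 2 = norm p ^ 2 * norm u ^ 2"
    unfolding c_def w_def wedge_def cmod_power2 inner_complex_def by (simp add: power2_eq_square algebra_simps)
  hence cw: "w ^ 2 = (1 - c) * (1 + c)" using assms by (simp add: power2_eq_square algebra_simps)
  have c1: "\<bar>c\<bar> \<le> 1" using Cauchy_Schwarz_ineq2[of p u] assms by (simp add: c_def)
  have m: "norm (p - u) ^ 2 = 2 * (1 - c)" "norm (p + u) ^ 2 = 2 * (1 + c)"
    using assms unfolding c_def by (simp_all add: power2_norm_eq_inner inner_diff inner_add inner_commute algebra_simps norm_eq_1)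
  show ?thesis
  proof (cases "0 \<le> c")
    case True
    hence "(1 - c) * 1 \<le> (1 - c) * (1 + c)" using c1 by (intro mult_left_mono) auto
    hence "2 * (1 - c) \<le> 4 * ((1 - c) * (1 + c))" using c1 by (simp del: mult_le_cancel_left1)
    hence "norm (p - u) ^ 2 \<le> (2 * \<bar>w\<bar>) ^ 2" unfolding m power_mult_distrib power2_abs cw by simp
    thus ?thesis unfolding w_def by (intro disjI1) (rule power2_le_imp_le, auto)
  next
    case False
    hence "1 * (1 + c) \<le> (1 - c) * (1 + c)" using c1 by (intro mult_right_mono) auto
    hence "2 * (1 + c) \<le> 4 * ((1 - c) * (1 + c))" using c1 by (simp del: mult_le_cancel_right1)
    hence "norm (p + u) ^ 2 \<le> (2 * \<bar>w\<bar>) ^ 2" unfolding m power_mult_distrib power2_abs cw by simp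
    thus ?thesis unfolding w_def by (intro disjI2) (rule power2_le_imp_le, auto)
  qed
qed

lemma antitone_tendsto:
  fixes f :: "real \<Rightarrow> real"
  assumes anti: "\<And>x y. 0 < x \<Longrightarrow> x \<le> y \<Longrightarrow> f y \<le> f x" and le: "\<And>x. f x \<le> c"
    and lim: "(\<lambda>k. f (1 / real (Suc k))) \<longlonglongrightarrow> c" and e: "e \<longlonglongrightarrow> 0" "\<And>k. 0 < e k"
  shows "(\<lambda>k. f (e k)) \<longlonglongrightarrow> c"
proof (rule order_tendstoI)
  fix a assume "a < c"
  from order_tendstoD(1)[OF lim this] obtain k where k: "a < f (1 / real (Suc k))"
    by (auto simp: eventually_sequentially)
  have "eventually (\<lambda>n. e n < 1 / real (Suc k)) sequentially" using e(1) by (rule order_tendstoD(2)) simp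
  thus "eventually (\<lambda>n. a < f (e n)) sequentially"
  proof (rule eventually_mono)
    fix n assume "e n < 1 / real (Suc k)"
    hence "f (1 / real (Suc k)) \<le> f (e n)" using e(2) by (intro anti) auto
    thus "a < f (e n)" using k by simp
  qed
next
  fix a assume "c < a"
  thus "eventually (\<lambda>n. f (e n) < a) sequentially" using le by (intro always_eventually allI) (meson le_less_trans)
qed

section \<open>The glued polygon\<close>

locale regular_polygon =
  fixes d :: nat
  assumes d_ge: "2 \<le> d"
begin

definition b :: real where "b = pi / (2 * real d)"

text \<open>The outer unit normals of the sides; the inradius is \<open>cos b\<close>.\<close>

definition nrm :: "nat \<Rightarrow> complex" where "nrm k = cis ((2 * real k + 1) * b)"

abbreviation "P \<equiv> polygon d"
abbreviation "V \<equiv> range (vertex d)"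

lemma b_pos: "0 < b" and b_le: "b \<le> pi / 4" and db: "2 * real d * b = pi"
  using d_ge by (auto simp: b_def field_simps)

lemma sin_b_pos: "0 < sin b"
  using b_pos b_le by (intro sin_gt_zero) (auto intro: order.strict_trans1 simp: field_simps)

lemma cos_b_pos: "0 < cos b"
  using b_pos b_le by (intro cos_gt_zero) (use pi_gt_zero in linarith)+

lemma vertex_cis: "vertex d k = cis (2 * real k * b)"
  using d_ge by (simp add: vertex_def b_def field_simps)

lemma vertex_add_d: "vertex d (k + d) = - vertex d k"
proof -
  have "2 * real (k + d) * b = 2 * real k * b + pi" using db by (simp add: algebra_simps)
  thus ?thesis unfolding vertex_cis by (simp add: complex_eq_iff)
qed

lemma nrm_add_d: "nrm (k + d) = - nrm k"
proof -
  have "(2 * real (k + d) + 1) * b = (2 * real k + 1) * b + pi" using db by (simp add: algebra_simps)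
  thus ?thesis unfolding nrm_def by (simp add: complex_eq_iff)
qed

lemma vertex_mult: "vertex d (k + 2 * d * i) = vertex d k"
proof (induction i)
  case (Suc i)
  have "k + 2 * d * Suc i = k + 2 * d * i + d + d" by simp
  thus ?case using Suc by (simp only: vertex_add_d minus_minus)
qed simp

lemma nrm_mult: "nrm (k + 2 * d * i) = nrm k"
proof (induction i)
  case (Suc i)
  have "k + 2 * d * Suc i = k + 2 * d * i + d + d" by simp
  thus ?case using Suc by (simp only: nrm_add_d minus_minus)
qed simp

lemma vertex_mod: "vertex d (k mod (2 * d)) = vertex d k"
  by (metis vertex_mult mod_mult_div_eq)

lemma nrm_mod: "nrm (k mod (2 * d)) = nrm k"
  by (metis nrm_mult mod_mult_div_eq)

lemma vertex_Suc_mod: "vertex d (k mod (2 * d) + 1) = vertex d (k + 1)"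
  by (metis vertex_mod mod_add_left_eq)

lemma side_mod: "side d (k mod (2 * d)) = side d k"
  unfolding side_def by (simp only: vertex_mod vertex_Suc_mod)

lemma side_shift_eq: "side_shift d k = - (vertex d k + vertex d (k + 1))"
proof -
  have "vertex d (k + d + 1) = - vertex d (k + 1)" using vertex_add_d[of "k+1"] by (simp add: add_ac)
  thus ?thesis unfolding side_shift_def by simp
qed

lemma side_shift_mod: "side_shift d (k mod (2 * d)) = side_shift d k"
  unfolding side_shift_eq by (simp only: vertex_mod vertex_Suc_mod)

lemma V_eq: "V = vertex d ` {..<2 * d}"
proof -
  have "vertex d k \<in> vertex d ` {..<2 * d}" for k
    using d_ge by (intro rev_image_eqI[of "k mod (2 * d)"]) (auto simp: vertex_mod)
  thus ?thesis by blast
qed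

lemma finite_V: "finite V" unfolding V_eq by simp

lemma norm_vertex [simp]: "norm (vertex d k) = 1" by (simp add: vertex_def)

lemma inner_cis: "cis x \<bullet> cis y = cos (x - y)"
  by (simp add: inner_complex_def cos_diff)

text \<open>The difference of the two cosines is \<open>2 * sin (m * b) * sin ((m + 1) * b)\<close>.
  Consecutive multiples of \<open>b = pi / (2 * d)\<close> are never strictly separated by a
  multiple of \<open>pi\<close>, so the product is nonnegative; it vanishes iff one of them is such
  a multiple.\<close>

lemma cos_odd_le:
  fixes m :: int
  shows "cos ((2 * of_int m + 1) * b) \<le> cos b"
    and "cos ((2 * of_int m + 1) * b) = cos b \<longleftrightarrow> int (2 * d) dvd m \<or> int (2 * d) dvd (m + 1)"
proof -
  define D where "D = int (2 * d)"
  define q r where "q = m div D" and "r = m mod D"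
  have D: "D \<ge> 4" using d_ge by (simp add: D_def)
  have m: "m = D * q + r" by (simp add: q_def r_def)
  have r: "0 \<le> r" "r < D" using D by (auto simp: r_def)
  have Db: "of_int D * b = pi" using db by (simp add: D_def)
  have "of_int m * b = of_int r * b + of_int q * pi"
    unfolding m by (simp add: algebra_simps flip: Db)
  moreover have "of_int (m + 1) * b = of_int (r + 1) * b + of_int q * pi"
    unfolding m by (simp add: algebra_simps flip: Db)
  \<comment> \<open>A shift by \<open>q * pi\<close> multiplies both sines by the same sign.\<close>
  moreover have "sin (x + of_int q * pi) * sin (y + of_int q * pi) = sin x * sin y" for x y :: real
  proof -
    have "sin (of_int q * pi) = 0" by (metis sin_zero_iff_int2)
    moreover have "cos (of_int q * pi) ^ 2 = 1" using calculation sin_cos_squared_add2[of "of_int q * pi"] by simp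
    ultimately show ?thesis by (simp add: sin_add power2_eq_square algebra_simps)
  qed
  ultimately have prod: "sin (of_int m * b) * sin (of_int (m + 1) * b) = sin (of_int r * b) * sin (of_int (r + 1) * b)"
    by simp
  have bnd: "0 \<le> of_int r * b" "of_int r * b < pi" "0 < of_int (r+1) * b" "of_int (r + 1) * b \<le> pi"
    using r b_pos Db mult_strict_right_mono[of "of_int r" "of_int D" b] mult_right_mono[of "of_int (r+1)" "of_int D" b]
    by (auto simp del: of_int_add simp: mult_pos_pos)
  have rb: "0 < of_int r * b" if "r \<noteq> 0" using that r b_pos by (intro mult_pos_pos) auto
  have id: "cos b - cos ((2 * of_int m + 1) * b) = 2 * (sin (of_int m * b) * sin (of_int (m + 1) * b))"
    by (simp add: cos_diff_cos algebra_simps add_divide_distrib)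
  have ge: "0 \<le> sin (of_int r * b) * sin (of_int (r + 1) * b)"
    by (rule mult_nonneg_nonneg; rule sin_ge_zero) (use bnd in linarith)+
  show "cos ((2 * of_int m + 1) * b) \<le> cos b" using id prod ge by linarith
  have z1: "sin (of_int r * b) = 0 \<longleftrightarrow> r = 0"
    using bnd(2) rb sin_gt_zero[of "of_int r * b"] by (cases "r = 0") force+
  have z2: "sin (of_int (r + 1) * b) = 0 \<longleftrightarrow> r + 1 = D"
  proof
    assume s: "sin (of_int (r + 1) * b) = 0"
    have "\<not> of_int (r + 1) * b < pi" using s bnd(3) sin_gt_zero[of "of_int (r+1) * b"] by force
    hence "of_int (r + 1) * b = of_int D * b" using bnd Db by linarith
    thus "r + 1 = D" using b_pos by (simp del: of_int_add)
  next
    assume "r + 1 = D"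
    thus "sin (of_int (r + 1) * b) = 0" using Db by (simp del: of_int_add)
  qed
  have d1: "D dvd m \<longleftrightarrow> r = 0" by (simp add: r_def dvd_eq_mod_eq_0)
  have d2: "D dvd (m + 1) \<longleftrightarrow> r + 1 = D"
  proof -
    have "D dvd (m + 1) \<longleftrightarrow> D dvd (r + 1)" unfolding m by (simp add: dvd_add_right_iff add.assoc)
    also have "\<dots> \<longleftrightarrow> r + 1 = D" using r zdvd_imp_le[of D "r + 1"] by auto
    finally show ?thesis .
  qed
  show "cos ((2 * of_int m + 1) * b) = cos b \<longleftrightarrow> int (2 * d) dvd m \<or> int (2 * d) dvd (m + 1)"
    unfolding D_def[symmetric] d1 d2 using id prod z1 z2 by auto
qed

lemma nrm_inner_vertex: "nrm k \<bullet> vertex d j = cos ((2 * of_int (int k - int j) + 1) * b)"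
  unfolding nrm_def vertex_cis inner_cis by (simp add: algebra_simps)

lemma nrm_vertex_le: "nrm k \<bullet> vertex d j \<le> cos b"
  unfolding nrm_inner_vertex by (rule cos_odd_le)

lemma nrm_vertex_same: "nrm k \<bullet> vertex d k = cos b" "nrm k \<bullet> vertex d (k + 1) = cos b"
  unfolding nrm_inner_vertex by (auto simp: algebra_simps)

lemma dvd_int_diff_mod:
  assumes "int (2 * d) dvd (int k - int j)" shows "k mod (2 * d) = j mod (2 * d)"
  using assms by (metis mod_eq_dvd_iff of_nat_eq_iff zmod_int)

lemma nrm_vertex_eqD:
  assumes "nrm k \<bullet> vertex d j = cos b"
  shows "j mod (2 * d) = k mod (2 * d) \<or> j mod (2 * d) = (k + 1) mod (2 * d)"
proof -
  from assms have "int (2 * d) dvd (int k - int j) \<or> int (2 * d) dvd (int (k + 1) - int j)"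
    unfolding nrm_inner_vertex cos_odd_le(2) by (simp add: algebra_simps)
  thus ?thesis using dvd_int_diff_mod by metis
qed

lemma polygon_nrm_le: "p \<in> P \<Longrightarrow> nrm k \<bullet> p \<le> cos b"
proof -
  have "P \<subseteq> {p. nrm k \<bullet> p \<le> cos b}"
    unfolding polygon_def by (rule hull_minimal) (auto simp: nrm_vertex_le convex_halfspace_le)
  thus "p \<in> P \<Longrightarrow> nrm k \<bullet> p \<le> cos b" by blast
qed

lemma vertex_in_P [simp]: "vertex d k \<in> P" by (simp add: polygon_def hull_inc)

lemma convex_P: "convex P" by (simp add: polygon_def)

lemma compact_P: "compact P" unfolding polygon_def by (intro finite_imp_compact_convex_hull finite_V)

lemma closed_P: "closed P" using compact_P by (rule compact_imp_closed)

lemma norm_P: "p \<in> P \<Longrightarrow> norm p \<le> 1"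
proof -
  have "P \<subseteq> cball 0 1" unfolding polygon_def by (rule hull_minimal) auto
  thus "p \<in> P \<Longrightarrow> norm p \<le> 1" by auto
qed

lemma side_subset_P: "side d k \<subseteq> P"
  unfolding side_def using convex_P by (simp add: closed_segment_subset)

lemma side_nrm: "p \<in> side d k \<Longrightarrow> nrm k \<bullet> p = cos b"
  unfolding side_def closed_segment_def
  by (auto simp: inner_add_right nrm_vertex_same[simplified] left_diff_distrib)

text \<open>The polygon lies in the unit disc, and the line at distance \<open>cos b\<close> from
  the origin cuts the disc exactly in the chord between two adjacent vertices.\<close>

lemma side_iff: "p \<in> side d k \<longleftrightarrow> p \<in> P \<and> nrm k \<bullet> p = cos b"
proof
  assume "p \<in> P \<and> nrm k \<bullet> p = cos b"
  hence p: "norm p \<le> 1" and n: "nrm k \<bullet> p = cos b" using norm_P by auto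
  define q where "q = cnj (nrm k) * p"
  have nk: "nrm k * cnj (nrm k) = 1" by (simp add: nrm_def cis_cnj cis_mult)
  have pq: "p = nrm k * q" unfolding q_def using nk by (simp flip: mult.assoc)
  have req: "Re q = cos b" using n by (simp add: q_def inner_complex_def)
  have "norm q \<le> 1" using p by (simp add: q_def norm_mult nrm_def)
  hence "Re q ^ 2 + Im q ^ 2 \<le> 1" by (simp flip: cmod_power2 add: power_le_one)
  hence "Im q ^ 2 \<le> sin b ^ 2" unfolding req by (simp add: cos_squared_eq)
  hence im: "\<bar>Im q\<bar> \<le> sin b" using sin_b_pos by (simp add: abs_le_square_iff[symmetric])
  define t where "t = (Im q + sin b) / (2 * sin b)"
  have t: "0 \<le> t" "t \<le> 1" using im sin_b_pos by (auto simp: t_def field_simps)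
  have v1: "vertex d k = nrm k * cis (- b)" and v2: "vertex d (k+1) = nrm k * cis b"
    unfolding vertex_cis nrm_def cis_mult by (simp_all add: algebra_simps)
  have "q = (1 - t) *\<^sub>R cis (- b) + t *\<^sub>R cis b"
    using sin_b_pos by (auto simp: complex_eq_iff req t_def field_simps)
  hence "p = nrm k * ((1 - t) *\<^sub>R cis (- b) + t *\<^sub>R cis b)" using pq by simp
  hence "p = (1 - t) *\<^sub>R vertex d k + t *\<^sub>R vertex d (k + 1)"
    unfolding v1 v2 by (simp add: distrib_left scaleR_conv_of_real)
  thus "p \<in> side d k" using t unfolding side_def closed_segment_def by auto
qed (use side_subset_P side_nrm in auto)

lemma vertex_in_side: "vertex d j \<in> side d k \<Longrightarrow> vertex d j = vertex d k \<or> vertex d j = vertex d (k + 1)"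
  using nrm_vertex_eqD side_nrm vertex_mod by metis

lemma side_nonvertexE:
  assumes "p \<in> side d k" "p \<notin> V"
  obtains t where "0 < t" "t < 1" "p = (1 - t) *\<^sub>R vertex d k + t *\<^sub>R vertex d (k + 1)"
proof -
  from assms(1) obtain t where t: "0 \<le> t" "t \<le> 1" "p = (1 - t) *\<^sub>R vertex d k + t *\<^sub>R vertex d (k + 1)"
    unfolding side_def closed_segment_def by auto
  have "t \<noteq> 0" "t \<noteq> 1" using t assms(2) by auto
  thus ?thesis using t by (intro that[of t]) auto
qed

text \<open>The functional \<open>nrm j\<close> attains its maximum at a point strictly between two
  vertices only if it does so at both of them.\<close>

lemma side_unique:
  assumes "p \<in> side d k" "p \<in> side d j" "p \<notin> V"
  shows "k mod (2 * d) = j mod (2 * d)"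
proof -
  from assms obtain t where t: "0 < t" "t < 1" and p: "p = (1 - t) *\<^sub>R vertex d k + t *\<^sub>R vertex d (k + 1)"
    using side_nonvertexE by metis
  have "(1 - t) * (nrm j \<bullet> vertex d k) + t * (nrm j \<bullet> vertex d (k+1)) = cos b"
    using side_nrm[OF assms(2)] unfolding p by (simp add: inner_add_right)
  moreover have "(1 - t) * (nrm j \<bullet> vertex d k) \<le> (1 - t) * cos b" "t * (nrm j \<bullet> vertex d (k+1)) \<le> t * cos b"
    using t nrm_vertex_le by (auto intro: mult_left_mono)
  moreover have "(1 - t) * cos b + t * cos b = cos b" by (simp add: algebra_simps)
  ultimately have "(1 - t) * (nrm j \<bullet> vertex d k) = (1 - t) * cos b" "t * (nrm j \<bullet> vertex d (k+1)) = t * cos b"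
    by linarith+
  hence "nrm j \<bullet> vertex d k = cos b" "nrm j \<bullet> vertex d (k+1) = cos b" using t by auto
  hence e: "int (2 * d) dvd (int j - int k) \<or> int (2 * d) dvd (int j - int k + 1)"
      "int (2 * d) dvd (int j - int (k + 1)) \<or> int (2 * d) dvd (int j - int (k + 1) + 1)"
    unfolding nrm_inner_vertex cos_odd_le(2) by auto
  \<comment> \<open>Otherwise the endpoints of the two sides would be matched in reversed order, and
    \<open>2 * d\<close> would divide 2.\<close>
  have "int (2 * d) dvd (int j - int k)"
  proof (rule ccontr)
    assume n: "\<not> ?thesis"
    with e have "int (2 * d) dvd (int j - int k + 1)" "int (2 * d) dvd (int j - int (k + 1))" by auto
    hence "int (2 * d) dvd ((int j - int k + 1) - (int j - int (k + 1)))" by (rule dvd_diff)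
    hence "int (2 * d) dvd 2" by simp
    thus False using d_ge zdvd_imp_le[of "int (2*d)" 2] by simp
  qed
  thus ?thesis using dvd_int_diff_mod by metis
qed

lemma side_shift_add_d: "side_shift d (k + d) = - side_shift d k"
  using vertex_add_d[of k] vertex_add_d[of "k+1"] unfolding side_shift_eq by simp

lemma side_shift_in: "p \<in> side d k \<Longrightarrow> p + side_shift d k \<in> side d (k + d)"
proof -
  assume "p \<in> side d k"
  then obtain t where t: "0 \<le> t" "t \<le> 1" "p = (1 - t) *\<^sub>R vertex d k + t *\<^sub>R vertex d (k + 1)"
    unfolding side_def closed_segment_def by auto
  have "p + side_shift d k = (1 - (1 - t)) *\<^sub>R vertex d (k + d) + (1 - t) *\<^sub>R vertex d (k + d + 1)"
    using vertex_add_d[of k] vertex_add_d[of "k+1"] unfolding side_shift_eq t(3)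
    by (simp add: algebra_simps)
  moreover have "0 \<le> 1 - t" "1 - t \<le> 1" using t by auto
  ultimately show ?thesis unfolding side_def closed_segment_def by blast
qed

lemma shift_nonvertex:
  assumes "p \<in> side d k" "p \<notin> V" shows "p + side_shift d k \<notin> V"
proof
  assume "p + side_shift d k \<in> V"
  then obtain j where "p + side_shift d k = vertex d j" by auto
  hence "p + side_shift d k = vertex d (k + d) \<or> p + side_shift d k = vertex d (k + d + 1)"
    using vertex_in_side[of j "k + d"] side_shift_in[OF assms(1)] by auto
  hence "p = vertex d (k+1) \<or> p = vertex d k"
    using vertex_add_d[of k] vertex_add_d[of "k+1"] unfolding side_shift_eq by (auto simp: algebra_simps)
  with assms(2) show False by auto
qed

lemma shift_vertex:
  assumes "p \<in> side d k" "p \<in> V" shows "p + side_shift d k \<in> V"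
proof -
  from assms have "p = vertex d k \<or> p = vertex d (k+1)" using vertex_in_side by auto
  thus ?thesis
  proof
    assume "p = vertex d k"
    hence "p + side_shift d k = vertex d (k + 1 + d)" unfolding side_shift_eq vertex_add_d by simp
    thus ?thesis by auto
  next
    assume "p = vertex d (k+1)"
    hence "p + side_shift d k = vertex d (k + d)" unfolding side_shift_eq vertex_add_d by simp
    thus ?thesis by auto
  qed
qed

section \<open>Classes of the gluing relation\<close>

lemma side_pairing_sym: "sym (side_pairing d)"
proof (rule symI)
  fix p q assume "(p, q) \<in> side_pairing d"
  then obtain k where k: "p \<in> side d k" "q = p + side_shift d k" unfolding side_pairing_def by auto
  have "q \<in> side d (k + d)" using side_shift_in k by auto
  moreover have "p = q + side_shift d (k + d)" using k by (simp add: side_shift_add_d)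
  ultimately show "(q, p) \<in> side_pairing d" unfolding side_pairing_def by auto
qed

lemma equiv_glue: "equiv P (glue d)"
proof (rule equivI)
  show "refl_on P (glue d)" unfolding glue_def refl_on_def by auto
  show "glue d \<subseteq> P \<times> P" unfolding glue_def by auto
  show "sym (glue d)" using sym_rtrancl[OF side_pairing_sym] unfolding glue_def sym_def by auto
  show "trans (glue d)" unfolding glue_def trans_def by auto
qed

text \<open>Off the vertices the transitive closure adds nothing: the partner of a point lies on
  exactly one side, and pairing along that side leads back. All vertices are only recorded as being
  glued to vertices.\<close>

lemma glue_cases:
  assumes "(p, q) \<in> glue d"
  shows "p \<in> P \<and> q \<in> P \<and> ((p \<in> V \<and> q \<in> V) \<or>
    (p \<notin> V \<and> q \<notin> V \<and> (q = p \<or> (\<exists>k<2*d. p \<in> side d k \<and> q = p + side_shift d k))))"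
proof -
  have "(p, q) \<in> (side_pairing d)\<^sup>*" and pq: "p \<in> P" "q \<in> P" using assms by (auto simp: glue_def)
  from this(1) have "(p \<in> V \<and> q \<in> V) \<or>
    (p \<notin> V \<and> q \<notin> V \<and> (q = p \<or> (\<exists>k<2*d. p \<in> side d k \<and> q = p + side_shift d k)))"
  proof induction
    case base
    thus ?case by auto
  next
    case (step q r)
    from step(2) obtain k where k: "q \<in> side d k" "r = q + side_shift d k" unfolding side_pairing_def by auto
    show ?case
    proof (cases "p \<in> V")
      case True
      thus ?thesis using step shift_vertex k by auto
    next
      case False
      hence q: "q \<notin> V" "q = p \<or> (\<exists>k<2*d. p \<in> side d k \<and> q = p + side_shift d k)" using step by auto
      have r: "r \<notin> V" using shift_nonvertex k q by auto
      have "r = p \<or> (\<exists>k<2*d. p \<in> side d k \<and> r = p + side_shift d k)" using q(2)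
      proof
        assume "q = p"
        hence "p \<in> side d (k mod (2*d)) \<and> r = p + side_shift d (k mod (2*d))"
          using k by (simp add: side_mod side_shift_mod)
        moreover have "k mod (2*d) < 2*d" using d_ge by simp
        ultimately show ?thesis by blast
      next
        assume "\<exists>k<2*d. p \<in> side d k \<and> q = p + side_shift d k"
        then obtain j where j: "p \<in> side d j" "q = p + side_shift d j" by auto
        have "q \<in> side d (j + d)" using side_shift_in j by auto
        \<comment> \<open>The second pairing must use the only side through \<open>q\<close>, the
          one opposite to side \<open>j\<close>, and so undoes the first.\<close>
        hence "(j + d) mod (2*d) = k mod (2*d)" using side_unique k q by blast
        hence "side_shift d k = side_shift d (j + d)" by (metis side_shift_mod)
        hence "r = p" using k j by (simp add: side_shift_add_d)
        thus ?thesis by simp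
      qed
      thus ?thesis using r False by auto
    qed
  qed
  thus ?thesis using pq by simp
qed

lemma glue_shift: "p \<in> side d k \<Longrightarrow> (p, p + side_shift d k) \<in> glue d"
  unfolding glue_def using side_subset_P side_shift_in[of p k] by (auto simp: side_pairing_def)

text \<open>The relation is the union of the diagonal, the graphs of finitely many translations of
  sides and a finite set. Its closedness is what lets equality of paths pass to limits.\<close>

lemma compact_glue: "compact (glue d)"
proof -
  have eq: "glue d = (\<lambda>p. (p, p)) ` P \<union> (\<Union>k<2*d. (\<lambda>p. (p, p + side_shift d k)) ` side d k) \<union> (glue d \<inter> V \<times> V)"
    (is "_ = ?A \<union> ?B \<union> ?C")
  proof (intro equalityI subsetI)
    fix x assume x: "x \<in> glue d"
    obtain p q where pq: "x = (p, q)" by (cases x)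
    from glue_cases[of p q] x pq show "x \<in> ?A \<union> ?B \<union> ?C" by auto
  next
    fix x assume "x \<in> ?A \<union> ?B \<union> ?C"
    thus "x \<in> glue d" using glue_shift equiv_glue by (auto simp: equiv_def refl_on_def)
  qed
  have "compact ?A" by (intro compact_continuous_image compact_P continuous_intros)
  moreover have "compact ?B"
    by (intro compact_UN compact_continuous_image continuous_intros) (auto simp: side_def)
  moreover have "compact ?C" using finite_V by (intro finite_imp_compact) auto
  ultimately show ?thesis by (subst eq) (intro compact_Un)
qed

lemma closed_glue: "closed (glue d)" using compact_glue by (rule compact_imp_closed)

lemma proj_eq_iff: "p \<in> P \<Longrightarrow> q \<in> P \<Longrightarrow> proj d p = proj d q \<longleftrightarrow> (p, q) \<in> glue d"
  unfolding proj_def using equiv_glue by (simp add: eq_equiv_class_iff)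

lemma in_proj_iff: "q \<in> proj d p \<longleftrightarrow> (p, q) \<in> glue d"
  by (simp add: proj_def)

lemma proj_self: "p \<in> P \<Longrightarrow> p \<in> proj d p"
  using equiv_glue by (auto simp: in_proj_iff equiv_def refl_on_def)

lemma surface_eq: "surface d = proj d ` P"
  unfolding surface_def proj_def quotient_def by auto

lemma in_surfaceD:
  assumes "x \<in> surface d" "p \<in> x" shows "p \<in> P" "x = proj d p"
proof -
  obtain q where q: "q \<in> P" "x = proj d q" using assms(1) surface_eq by auto
  hence qp: "(q, p) \<in> glue d" using assms(2) by (simp add: in_proj_iff)
  show p: "p \<in> P" using glue_cases[OF qp] by simp
  show "x = proj d p" using proj_eq_iff[OF q(1) p] qp q(2) by simp
qed

lemma proj_cone_iff:
  assumes "p \<in> P" shows "proj d p \<in> cone_points d \<longleftrightarrow> p \<in> V"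
proof
  assume "proj d p \<in> cone_points d"
  then obtain k where "proj d p = proj d (vertex d k)" unfolding cone_points_def by auto
  hence "(p, vertex d k) \<in> glue d" using proj_eq_iff assms vertex_in_P by simp
  from glue_cases[OF this] show "p \<in> V" by auto
qed (simp add: cone_points_def)

lemma glue_nonvertexD:
  assumes "(p, q) \<in> glue d" "p \<notin> V" "q \<noteq> p"
  obtains k where "k < 2*d" "p \<in> side d k" "q = p + side_shift d k"
  using glue_cases[OF assms(1)] assms that by auto

lemma proj_interior:
  assumes "p \<in> P" "\<And>k. nrm k \<bullet> p < cos b" shows "proj d p = {p}"
proof -
  have v: "p \<notin> V" using assms(2) nrm_vertex_same(1) by (metis imageE order_less_irrefl)
  have "q = p" if "(p, q) \<in> glue d" for q
  proof (rule ccontr)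
    assume "q \<noteq> p"
    with that v obtain k where "p \<in> side d k" by (elim glue_nonvertexD)
    thus False using side_nrm assms(2)[of k] by simp
  qed
  thus ?thesis using proj_self[OF assms(1)] by (auto simp: in_proj_iff)
qed

section \<open>Horizontal strips\<close>

text \<open>In the coordinates \<open>z = kap * Complex x y\<close> side \<open>d - 1\<close> is horizontal, and the horizontal diagonals cut
  the polygon into \<open>d - 1\<close> strips. Strip \<open>j\<close> lies between the vertices \<open>Complex (sx j) (sy j)\<close> and
  \<open>Complex (sx (j + 1)) (sy (j + 1))\<close>; it has height \<open>ht j\<close>, its chord at the relative height \<open>t\<close> has length
  \<open>2 * hw j t\<close>, and \<open>Pt j a t\<close> is the point of abscissa \<open>a\<close> on the line of this chord. Side \<open>j\<close> on the right of
  strip \<open>j\<close> is glued to the left side of strip \<open>opp j\<close>; together the two strips form a cylinder of circumference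
  \<open>2 * wd j\<close>.\<close>

definition kap :: complex where "kap = cis (pi / 2 - b)"
definition sx :: "nat \<Rightarrow> real" where "sx j = sin ((2 * real j + 1) * b)"
definition sy :: "nat \<Rightarrow> real" where "sy j = - cos ((2 * real j + 1) * b)"
definition hw :: "nat \<Rightarrow> real \<Rightarrow> real" where "hw j t = (1 - t) * sx j + t * sx (j + 1)"
definition ht :: "nat \<Rightarrow> real" where "ht j = sy (j + 1) - sy j"
definition wd :: "nat \<Rightarrow> real" where "wd j = sx j + sx (j + 1)"
definition Pt :: "nat \<Rightarrow> real \<Rightarrow> real \<Rightarrow> complex" where
  "Pt j a t = kap * Complex a (sy j + t * ht j)"
definition opp :: "nat \<Rightarrow> nat" where "opp j = d - 2 - j"

lemma norm_kap [simp]: "norm kap = 1" by (simp add: kap_def)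

lemma kap_inner: "(kap * z) \<bullet> (kap * w) = z \<bullet> w"
proof -
  have "(Re kap)^2 + (Im kap)^2 = 1" using norm_kap cmod_power2[of kap] by simp
  hence "(Re kap * Re kap + Im kap * Im kap) = 1" by (simp add: power2_eq_square)
  moreover have "(kap * z) \<bullet> (kap * w) = (Re kap * Re kap + Im kap * Im kap) * (z \<bullet> w)"
    by (simp add: inner_complex_def algebra_simps)
  ultimately show ?thesis by simp
qed

lemma kap_cnj: "kap * cnj kap = 1" "cnj kap * kap = 1"
  by (simp_all add: kap_def cis_cnj cis_mult)

lemma kap_nz [simp]: "kap \<noteq> 0" using norm_kap by force

lemma vertex_local: "vertex d j = kap * Complex (sx j) (sy j)"
proof -
  have "Complex (sx j) (sy j) = cis ((2 * real j + 1) * b - pi / 2)"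
    by (simp add: complex_eq_iff sx_def sy_def cos_diff sin_diff)
  thus ?thesis unfolding vertex_cis kap_def by (simp add: cis_mult algebra_simps)
qed

lemma nrm_local: "nrm j = kap * Complex (sin ((2 * real j + 2) * b)) (- cos ((2 * real j + 2) * b))"
proof -
  have "Complex (sin ((2 * real j + 2) * b)) (- cos ((2 * real j + 2) * b)) = cis ((2 * real j + 2) * b - pi / 2)"
    by (simp add: complex_eq_iff cos_diff sin_diff)
  thus ?thesis unfolding nrm_def kap_def by (simp add: cis_mult algebra_simps)
qed

lemma angle_less: "0 < x \<Longrightarrow> x < 2 * real d \<Longrightarrow> 0 < x * b \<and> x * b < pi"
  using b_pos db by (metis mult_pos_pos mult_less_cancel_right_pos)

lemma sx_pos: "j < d \<Longrightarrow> 0 < sx j"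
  unfolding sx_def using angle_less[of "2 * real j + 1"] by (intro sin_gt_zero) auto

lemma sin_mid_pos: "j + 1 < d \<Longrightarrow> 0 < sin ((2 * real j + 2) * b)"
  using angle_less[of "2 * real j + 2"] by (intro sin_gt_zero) auto

text \<open>The factor \<open>sin ((2 * real j + 2) * b)\<close> is shared with \<open>wd j\<close>,
  so \<open>wd j / ht j\<close> is the same for all strips: the reason for the common
  modulus.\<close>

lemma ht_eq: "ht j = 2 * sin ((2 * real j + 2) * b) * sin b"
proof -
  define B where "B = (2 * real j + 2) * b"
  have "ht j = cos (B - b) - cos (B + b)" unfolding ht_def sy_def B_def by (simp add: algebra_simps)
  thus ?thesis unfolding B_def[symmetric] by (simp add: cos_add cos_diff)
qed

lemma wd_eq: "wd j = 2 * sin ((2 * real j + 2) * b) * cos b"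
proof -
  define B where "B = (2 * real j + 2) * b"
  have "wd j = sin (B - b) + sin (B + b)" unfolding wd_def sx_def B_def by (simp add: algebra_simps)
  thus ?thesis unfolding B_def[symmetric] by (simp add: sin_add sin_diff)
qed

lemma ht_pos: "j + 1 < d \<Longrightarrow> 0 < ht j"
  unfolding ht_eq using sin_mid_pos sin_b_pos by simp

lemma wd_pos: "j + 1 < d \<Longrightarrow> 0 < wd j"
  unfolding wd_eq using sin_mid_pos cos_b_pos by simp

lemma sy_mono: "i < j \<Longrightarrow> j < d \<Longrightarrow> sy i < sy j"
proof (induction j)
  case (Suc j)
  have "sy j < sy (Suc j)" using ht_pos[of j] Suc by (simp add: ht_def)
  thus ?case using Suc by (cases "i = j") auto
qed simp

lemma sy_mono_le: "i \<le> j \<Longrightarrow> j < d \<Longrightarrow> sy i \<le> sy j"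
  using sy_mono[of i j] by (cases "i = j") auto

lemma hw_pos: "j + 1 < d \<Longrightarrow> 0 \<le> t \<Longrightarrow> t \<le> 1 \<Longrightarrow> 0 < hw j t"
  unfolding hw_def using sx_pos[of j] sx_pos[of "j+1"]
  by (cases "t = 0") (auto intro!: add_nonneg_pos mult_pos_pos)

lemma opp_less: "j + 1 < d \<Longrightarrow> opp j + 1 < d" and opp_opp: "j + 1 < d \<Longrightarrow> opp (opp j) = j"
  by (auto simp: opp_def)

lemma opp_angle: "j + 1 < d \<Longrightarrow> (2 * real (opp j) + 1) * b = pi - (2 * real (j + 1) + 1) * b"
  using db by (simp add: opp_def of_nat_diff algebra_simps)

lemma opp_angle': "j + 1 < d \<Longrightarrow> (2 * real (opp j + 1) + 1) * b = pi - (2 * real j + 1) * b"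
  using db by (simp add: opp_def of_nat_diff algebra_simps)

lemma opp_sx: "j + 1 < d \<Longrightarrow> sx (opp j) = sx (j + 1)" "j + 1 < d \<Longrightarrow> sx (opp j + 1) = sx j"
  and opp_sy: "j + 1 < d \<Longrightarrow> sy (opp j) = - sy (j + 1)" "j + 1 < d \<Longrightarrow> sy (opp j + 1) = - sy j"
  unfolding sx_def sy_def using opp_angle[of j] opp_angle'[of j] by simp_all

text \<open>Strip \<open>opp j\<close> is strip \<open>j\<close> turned upside down. At equal
  relative height the chords of the two strips add up to the constant length
  \<open>2 * wd j\<close>, so they close up to a cylinder.\<close>

lemma opp_wd: "j + 1 < d \<Longrightarrow> wd (opp j) = wd j" and opp_ht: "j + 1 < d \<Longrightarrow> ht (opp j) = ht j"
  and opp_hw: "j + 1 < d \<Longrightarrow> hw (opp j) t = wd j - hw j t"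
  by (simp_all add: wd_def ht_def hw_def opp_sx[simplified] opp_sy[simplified] algebra_simps)

lemma nrm_Pt: "nrm j \<bullet> Pt j a t = cos b + sin ((2 * real j + 2) * b) * (a - hw j t)"
proof -
  define B where "B = (2 * real j + 2) * b"
  have s: "sx j = sin (B - b)" "sx (j+1) = sin (B + b)" "sy j = - cos (B - b)" "sy (j+1) = - cos (B + b)"
    unfolding sx_def sy_def B_def by (simp_all add: algebra_simps)
  have e1: "sin B * sin (B - b) + cos B * cos (B - b) = cos b"
    using cos_diff[of B "B - b"] by simp
  have e2: "sin B * sin (B + b) + cos B * cos (B + b) = cos b"
    using cos_diff[of B "B + b"] by simp
  have "nrm j \<bullet> Pt j a t = sin B * a - cos B * (sy j + t * ht j)"
    unfolding nrm_local Pt_def kap_inner B_def by (simp add: inner_complex_def)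
  also have "\<dots> = sin B * (a - hw j t) + (1 - t) * (sin B * sin (B - b) + cos B * cos (B - b)) + t * (sin B * sin (B + b) + cos B * cos (B + b))"
    unfolding ht_def hw_def s by (simp add: algebra_simps)
  also have "\<dots> = cos b + sin B * (a - hw j t)" unfolding e1 e2 by (simp add: algebra_simps)
  finally show ?thesis unfolding B_def .
qed

text \<open>Side \<open>opp j + d\<close> bounds strip \<open>j\<close> on the left, as follows from
  the reflection in the vertical axis.\<close>

lemma nrm_Pt_left:
  assumes j: "j + 1 < d"
  shows "nrm (opp j + d) \<bullet> Pt j a t = cos b + sin ((2 * real j + 2) * b) * (- a - hw j t)"
proof -
  have an: "(2 * real (opp j) + 2) * b = pi - (2 * real j + 2) * b"
    using opp_angle[OF j] db by (simp add: algebra_simps)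
  have "nrm (opp j + d) = kap * Complex (- sin ((2 * real j + 2) * b)) (- cos ((2 * real j + 2) * b))"
    unfolding nrm_add_d nrm_local[of "opp j"] an by (simp add: complex_eq_iff)
  hence "nrm (opp j + d) \<bullet> Pt j a t = nrm j \<bullet> Pt j (- a) t"
    unfolding Pt_def nrm_local[of j] by (simp only: kap_inner) (simp add: inner_complex_def)
  thus ?thesis by (simp add: nrm_Pt)
qed

lemma vertex_Pt: "vertex d j = Pt j (sx j) 0" "vertex d (j + 1) = Pt j (sx (j + 1)) 1"
  by (simp_all add: vertex_local Pt_def ht_def)

lemma Pt_combine: "(1 - r) *\<^sub>R Pt j a t + r *\<^sub>R Pt j a' t' = Pt j ((1 - r) * a + r * a') ((1 - r) * t + r * t')"
  by (simp add: Pt_def complex_eq_iff algebra_simps)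

lemma Pt_right: "0 \<le> t \<Longrightarrow> t \<le> 1 \<Longrightarrow> Pt j (hw j t) t \<in> side d j"
  unfolding side_def closed_segment_def vertex_Pt(1)[of j] vertex_Pt(2)[of j] Pt_combine
  by (auto simp: hw_def intro!: exI[of _ t])

lemma Pt_shift:
  assumes j: "j + 1 < d" shows "Pt j a t + side_shift d j = Pt (opp j) (a - wd j) t"
proof -
  have "side_shift d j = kap * Complex (- wd j) (- (sy j + sy (j+1)))"
    unfolding side_shift_eq vertex_local by (simp add: complex_eq_iff wd_def algebra_simps)
  thus ?thesis unfolding Pt_def opp_ht[OF j] opp_sy(1)[OF j]
    by (simp add: complex_eq_iff ht_def algebra_simps)
qed

lemma Pt_left:
  assumes j: "j + 1 < d" "0 \<le> t" "t \<le> 1" shows "Pt j (- hw j t) t \<in> side d (opp j + d)"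
proof -
  have "Pt (opp j) (hw (opp j) t) t \<in> side d (opp j)" using Pt_right j by simp
  from side_shift_in[OF this] have "Pt (opp (opp j)) (hw (opp j) t - wd (opp j)) t \<in> side d (opp j + d)"
    using Pt_shift[OF opp_less[OF j(1)]] by simp
  thus ?thesis using j by (simp add: opp_opp opp_hw opp_wd)
qed

lemma Pt_in_P:
  assumes j: "j + 1 < d" and t: "0 \<le> t" "t \<le> 1"
  shows "Pt j a t \<in> P \<longleftrightarrow> \<bar>a\<bar> \<le> hw j t"
proof
  assume p: "Pt j a t \<in> P"
  have "sin ((2 * real j + 2) * b) * (a - hw j t) \<le> 0"
    using polygon_nrm_le[OF p, of j] by (simp add: nrm_Pt)
  moreover have "sin ((2 * real j + 2) * b) * (- a - hw j t) \<le> 0"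
    using polygon_nrm_le[OF p, of "opp j + d"] by (simp add: nrm_Pt_left[OF j])
  ultimately show "\<bar>a\<bar> \<le> hw j t" using sin_mid_pos[OF j] by (auto simp: mult_le_0_iff)
next
  assume a: "\<bar>a\<bar> \<le> hw j t"
  define r where "r = (a + hw j t) / (2 * hw j t)"
  have h: "0 < hw j t" by (rule hw_pos) (use j t in auto)
  have r: "0 \<le> r" "r \<le> 1" using a h by (auto simp: r_def field_simps)
  have "(1 - r) *\<^sub>R Pt j (- hw j t) t + r *\<^sub>R Pt j (hw j t) t \<in> P"
    using convexD_alt[OF convex_P, of "Pt j (- hw j t) t" "Pt j (hw j t) t" r] r Pt_left Pt_right j t side_subset_P by blast
  moreover have "(1 - r) * - hw j t + r * hw j t = a" using h by (simp add: r_def field_simps)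
  moreover have "(1 - r) * t + r * t = t" by (simp add: algebra_simps)
  ultimately show "Pt j a t \<in> P" by (simp only: Pt_combine)
qed

definition Yc :: "complex \<Rightarrow> real" where "Yc z = Im (cnj kap * z)"
definition Xc :: "complex \<Rightarrow> real" where "Xc z = Re (cnj kap * z)"

lemma XY_local: "z = kap * Complex (Xc z) (Yc z)"
proof -
  have "Complex (Xc z) (Yc z) = cnj kap * z" by (simp add: complex_eq_iff Xc_def Yc_def)
  thus ?thesis using kap_cnj by (simp flip: mult.assoc)
qed

lemma XY_kap: "Xc (kap * Complex x y) = x" "Yc (kap * Complex x y) = y"
  unfolding Xc_def Yc_def using kap_cnj by (simp_all flip: mult.assoc)

lemma Yc_Pt: "Yc (Pt j a t) = sy j + t * ht j" and Xc_Pt: "Xc (Pt j a t) = a"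
  by (simp_all add: Pt_def XY_kap)

lemma Yc_halfplanes:
  assumes "\<And>k. k < 2 * d \<Longrightarrow> nrm k \<bullet> p \<le> cos b" shows "sy 0 \<le> Yc p" "Yc p \<le> sy (d - 1)"
proof -
  have an: "(2 * real (d - 1) + 2) * b = pi" "(2 * real (d - 1) + 1) * b = pi - b"
    using d_ge db by (simp_all add: of_nat_diff algebra_simps)
  have n: "nrm (d - 1) = kap * Complex 0 1" unfolding nrm_local an by simp
  have n': "nrm (d - 1 + d) = kap * Complex 0 (-1)" unfolding nrm_add_d n by (simp add: complex_eq_iff)
  have "nrm (d - 1) \<bullet> p = Yc p" by (subst XY_local[of p], unfold n kap_inner) (simp add: inner_complex_def)
  moreover have "nrm (d - 1 + d) \<bullet> p = - Yc p" by (subst XY_local[of p], unfold n' kap_inner) (simp add: inner_complex_def)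
  moreover have "sy (d - 1) = cos b" "sy 0 = - cos b" unfolding sy_def an by simp_all
  moreover have "d - 1 < 2 * d" "d - 1 + d < 2 * d" using d_ge by auto
  ultimately show "sy 0 \<le> Yc p" "Yc p \<le> sy (d - 1)"
    using assms[of "d - 1"] assms[of "d - 1 + d"] by linarith+
qed

lemma Yc_range: assumes "p \<in> P" shows "sy 0 \<le> Yc p" "Yc p \<le> sy (d - 1)"
  using Yc_halfplanes polygon_nrm_le[OF assms] by blast+

lemma level_ex: "sy 0 \<le> y \<Longrightarrow> y < sy n \<Longrightarrow> \<exists>j<n. sy j \<le> y \<and> y < sy (j + 1)"
proof (induction n)
  case (Suc n)
  show ?case
  proof (cases "y < sy n")
    case True
    then obtain j where "j < n" "sy j \<le> y" "y < sy (j + 1)" using Suc by blast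
    thus ?thesis by (intro exI[of _ j]) simp
  next
    case False
    thus ?thesis using Suc by (intro exI[of _ n]) auto
  qed
qed simp

lemma strip_ex_up:
  assumes "sy 0 \<le> y" "y < sy (d - 1)"
  obtains j t where "j + 1 < d" "0 \<le> t" "t < 1" "y = sy j + t * ht j"
proof -
  obtain j where j: "j < d - 1" "sy j \<le> y" "y < sy (j + 1)" using level_ex assms by blast
  have j': "j + 1 < d" using j by simp
  show ?thesis
    by (rule that[of j "(y - sy j) / ht j"]) (use j j' ht_pos[OF j'] in \<open>auto simp: ht_def field_simps\<close>)
qed

text \<open>A height on a horizontal diagonal belongs to two strips. This variant chooses the strip
  with room below and the previous one the strip with room above; the two are exchanged by the
  reflection that sends strip \<open>j\<close> to \<open>opp j\<close>.\<close>

lemma strip_ex_down: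
  assumes "sy 0 < y" "y \<le> sy (d - 1)"
  obtains j t where "j + 1 < d" "0 < t" "t \<le> 1" "y = sy j + t * ht j"
proof -
  have an: "(2 * real (d - 1) + 1) * b = pi - b" using d_ge db by (simp add: of_nat_diff algebra_simps)
  have e: "sy (d - 1) = - sy 0" unfolding sy_def an by simp
  obtain j t where j: "j + 1 < d" "0 \<le> t" "t < 1" "- y = sy j + t * ht j"
    by (rule strip_ex_up[of "- y"]) (use assms e in auto)
  have "y = sy (opp j) + (1 - t) * ht (opp j)"
    using j(4) unfolding opp_ht[OF j(1)] opp_sy(1)[OF j(1)] by (simp add: ht_def algebra_simps)
  thus ?thesis using j opp_less[OF j(1)] by (intro that[of "opp j" "1 - t"]) auto
qed

lemma Pt_of_Y:
  assumes "Yc p = sy j + t * ht j" shows "p = Pt j (Xc p) t"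
  using XY_local[of p] unfolding Pt_def assms .

lemma strip_ex:
  assumes Y: "sy 0 \<le> Yc p" "Yc p \<le> sy (d - 1)"
  obtains j t where "j + 1 < d" "0 \<le> t" "t \<le> 1" "p = Pt j (Xc p) t"
proof (cases "Yc p < sy (d - 1)")
  case True
  obtain j t where "j + 1 < d" "0 \<le> t" "t < 1" "Yc p = sy j + t * ht j" by (rule strip_ex_up[OF Y(1) True])
  thus ?thesis using Pt_of_Y by (intro that[of j t]) auto
next
  case False
  have "sy 0 < sy (d - 1)" using sy_mono[of 0 "d - 1"] d_ge by simp
  hence "sy 0 < Yc p" using False by simp
  then obtain j t where "j + 1 < d" "0 < t" "t \<le> 1" "Yc p = sy j + t * ht j" by (rule strip_ex_down[OF _ Y(2)])
  thus ?thesis using Pt_of_Y by (intro that[of j t]) auto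
qed

lemma P_strip:
  assumes p: "p \<in> P"
  obtains j a t where "j + 1 < d" "0 \<le> t" "t \<le> 1" "\<bar>a\<bar> \<le> hw j t" "p = Pt j a t"
proof -
  obtain j t where j: "j + 1 < d" "0 \<le> t" "t \<le> 1" "p = Pt j (Xc p) t" by (rule strip_ex[OF Yc_range[OF p]])
  have "\<bar>Xc p\<bar> \<le> hw j t" using Pt_in_P[OF j(1-3), of "Xc p"] p j(4) by simp
  thus ?thesis by (rule that[OF j(1-3) _ j(4)])
qed

text \<open>The facet description of the convex hull. The two horizontal sides confine the height
  and thereby place \<open>p\<close> on the line of a chord of some strip; the two sides bounding
  that strip confine the abscissa.\<close>

lemma P_halfplanes:
  assumes "\<And>k. k < 2 * d \<Longrightarrow> nrm k \<bullet> p \<le> cos b" shows "p \<in> P"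
proof -
  have Y: "sy 0 \<le> Yc p" "Yc p \<le> sy (d - 1)" using Yc_halfplanes assms by blast+
  obtain j t where j: "j + 1 < d" "0 \<le> t" "t \<le> 1" "p = Pt j (Xc p) t" by (rule strip_ex[OF Y])
  have s: "0 < sin ((2 * real j + 2) * b)" by (rule sin_mid_pos[OF j(1)])
  have "nrm j \<bullet> p \<le> cos b" "nrm (opp j + d) \<bullet> p \<le> cos b" using j opp_less[OF j(1)] by (auto intro!: assms)
  hence "sin ((2 * real j + 2) * b) * (Xc p - hw j t) \<le> 0" "sin ((2 * real j + 2) * b) * (- Xc p - hw j t) \<le> 0"
    using nrm_Pt[of j "Xc p" t] nrm_Pt_left[OF j(1), of "Xc p" t] j(4) by simp_all
  hence "\<bar>Xc p\<bar> \<le> hw j t" using s by (auto simp: mult_le_0_iff)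
  thus ?thesis using Pt_in_P[OF j(1-3), of "Xc p"] j(4) by simp
qed

lemma strip_height_unique:
  assumes "i + 1 < d" "j + 1 < d" "0 < t" "t < 1" "0 \<le> t'" "t' \<le> 1" "sy i + t * ht i = sy j + t' * ht j"
  shows "i = j \<and> t = t'"
proof -
  have hi: "0 < ht i" and hj: "0 < ht j" using assms ht_pos by auto
  have a: "sy i < sy i + t * ht i" using mult_pos_pos[OF assms(3) hi] by simp
  have b: "sy i + t * ht i < sy (i + 1)" using mult_strict_right_mono[OF assms(4) hi] by (simp add: ht_def)
  have c: "sy j \<le> sy j + t' * ht j" using hj assms by simp
  have e: "sy j + t' * ht j \<le> sy (j + 1)" using mult_right_mono[OF assms(6) less_imp_le[OF hj]] by (simp add: ht_def)
  have "i = j"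
  proof (rule ccontr)
    assume "i \<noteq> j"
    then consider "i + 1 \<le> j" | "j + 1 \<le> i" by linarith
    thus False
    proof cases
      case 1
      thus False using sy_mono_le[of "i+1" j] assms a b c e by linarith
    next
      case 2
      thus False using sy_mono_le[of "j+1" i] assms a b c e by linarith
    qed
  qed
  thus ?thesis using assms hi by auto
qed

lemma vertex_level:
  assumes "v \<in> V" shows "\<exists>i<d. Yc v = sy i"
proof -
  obtain k where k: "k < 2 * d" "v = vertex d k" using assms unfolding V_eq by auto
  have Y: "Yc v = sy k" unfolding k(2) vertex_local XY_kap ..
  show ?thesis
  proof (cases "k < d")
    case False
    \<comment> \<open>Vertices with index at least \<open>d\<close> are mirror images, at the same
      height, of those with smaller index.\<close>
    have an: "(2 * real (2 * d - 1 - k) + 1) * b = 2 * pi - (2 * real k + 1) * b"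
      using db k False by (simp add: of_nat_diff algebra_simps)
    have "sy (2 * d - 1 - k) = sy k" unfolding sy_def an by (simp add: cos_diff)
    thus ?thesis using Y False k by (intro exI[of _ "2 * d - 1 - k"]) auto
  qed (use Y in auto)
qed

lemma Pt_nonvertex:
  assumes "j + 1 < d" "0 < t" "t < 1" shows "Pt j a t \<notin> V"
proof
  assume "Pt j a t \<in> V"
  then obtain i where i: "i < d" "sy j + t * ht j = sy i" using vertex_level Yc_Pt by metis
  have "\<exists>i' t'. i' + 1 < d \<and> (t' = 0 \<or> t' = 1) \<and> sy i = sy i' + t' * ht i'"
  proof (cases "i + 1 < d")
    case True
    thus ?thesis by (intro exI[of _ i] exI[of _ 0]) auto
  next
    case False
    thus ?thesis using i d_ge by (intro exI[of _ "i - 1"] exI[of _ 1]) (auto simp: ht_def)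
  qed
  then obtain i' t' where "i' + 1 < d" "t' = 0 \<or> t' = 1" "sy i = sy i' + t' * ht i'" by blast
  with strip_height_unique[of j i' t t'] assms i show False by auto
qed

lemma Pt_side:
  assumes j: "j + 1 < d" "0 < t" "t < 1" and p: "Pt j a t \<in> side d k"
  shows "(a = hw j t \<and> k mod (2 * d) = j) \<or> (a = - hw j t \<and> k mod (2 * d) = opp j + d)"
proof -
  have t: "0 \<le> t" "t \<le> 1" using j by auto
  have nv: "Pt j x t \<notin> V" for x using Pt_nonvertex j by blast
  have mods: "j mod (2*d) = j" "(opp j + d) mod (2*d) = opp j + d" using j opp_less[OF j(1)] by auto
  have a: "\<bar>a\<bar> \<le> hw j t" using p side_subset_P Pt_in_P[OF j(1) t] by blast
  have h: "0 < hw j t" using hw_pos[OF j(1) t] .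
  consider "a = hw j t" | "a = - hw j t" | "- hw j t < a" "a < hw j t" using a by linarith
  thus ?thesis
  proof cases
    case 1
    hence "k mod (2*d) = j mod (2*d)" using side_unique[OF p _ nv] Pt_right t by metis
    thus ?thesis using 1 mods by simp
  next
    case 2
    hence "k mod (2*d) = (opp j + d) mod (2*d)" using side_unique[OF p _ nv] Pt_left j t by metis
    thus ?thesis using 2 mods by simp
  next
    \<comment> \<open>Inside the chord, a side through the point would contain both ends of the
      chord, which lie on two different sides.\<close>
    case 3
    define r where "r = (a + hw j t) / (2 * hw j t)"
    have r: "0 < r" "r < 1" using 3 h by (auto simp: r_def field_simps)
    let ?L = "Pt j (- hw j t) t" and ?R = "Pt j (hw j t) t"
    have LR: "?L \<in> side d (opp j + d)" "?R \<in> side d j" using Pt_left Pt_right j t by auto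
    have "(1 - r) * - hw j t + r * hw j t = a" using h by (simp add: r_def field_simps)
    moreover have "(1 - r) * t + r * t = t" by (simp add: algebra_simps)
    ultimately have "Pt j a t = (1 - r) *\<^sub>R ?L + r *\<^sub>R ?R" by (simp only: Pt_combine)
    hence "(1 - r) * (nrm k \<bullet> ?L) + r * (nrm k \<bullet> ?R) = cos b"
      using side_nrm[OF p] by (simp add: inner_add_right)
    moreover have "(1 - r) * (nrm k \<bullet> ?L) \<le> (1 - r) * cos b" "r * (nrm k \<bullet> ?R) \<le> r * cos b"
      using LR side_subset_P r by (auto intro!: mult_left_mono polygon_nrm_le)
    moreover have "(1 - r) * cos b + r * cos b = cos b" by (simp add: algebra_simps)
    ultimately have "(1 - r) * (nrm k \<bullet> ?L) = (1 - r) * cos b" "r * (nrm k \<bullet> ?R) = r * cos b" by linarith+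
    hence "?L \<in> side d k" "?R \<in> side d k" using r LR side_subset_P unfolding side_iff by auto
    hence "k mod (2*d) = (opp j + d) mod (2*d)" "k mod (2*d) = j mod (2*d)"
      using LR side_unique nv by metis+
    thus ?thesis using mods j by simp
  qed
qed

lemma Pt_glue:
  assumes j: "j + 1 < d" "0 < t" "t < 1" and g: "(Pt j a t, q) \<in> glue d" and ne: "q \<noteq> Pt j a t"
  shows "(a = hw j t \<and> q = Pt (opp j) (a - wd j) t) \<or> (a = - hw j t \<and> q = Pt (opp j) (a + wd j) t)"
proof -
  have nv: "Pt j a t \<notin> V" using Pt_nonvertex j by blast
  obtain k where k: "k < 2 * d" "Pt j a t \<in> side d k" "q = Pt j a t + side_shift d k"
    using glue_nonvertexD[OF g nv ne] .
  from Pt_side[OF j k(2)] k(1) consider "a = hw j t" "k = j" | "a = - hw j t" "k = opp j + d" by auto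
  thus ?thesis
  proof cases
    case 1
    thus ?thesis using k Pt_shift[OF j(1)] by simp
  next
    case 2
    have "side_shift d k = - side_shift d (opp j)" using 2 side_shift_add_d by simp
    moreover have "Pt (opp j) (a + wd j) t + side_shift d (opp j) = Pt j a t"
      using Pt_shift[OF opp_less[OF j(1)]] j by (simp add: opp_opp opp_wd)
    ultimately have "q = Pt (opp j) (a + wd j) t" using k(3) by (metis add_diff_cancel_right' diff_conv_add_uminus)
    thus ?thesis using 2 by simp
  qed
qed

section \<open>Straight paths and affine maps\<close>

text \<open>\<open>straight v a c \<gamma>\<close> allows any velocity \<open>v\<close>, even zero, and cone points on the path.\<close>

definition rgerm :: "(real \<Rightarrow> complex set) \<Rightarrow> complex \<Rightarrow> real \<Rightarrow> bool" where
  "rgerm \<gamma> v t \<longleftrightarrow> (\<exists>\<epsilon>>0. \<exists>p\<in>\<gamma> t. \<forall>s\<in>{0..<\<epsilon>}. p + s *\<^sub>R v \<in> P \<and> \<gamma> (t + s) = proj d (p + s *\<^sub>R v))"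

definition lgerm :: "(real \<Rightarrow> complex set) \<Rightarrow> complex \<Rightarrow> real \<Rightarrow> bool" where
  "lgerm \<gamma> v t \<longleftrightarrow> (\<exists>\<epsilon>>0. \<exists>p\<in>\<gamma> t. \<forall>s\<in>{0..<\<epsilon>}. p - s *\<^sub>R v \<in> P \<and> \<gamma> (t - s) = proj d (p - s *\<^sub>R v))"

definition straight :: "complex \<Rightarrow> real \<Rightarrow> real \<Rightarrow> (real \<Rightarrow> complex set) \<Rightarrow> bool" where
  "straight v a c \<gamma> \<longleftrightarrow>
    (\<forall>t\<in>{a..c}. \<gamma> t \<in> surface d \<and> (t < c \<longrightarrow> rgerm \<gamma> v t) \<and> (a < t \<longrightarrow> lgerm \<gamma> v t))"

lemma proj_in_surface: "p \<in> P \<Longrightarrow> proj d p \<in> surface d"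
  by (simp add: surface_eq)

text \<open>Two different representatives lie on paired sides with opposite outer normals. If
  \<open>v\<close> points into the polygon from both, it is parallel to these sides, and the two
  segments run along them and stay glued.\<close>

lemma germ_unique:
  assumes x: "x \<in> surface d - cone_points d" and pq: "p \<in> x" "q \<in> x" and e: "0 < e"
    and P: "\<And>s. 0 \<le> s \<Longrightarrow> s < e \<Longrightarrow> p + s *\<^sub>R v \<in> P" "\<And>s. 0 \<le> s \<Longrightarrow> s < e \<Longrightarrow> q + s *\<^sub>R v \<in> P"
    and s: "0 \<le> s" "s < e"
  shows "proj d (p + s *\<^sub>R v) = proj d (q + s *\<^sub>R v)"
proof (cases "q = p")
  case False
  have p: "p \<in> P" "x = proj d p" using in_surfaceD x pq by auto
  hence g: "(p, q) \<in> glue d" using pq in_proj_iff by auto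
  have "p \<notin> V" using proj_cone_iff p x by auto
  from glue_nonvertexD[OF g this False] obtain k where k: "p \<in> side d k" "q = p + side_shift d k" .
  have q: "q \<in> side d (k + d)" using side_shift_in k by auto
  have e2: "0 \<le> e / 2" "e / 2 < e" using e by auto
  have "(e / 2) * (nrm k \<bullet> v) \<le> 0"
    using polygon_nrm_le[OF P(1)[OF e2], of k] side_nrm[OF k(1)] by (simp add: inner_add_right)
  moreover have "(e / 2) * (nrm (k + d) \<bullet> v) \<le> 0"
    using polygon_nrm_le[OF P(2)[OF e2], of "k + d"] side_nrm[OF q] by (simp add: inner_add_right)
  ultimately have "nrm k \<bullet> v = 0" using e by (auto simp: nrm_add_d mult_le_0_iff zero_le_mult_iff)
  hence "p + s *\<^sub>R v \<in> side d k" unfolding side_iff using P(1)[OF s] side_nrm[OF k(1)] by (simp add: inner_add_right)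
  from glue_shift[OF this] have "(p + s *\<^sub>R v, q + s *\<^sub>R v) \<in> glue d" unfolding k(2) by (simp add: algebra_simps)
  thus ?thesis using proj_eq_iff P s by auto
qed simp

lemma lgerm_limit:
  assumes l: "lgerm \<gamma>1 v t" "lgerm \<gamma>2 v t" and S: "\<gamma>1 t \<in> surface d" "\<gamma>2 t \<in> surface d"
    and e: "a < t" "\<And>s. a < s \<Longrightarrow> s < t \<Longrightarrow> \<gamma>1 s = \<gamma>2 s"
  shows "\<gamma>1 t = \<gamma>2 t"
proof -
  obtain e1 p where p: "0 < e1" "p \<in> \<gamma>1 t" "\<And>s. 0 \<le> s \<Longrightarrow> s < e1 \<Longrightarrow> p - s *\<^sub>R v \<in> P \<and> \<gamma>1 (t - s) = proj d (p - s *\<^sub>R v)"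
    using l(1) unfolding lgerm_def by auto
  obtain e2 q where q: "0 < e2" "q \<in> \<gamma>2 t" "\<And>s. 0 \<le> s \<Longrightarrow> s < e2 \<Longrightarrow> q - s *\<^sub>R v \<in> P \<and> \<gamma>2 (t - s) = proj d (q - s *\<^sub>R v)"
    using l(2) unfolding lgerm_def by auto
  define e where "e = min (min e1 e2) (t - a)"
  have e0: "0 < e" using p q e by (simp add: e_def)
  have g: "(p - s *\<^sub>R v, q - s *\<^sub>R v) \<in> glue d" if "0 < s" "s < e" for s
  proof -
    have s: "0 \<le> s" "s < e1" "s < e2" "a < t - s" "t - s < t" using that by (auto simp: e_def)
    have "proj d (p - s *\<^sub>R v) = proj d (q - s *\<^sub>R v)" using p(3)[OF s(1,2)] q(3)[OF s(1,3)] e(2)[OF s(4,5)] by simp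
    thus ?thesis using proj_eq_iff p(3)[OF s(1,2)] q(3)[OF s(1,3)] by blast
  qed
  have "((\<lambda>s. (p - s *\<^sub>R v, q - s *\<^sub>R v)) \<longlongrightarrow> (p - 0 *\<^sub>R v, q - 0 *\<^sub>R v)) (at_right 0)"
    by (intro tendsto_intros)
  moreover have "eventually (\<lambda>s. (p - s *\<^sub>R v, q - s *\<^sub>R v) \<in> glue d) (at_right 0)"
    by (rule eventually_mono[OF eventually_at_right_real[OF e0]]) (auto intro: g)
  ultimately have "(p, q) \<in> glue d"
    using Lim_in_closed_set[OF closed_glue, of "\<lambda>s. (p - s *\<^sub>R v, q - s *\<^sub>R v)" "at_right 0"] by simp
  thus ?thesis using in_surfaceD[OF S(1) p(2)] in_surfaceD[OF S(2) q(2)] proj_eq_iff by simp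
qed

text \<open>Consider the supremum of the times up to which the paths agree: left germs and
  closedness of the gluing carry equality to it, right germs carry it beyond. Only the second step
  needs a non-cone point, so the final point may be a cone point.\<close>

lemma straight_unique:
  assumes s1: "straight v a c \<gamma>1" and s2: "straight v a c \<gamma>2"
    and nc: "\<And>t. a \<le> t \<Longrightarrow> t < c \<Longrightarrow> \<gamma>1 t \<notin> cone_points d"
    and start: "\<gamma>1 a = \<gamma>2 a" and t: "a \<le> t" "t \<le> c"
  shows "\<gamma>1 t = \<gamma>2 t"
proof -
  define S where "S = {t. a \<le> t \<and> t \<le> c \<and> (\<forall>s. a \<le> s \<longrightarrow> s \<le> t \<longrightarrow> \<gamma>1 s = \<gamma>2 s)}"
  define T where "T = Sup S"
  have aS: "a \<in> S" using start t by (auto simp: S_def)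
  have bdd: "bdd_above S" by (rule bdd_aboveI[of _ c]) (auto simp: S_def)
  have aT: "a \<le> T" unfolding T_def by (rule cSup_upper[OF aS bdd])
  have Tc: "T \<le> c" unfolding T_def using aS by (intro cSup_least) (auto simp: S_def)
  have below: "\<gamma>1 s = \<gamma>2 s" if "a \<le> s" "s < T" for s
  proof -
    have "\<exists>r\<in>S. s < r" using that less_cSup_iff[OF _ bdd, of s] aS unfolding T_def by blast
    thus ?thesis using that by (auto simp: S_def)
  qed
  have Tm: "T \<in> {a..c}" using aT Tc by simp
  have at: "\<gamma>1 T = \<gamma>2 T"
  proof (cases "T = a")
    case False
    hence "a < T" using aT by simp
    thus ?thesis using s1 s2 Tm unfolding straight_def by (intro lgerm_limit[of \<gamma>1 v T \<gamma>2 a]) (auto simp: below)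
  qed (use start in simp)
  have "T = c"
  proof (rule ccontr)
    assume "T \<noteq> c"
    hence lt: "T < c" using Tc by simp
    have "rgerm \<gamma>1 v T" "rgerm \<gamma>2 v T" using s1 s2 Tm lt unfolding straight_def by auto
    then obtain e1 p e2 q where p: "0 < e1" "p \<in> \<gamma>1 T" "\<And>s. 0 \<le> s \<Longrightarrow> s < e1 \<Longrightarrow> p + s *\<^sub>R v \<in> P \<and> \<gamma>1 (T + s) = proj d (p + s *\<^sub>R v)"
      and q: "0 < e2" "q \<in> \<gamma>2 T" "\<And>s. 0 \<le> s \<Longrightarrow> s < e2 \<Longrightarrow> q + s *\<^sub>R v \<in> P \<and> \<gamma>2 (T + s) = proj d (q + s *\<^sub>R v)"
      unfolding rgerm_def by auto
    define e where "e = min (min e1 e2) (c - T)"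
    have e: "0 < e" using p q lt by (simp add: e_def)
    have x: "\<gamma>1 T \<in> surface d - cone_points d" using s1 Tm nc[OF aT lt] unfolding straight_def by auto
    have eq: "\<gamma>1 (T + s) = \<gamma>2 (T + s)" if "0 \<le> s" "s < e" for s
    proof -
      have "proj d (p + s *\<^sub>R v) = proj d (q + s *\<^sub>R v)"
        by (rule germ_unique[OF x p(2) _ e]) (use p q at that in \<open>auto simp: e_def\<close>)
      thus ?thesis using p(3) q(3) that by (simp add: e_def)
    qed
    have "T + e / 2 \<in> S"
    proof -
      have "\<gamma>1 s = \<gamma>2 s" if "a \<le> s" "s \<le> T + e / 2" for s
        using below[of s] eq[of "s - T"] that e by (cases "s < T") auto
      moreover have "e \<le> c - T" by (simp add: e_def)
      hence "T + e / 2 \<le> c" using e by linarith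
      ultimately show ?thesis using aT e by (auto simp: S_def)
    qed
    hence "T + e / 2 \<le> T" unfolding T_def by (intro cSup_upper bdd)
    thus False using e by simp
  qed
  thus ?thesis using t below at by (cases "t = c") auto
qed

lemma straight_polygon:
  assumes "\<And>s. a \<le> s \<Longrightarrow> s \<le> c \<Longrightarrow> p + s *\<^sub>R v \<in> P"
  shows "straight v a c (\<lambda>s. proj d (p + s *\<^sub>R v))"
  unfolding straight_def
proof (intro ballI conjI impI)
  fix t assume t: "t \<in> {a..c}"
  have tp: "p + t *\<^sub>R v \<in> P" using assms t by auto
  show "proj d (p + t *\<^sub>R v) \<in> surface d" using proj_in_surface tp .
  have sp: "p + t *\<^sub>R v + s *\<^sub>R v = p + (t + s) *\<^sub>R v" "p + t *\<^sub>R v - s *\<^sub>R v = p + (t - s) *\<^sub>R v" for s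
    by (simp_all add: algebra_simps)
  show "rgerm (\<lambda>s. proj d (p + s *\<^sub>R v)) v t" if "t < c"
  proof -
    have "\<forall>s\<in>{0..<c - t}. p + t *\<^sub>R v + s *\<^sub>R v \<in> P \<and> proj d (p + (t + s) *\<^sub>R v) = proj d (p + t *\<^sub>R v + s *\<^sub>R v)"
      unfolding sp using assms t by auto
    moreover have "0 < c - t" using that by simp
    ultimately show ?thesis unfolding rgerm_def using proj_self[OF tp]
      by (intro exI conjI bexI) assumption+
  qed
  show "lgerm (\<lambda>s. proj d (p + s *\<^sub>R v)) v t" if "a < t"
  proof -
    have "\<forall>s\<in>{0..<t - a}. p + t *\<^sub>R v - s *\<^sub>R v \<in> P \<and> proj d (p + (t - s) *\<^sub>R v) = proj d (p + t *\<^sub>R v - s *\<^sub>R v)"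
      unfolding sp using assms t by auto
    moreover have "0 < t - a" using that by simp
    ultimately show ?thesis unfolding lgerm_def using proj_self[OF tp]
      by (intro exI conjI bexI) assumption+
  qed
qed

section \<open>Trajectories and the flow property\<close>

lemma linear_trajectory_iff:
  "linear_trajectory d u \<gamma> \<longleftrightarrow> (\<forall>t. \<gamma> t \<in> surface d - cone_points d \<and> rgerm \<gamma> u t \<and> lgerm \<gamma> u t)"
proof -
  have "(\<exists>\<epsilon>>0. (\<exists>p \<in> \<gamma> t. \<forall>s \<in> {0..<\<epsilon>}. p + s *\<^sub>R u \<in> P \<and> \<gamma> (t + s) = proj d (p + s *\<^sub>R u)) \<and>
        (\<exists>q \<in> \<gamma> t. \<forall>s \<in> {0..<\<epsilon>}. q - s *\<^sub>R u \<in> P \<and> \<gamma> (t - s) = proj d (q - s *\<^sub>R u)))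
     \<longleftrightarrow> rgerm \<gamma> u t \<and> lgerm \<gamma> u t" (is "?L = ?R") for t
  proof
    show "?L \<Longrightarrow> ?R" unfolding rgerm_def lgerm_def by blast
    assume ?R
    then obtain e1 p e2 q where p: "0 < e1" "p \<in> \<gamma> t" "\<forall>s\<in>{0..<e1}. p + s *\<^sub>R u \<in> P \<and> \<gamma> (t + s) = proj d (p + s *\<^sub>R u)"
      and q: "0 < e2" "q \<in> \<gamma> t" "\<forall>s\<in>{0..<e2}. q - s *\<^sub>R u \<in> P \<and> \<gamma> (t - s) = proj d (q - s *\<^sub>R u)"
      unfolding rgerm_def lgerm_def by auto
    show ?L using p q by (intro exI[of _ "min e1 e2"] conjI bexI[of _ p] bexI[of _ q]) auto
  qed
  thus ?thesis unfolding linear_trajectory_def by simp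
qed

lemma linear_trajectory_straight: "linear_trajectory d u \<gamma> \<Longrightarrow> straight u a c \<gamma>"
  unfolding linear_trajectory_iff straight_def by auto

lemma linear_trajectory_noncone: "linear_trajectory d u \<gamma> \<Longrightarrow> \<gamma> t \<notin> cone_points d"
  and linear_trajectory_surface: "linear_trajectory d u \<gamma> \<Longrightarrow> \<gamma> t \<in> surface d"
  unfolding linear_trajectory_iff by auto

text \<open>Reduces negative times to positive ones.\<close>

lemma linear_trajectory_reflect:
  assumes "linear_trajectory d u \<gamma>" shows "linear_trajectory d (- u) (\<lambda>t. \<gamma> (- t))"
proof -
  have "rgerm (\<lambda>t. \<gamma> (- t)) (- u) t \<longleftrightarrow> lgerm \<gamma> u (- t)" for t
    unfolding rgerm_def lgerm_def by simp
  moreover have "lgerm (\<lambda>t. \<gamma> (- t)) (- u) t \<longleftrightarrow> rgerm \<gamma> u (- t)" for t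
    unfolding rgerm_def lgerm_def by (simp add: algebra_simps)
  ultimately show ?thesis using assms unfolding linear_trajectory_iff by auto
qed

lemma linear_trajectory_shift:
  assumes "linear_trajectory d u \<gamma>" shows "linear_trajectory d u (\<lambda>t. \<gamma> (t + r))"
proof -
  have "rgerm (\<lambda>t. \<gamma> (t + r)) u t \<longleftrightarrow> rgerm \<gamma> u (t + r)" for t
    unfolding rgerm_def by (simp add: add_ac)
  moreover have "lgerm (\<lambda>t. \<gamma> (t + r)) u t \<longleftrightarrow> lgerm \<gamma> u (t + r)" for t
  proof -
    have e: "t - s + r = t + r - s" for s by simp
    show ?thesis unfolding lgerm_def by (simp only: e)
  qed
  ultimately show ?thesis using assms unfolding linear_trajectory_iff by simp
qed

lemma linear_trajectory_unique:
  assumes "linear_trajectory d u \<gamma>1" "linear_trajectory d u \<gamma>2" "\<gamma>1 0 = \<gamma>2 0"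
  shows "\<gamma>1 = \<gamma>2"
proof
  have pos: "\<gamma>1 t = \<gamma>2 t" if "linear_trajectory d u \<gamma>1" "linear_trajectory d u \<gamma>2" "\<gamma>1 0 = \<gamma>2 0" "0 \<le> t" for u \<gamma>1 \<gamma>2 t
    by (rule straight_unique[of u 0 t]) (use that linear_trajectory_straight linear_trajectory_noncone in auto)
  fix t
  show "\<gamma>1 t = \<gamma>2 t"
    using pos[OF assms, of t] pos[OF assms(1,2)[THEN linear_trajectory_reflect], of "- t"] assms(3)
    by (cases "0 \<le> t") auto
qed

lemma linear_flow_eq:
  assumes "linear_trajectory d u \<gamma>" shows "linear_flow d u t (\<gamma> 0) = \<gamma> t"
proof -
  have "(THE \<gamma>'. linear_trajectory d u \<gamma>' \<and> \<gamma>' 0 = \<gamma> 0) = \<gamma>"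
    using assms linear_trajectory_unique by (intro the_equality) auto
  thus ?thesis unfolding linear_flow_def using assms by auto
qed

lemma linear_flow_id: "\<nexists>\<gamma>. linear_trajectory d u \<gamma> \<and> \<gamma> 0 = x \<Longrightarrow> linear_flow d u t x = x"
  unfolding linear_flow_def by auto

lemma linear_flow_0: "linear_flow d u 0 x = x"
  using linear_flow_eq[of u _ 0] linear_flow_id[of u x 0] by (cases "\<exists>\<gamma>. linear_trajectory d u \<gamma> \<and> \<gamma> 0 = x") auto

lemma linear_flow_add: "linear_flow d u (s + t) x = linear_flow d u s (linear_flow d u t x)"
proof (cases "\<exists>\<gamma>. linear_trajectory d u \<gamma> \<and> \<gamma> 0 = x")
  case True
  then obtain \<gamma> where g: "linear_trajectory d u \<gamma>" "\<gamma> 0 = x" by auto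
  have "linear_flow d u (s + t) x = \<gamma> (s + t)" using linear_flow_eq[OF g(1), of "s + t"] g(2) by simp
  moreover have "linear_flow d u t x = \<gamma> t" using linear_flow_eq[OF g(1), of t] g(2) by simp
  moreover have "linear_flow d u s (\<gamma> t) = \<gamma> (s + t)"
    using linear_flow_eq[OF linear_trajectory_shift[OF g(1), of t], of s] by simp
  ultimately show ?thesis by simp
qed (simp add: linear_flow_id)

lemma linear_flow_surface: "x \<in> surface d \<Longrightarrow> linear_flow d u t x \<in> surface d"
  using linear_flow_eq[of u _ t] linear_flow_id[of u x t] linear_trajectory_surface
  by (cases "\<exists>\<gamma>. linear_trajectory d u \<gamma> \<and> \<gamma> 0 = x") auto

lemma linear_flow_inverse: "linear_flow d u (- t) (linear_flow d u t x) = x"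
  "linear_flow d u t (linear_flow d u (- t) x) = x"
  by (simp_all flip: linear_flow_add add: linear_flow_0)

text \<open>Affinity with derivative \<open>m\<close>, stated through germs of segments rather than
  charts: this is the form in which straight paths are transported, also across sides of the
  polygon.\<close>

definition affine_map :: "(complex \<Rightarrow> complex) \<Rightarrow> (complex set \<Rightarrow> complex set) \<Rightarrow> bool" where
  "affine_map m \<phi> \<longleftrightarrow> linear m \<and> (\<forall>x \<in> surface d - cone_points d. \<phi> x \<in> surface d - cone_points d) \<and>
    (\<forall>p \<in> P - V. \<forall>v. (\<exists>\<epsilon>>0. \<forall>s\<in>{0..<\<epsilon>}. p + s *\<^sub>R v \<in> P) \<longrightarrow>
      (\<exists>\<epsilon>>0. \<exists>q \<in> \<phi> (proj d p). \<forall>s\<in>{0..<\<epsilon>}. q + s *\<^sub>R m v \<in> P \<and> \<phi> (proj d (p + s *\<^sub>R v)) = proj d (q + s *\<^sub>R m v)))"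

lemma affine_map_germ:
  assumes "affine_map m \<phi>" "p \<in> P" "p \<notin> V" "0 < e" "\<And>s. 0 \<le> s \<Longrightarrow> s < e \<Longrightarrow> p + s *\<^sub>R v \<in> P"
  obtains e' q where "0 < e'" "q \<in> \<phi> (proj d p)"
    "\<And>s. 0 \<le> s \<Longrightarrow> s < e' \<Longrightarrow> q + s *\<^sub>R m v \<in> P \<and> \<phi> (proj d (p + s *\<^sub>R v)) = proj d (q + s *\<^sub>R m v)"
proof -
  have "\<exists>\<epsilon>>0. \<forall>s\<in>{0..<\<epsilon>}. p + s *\<^sub>R v \<in> P" using assms by (intro exI[of _ e]) auto
  with assms(1-3) obtain e' where "0 < e'" "\<exists>q \<in> \<phi> (proj d p). \<forall>s\<in>{0..<e'}. q + s *\<^sub>R m v \<in> P \<and> \<phi> (proj d (p + s *\<^sub>R v)) = proj d (q + s *\<^sub>R m v)"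
    unfolding affine_map_def by blast
  thus ?thesis using that by auto
qed

lemma affine_map_straight:
  assumes af: "affine_map m \<phi>" and s: "straight v a c \<gamma>"
    and nc: "\<And>t. a \<le> t \<Longrightarrow> t \<le> c \<Longrightarrow> \<gamma> t \<notin> cone_points d"
  shows "straight (m v) a c (\<lambda>t. \<phi> (\<gamma> t))"
  unfolding straight_def
proof (intro ballI conjI impI)
  fix t assume t: "t \<in> {a..c}"
  have x: "\<gamma> t \<in> surface d - cone_points d" using s nc t unfolding straight_def by auto
  show "\<phi> (\<gamma> t) \<in> surface d" using af x unfolding affine_map_def by auto
  have nonvertex: "p \<in> P \<and> p \<notin> V \<and> \<gamma> t = proj d p" if "p \<in> \<gamma> t" for p
    using in_surfaceD[of "\<gamma> t" p] that x proj_cone_iff[of p] by auto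
  show "rgerm (\<lambda>t. \<phi> (\<gamma> t)) (m v) t" if "t < c"
  proof -
    have "rgerm \<gamma> v t" using s t that unfolding straight_def by auto
    then obtain e p where p: "0 < e" "p \<in> \<gamma> t" "\<And>s. 0 \<le> s \<Longrightarrow> s < e \<Longrightarrow> p + s *\<^sub>R v \<in> P \<and> \<gamma> (t + s) = proj d (p + s *\<^sub>R v)"
      unfolding rgerm_def by auto
    have r: "p \<in> P" "p \<notin> V" "\<gamma> t = proj d p" using nonvertex p by auto
    obtain e' q where q: "0 < e'" "q \<in> \<phi> (proj d p)"
      "\<And>s. 0 \<le> s \<Longrightarrow> s < e' \<Longrightarrow> q + s *\<^sub>R m v \<in> P \<and> \<phi> (proj d (p + s *\<^sub>R v)) = proj d (q + s *\<^sub>R m v)"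
      using affine_map_germ[OF af r(1,2) p(1)] p(3) by metis
    show ?thesis unfolding rgerm_def using p q r
      by (intro exI[of _ "min e e'"] conjI bexI[of _ q]) auto
  qed
  show "lgerm (\<lambda>t. \<phi> (\<gamma> t)) (m v) t" if "a < t"
  proof -
    have "lgerm \<gamma> v t" using s t that unfolding straight_def by auto
    then obtain e p where p: "0 < e" "p \<in> \<gamma> t" "\<And>s. 0 \<le> s \<Longrightarrow> s < e \<Longrightarrow> p - s *\<^sub>R v \<in> P \<and> \<gamma> (t - s) = proj d (p - s *\<^sub>R v)"
      unfolding lgerm_def by auto
    have r: "p \<in> P" "p \<notin> V" "\<gamma> t = proj d p" using nonvertex p by auto
    have mm: "m (- v) = - m v" using af unfolding affine_map_def by (simp add: linear_neg)
    have pp: "p + s *\<^sub>R (- v) \<in> P" if "0 \<le> s" "s < e" for s using p(3)[OF that] by simp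
    obtain e' q where q: "0 < e'" "q \<in> \<phi> (proj d p)"
      "\<And>s. 0 \<le> s \<Longrightarrow> s < e' \<Longrightarrow> q - s *\<^sub>R m v \<in> P \<and> \<phi> (proj d (p - s *\<^sub>R v)) = proj d (q - s *\<^sub>R m v)"
      using affine_map_germ[OF af r(1,2) p(1) pp] unfolding mm by (metis diff_conv_add_uminus scaleR_minus_right)
    show ?thesis unfolding lgerm_def using p q r
      by (intro exI[of _ "min e e'"] conjI bexI[of _ q]) auto
  qed
qed

lemma affine_map_comp:
  assumes 1: "affine_map m1 \<phi>1" and 2: "affine_map m2 \<phi>2"
  shows "affine_map (m1 \<circ> m2) (\<phi>1 \<circ> \<phi>2)"
  unfolding affine_map_def
proof (intro conjI ballI allI impI)
  show "linear (m1 \<circ> m2)" using 1 2 unfolding affine_map_def by (auto intro: linear_compose)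
  show "(\<phi>1 \<circ> \<phi>2) x \<in> surface d - cone_points d" if "x \<in> surface d - cone_points d" for x
    using that 1 2 unfolding affine_map_def by auto
  fix p v assume p: "p \<in> P - V" "\<exists>\<epsilon>>0. \<forall>s\<in>{0..<\<epsilon>}. p + s *\<^sub>R v \<in> P"
  have "proj d p \<in> surface d - cone_points d" using p proj_in_surface proj_cone_iff by auto
  hence x2: "\<phi>2 (proj d p) \<in> surface d - cone_points d" using 2 unfolding affine_map_def by auto
  from p obtain e where "0 < e" "\<And>s. 0 \<le> s \<Longrightarrow> s < e \<Longrightarrow> p + s *\<^sub>R v \<in> P" by auto
  then obtain e' q where q: "0 < e'" "q \<in> \<phi>2 (proj d p)"
    "\<And>s. 0 \<le> s \<Longrightarrow> s < e' \<Longrightarrow> q + s *\<^sub>R m2 v \<in> P \<and> \<phi>2 (proj d (p + s *\<^sub>R v)) = proj d (q + s *\<^sub>R m2 v)"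
    using affine_map_germ[OF 2] p by (metis DiffD1 DiffD2)
  have qq: "q \<in> P" "\<phi>2 (proj d p) = proj d q" using in_surfaceD q x2 by auto
  hence "q \<notin> V" using x2 proj_cone_iff by auto
  then obtain e'' r where r: "0 < e''" "r \<in> \<phi>1 (proj d q)"
    "\<And>s. 0 \<le> s \<Longrightarrow> s < e'' \<Longrightarrow> r + s *\<^sub>R m1 (m2 v) \<in> P \<and> \<phi>1 (proj d (q + s *\<^sub>R m2 v)) = proj d (r + s *\<^sub>R m1 (m2 v))"
    using affine_map_germ[OF 1 qq(1) _ q(1)] q(3) by metis
  show "\<exists>\<epsilon>>0. \<exists>q\<in>(\<phi>1 \<circ> \<phi>2) (proj d p). \<forall>s\<in>{0..<\<epsilon>}. q + s *\<^sub>R (m1 \<circ> m2) v \<in> P \<and>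
      (\<phi>1 \<circ> \<phi>2) (proj d (p + s *\<^sub>R v)) = proj d (q + s *\<^sub>R (m1 \<circ> m2) v)"
    using q r qq by (intro exI[of _ "min e' e''"] conjI bexI[of _ r]) auto
qed

section \<open>Horizontal cylinders and affine automorphisms\<close>

definition par :: "nat \<Rightarrow> int \<Rightarrow> nat" where "par j n = (if even n then j else opp j)"

text \<open>On the unrolled circle at relative height \<open>t\<close>, the chords of the two strips
  alternate with midpoints at the multiples of \<open>wd j\<close>. As consecutive half lengths add
  up to \<open>wd j\<close>, these chords tile the line and overlap only at endpoints;
  \<open>n\<close> numbers the chord that contains \<open>a\<close>.\<close>

definition valid :: "nat \<Rightarrow> int \<Rightarrow> real \<Rightarrow> real \<Rightarrow> bool" where
  "valid j n a t \<longleftrightarrow> \<bar>a - of_int n * wd j\<bar> \<le> hw (par j n) t"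

definition Dv :: "nat \<Rightarrow> int \<Rightarrow> real \<Rightarrow> real \<Rightarrow> complex" where
  "Dv j n a t = Pt (par j n) (a - of_int n * wd j) t"

text \<open>Unrolling of the horizontal cylinder made up of strip \<open>j\<close> and the opposite strip \<open>opp j\<close>, which
  are crossed alternately.\<close>

definition D :: "nat \<Rightarrow> real \<Rightarrow> real \<Rightarrow> complex set" where
  "D j a t = proj d (Dv j (SOME n. valid j n a t) a t)"

lemma par_less: "j + 1 < d \<Longrightarrow> par j n + 1 < d" using opp_less[of j] by (simp add: par_def)
lemma par_wd: "j + 1 < d \<Longrightarrow> wd (par j n) = wd j" by (simp add: par_def opp_wd)
lemma par_ht: "j + 1 < d \<Longrightarrow> ht (par j n) = ht j" by (simp add: par_def opp_ht)
lemma par_hw: "j + 1 < d \<Longrightarrow> odd (m - n) \<Longrightarrow> hw (par j m) t = wd j - hw (par j n) t"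
  by (auto simp: par_def opp_hw)

lemma valid_in_P:
  assumes "j + 1 < d" "0 \<le> t" "t \<le> 1" "valid j n a t" shows "Dv j n a t \<in> P"
  using assms Pt_in_P[OF par_less[OF assms(1)] assms(2,3)] by (simp add: Dv_def valid_def)

lemma valid_ex:
  assumes j: "j + 1 < d" shows "\<exists>n. valid j n a t"
proof -
  define m where "m = wd j"
  define h where "h = hw j t"
  have m: "0 < m" using wd_pos j by (simp add: m_def)
  \<comment> \<open>Brings \<open>a\<close> to within \<open>wd j\<close> of the midpoint of an
    even-numbered chord; that chord and its two neighbours then suffice.\<close>
  define q where "q = \<lfloor>(a + m) / (2 * m)\<rfloor>"
  have q1: "of_int q \<le> (a + m) / (2 * m)" and q2: "(a + m) / (2 * m) < of_int q + 1"
    unfolding q_def by linarith+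
  define x where "x = a - 2 * of_int q * m"
  have x: "- m \<le> x" "x < m" using q1 q2 m by (simp_all add: x_def field_simps)
  have e0: "valid j (2 * q) a t \<longleftrightarrow> \<bar>x\<bar> \<le> h"
    by (simp add: valid_def par_def x_def m_def h_def)
  have e1: "valid j (2 * q + 1) a t \<longleftrightarrow> \<bar>x - m\<bar> \<le> m - h"
    by (simp add: valid_def par_def x_def m_def h_def opp_hw[OF j] algebra_simps)
  have e2: "valid j (2 * q - 1) a t \<longleftrightarrow> \<bar>x + m\<bar> \<le> m - h"
    by (simp add: valid_def par_def x_def m_def h_def opp_hw[OF j] algebra_simps)
  consider "\<bar>x\<bar> \<le> h" | "h < x" | "x < - h" by linarith
  thus ?thesis
  proof cases
    case 2
    hence "\<bar>x - m\<bar> \<le> m - h" using x by linarith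
    thus ?thesis using e1 by blast
  next
    case 3
    hence "\<bar>x + m\<bar> \<le> m - h" using x by linarith
    thus ?thesis using e2 by blast
  qed (use e0 in blast)
qed

text \<open>Two valid indices are consecutive and \<open>a\<close> is the common end of their
  chords, where the side pairing identifies the two points. Hence \<open>D\<close> does not depend
  on the choice of the index.\<close>

lemma valid_proj_aux:
  assumes j: "j + 1 < d" "0 \<le> t" "t \<le> 1" and v: "valid j n a t" "valid j n' a t" and lt: "n < n'"
  shows "proj d (Dv j n a t) = proj d (Dv j n' a t)"
proof -
  have m: "0 < wd j" using wd_pos j by simp
  define h h' where "h = hw (par j n) t" and "h' = hw (par j n') t"
  have a: "a - of_int n * wd j \<le> h" "- h' \<le> a - of_int n' * wd j"
    using v unfolding valid_def h_def h'_def by linarith+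
  hence nn: "of_int (n' - n) * wd j \<le> h + h'" by (simp add: algebra_simps)
  have hp: "0 < hw j t" "0 < hw (opp j) t" using hw_pos opp_less j by auto
  have h2: "h < wd j" "h' < wd j"
    using hp opp_hw[OF j(1), of t] unfolding h_def h'_def par_def by auto
  have "of_int (n' - n) * wd j < 2 * wd j" using nn h2 by linarith
  hence "n' = n + 1" using lt m by simp
  hence e: "h' = wd j - h" unfolding h_def h'_def using par_hw[OF j(1), of n' n] by simp
  have a': "a - of_int n * wd j = h" using a \<open>n' = n + 1\<close> e by (simp add: algebra_simps)
  have pn: "par j n' = opp (par j n)" using \<open>n' = n + 1\<close> j by (simp add: par_def opp_opp)
  have "Dv j n a t \<in> side d (par j n)" unfolding Dv_def a' h_def using Pt_right j by simp
  from glue_shift[OF this] have "(Dv j n a t, Dv j n' a t) \<in> glue d"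
    using Pt_shift[OF par_less[OF j(1)], of n "a - of_int n * wd j" t] par_wd[OF j(1), of n] pn \<open>n' = n + 1\<close>
    by (simp add: Dv_def algebra_simps)
  thus ?thesis using proj_eq_iff valid_in_P j v by simp
qed

lemma D_eq:
  assumes j: "j + 1 < d" "0 \<le> t" "t \<le> 1" and v: "valid j n a t"
  shows "D j a t = proj d (Dv j n a t)"
proof -
  define k where "k = (SOME n. valid j n a t)"
  have k: "valid j k a t" unfolding k_def using v by (rule someI)
  have "proj d (Dv j k a t) = proj d (Dv j n a t)"
    by (cases k n rule: linorder_cases)
      (simp_all only: valid_proj_aux[OF j k v] valid_proj_aux[OF j v k, symmetric])
  thus ?thesis by (simp add: D_def k_def)
qed

lemma D_obtain:
  assumes "j + 1 < d" "0 \<le> t" "t \<le> 1"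
  obtains n where "valid j n a t" "Dv j n a t \<in> P" "D j a t = proj d (Dv j n a t)"
  using valid_ex[OF assms(1)] D_eq[OF assms] valid_in_P[OF assms] by metis

lemma D_surface:
  assumes "j + 1 < d" "0 \<le> t" "t \<le> 1" shows "D j a t \<in> surface d"
  by (rule D_obtain[OF assms, of a]) (simp add: proj_in_surface)

lemma D_Pt: "j + 1 < d \<Longrightarrow> 0 \<le> t \<Longrightarrow> t \<le> 1 \<Longrightarrow> \<bar>a\<bar> \<le> hw j t \<Longrightarrow> D j a t = proj d (Pt j a t)"
  using D_eq[of j t 0 a] by (simp add: valid_def par_def Dv_def)

lemma D_noncone:
  assumes j: "j + 1 < d" "0 < t" "t < 1" shows "D j a t \<notin> cone_points d"
proof -
  have t: "0 \<le> t" "t \<le> 1" using j by auto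
  obtain n where n: "Dv j n a t \<in> P" "D j a t = proj d (Dv j n a t)" using D_obtain[OF j(1) t] .
  have "Dv j n a t \<notin> V" unfolding Dv_def by (rule Pt_nonvertex[OF par_less[OF j(1)] j(2,3)])
  thus ?thesis using n proj_cone_iff by simp
qed

lemma D_period:
  assumes j: "j + 1 < d" "0 \<le> t" "t \<le> 1" shows "D j (a + 2 * of_int k * wd j) t = D j a t"
proof -
  obtain n where n: "valid j n a t" "D j a t = proj d (Dv j n a t)" using D_obtain[OF j] .
  have e: "a + 2 * of_int k * wd j - of_int (n + 2 * k) * wd j = a - of_int n * wd j" by (simp add: algebra_simps)
  have p: "par j (n + 2 * k) = par j n" by (simp add: par_def)
  have "valid j (n + 2 * k) (a + 2 * of_int k * wd j) t" using n(1) unfolding valid_def e p .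
  from D_eq[OF j this] show ?thesis using n(2) unfolding Dv_def e p by simp
qed

text \<open>A point inside a cylinder determines its relative height, and its strip up to exchanging
  the two strips of the cylinder, which have the same \<open>wd\<close>.\<close>

lemma D_level:
  assumes j: "j + 1 < d" "0 < t" "t < 1" and k: "k + 1 < d" "0 \<le> t'" "t' \<le> 1" and eq: "D j a t = D k c t'"
  shows "t' = t \<and> wd k = wd j"
proof -
  have t: "0 \<le> t" "t \<le> 1" using j by auto
  obtain n where n: "Dv j n a t \<in> P" "D j a t = proj d (Dv j n a t)" using D_obtain[OF j(1) t] .
  obtain n' where n': "Dv k n' c t' \<in> P" "D k c t' = proj d (Dv k n' c t')" using D_obtain[OF k] .
  have g: "(Dv j n a t, Dv k n' c t') \<in> glue d" using eq n n' proj_eq_iff by simp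
  define i where "i = par j n"
  have i: "i + 1 < d" "wd i = wd j" "opp i + 1 < d" "wd (opp i) = wd j"
    using par_less[OF j(1)] par_wd[OF j(1)] opp_less opp_wd unfolding i_def by auto
  have "Dv k n' c t' = Dv j n a t \<or> (\<exists>x. Dv k n' c t' = Pt (opp i) x t)"
    using Pt_glue[OF i(1) j(2,3), of "a - of_int n * wd j"] g unfolding Dv_def i_def by blast
  then obtain l x where l: "l \<in> {i, opp i}" "Dv k n' c t' = Pt l x t"
    unfolding i_def Dv_def[of j n a t] by auto
  hence "sy l + t * ht l = sy (par k n') + t' * ht (par k n')" using Yc_Pt Dv_def by metis
  from strip_height_unique[OF _ par_less[OF k(1)] j(2,3) k(2,3) this] l i
  have "l = par k n' \<and> t = t'" by auto
  thus ?thesis using l i par_wd[OF k(1), of n'] by auto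
qed

lemma small_nonneg:
  fixes x y :: real
  assumes "0 \<le> x" "x = 0 \<Longrightarrow> 0 \<le> y"
  obtains e where "0 < e" "\<And>s. 0 \<le> s \<Longrightarrow> s < e \<Longrightarrow> 0 \<le> x + s * y"
proof (cases "0 \<le> y")
  case True
  thus ?thesis using assms by (intro that[of 1]) auto
next
  case False
  hence x: "0 < x" using assms by force
  show ?thesis
  proof (rule that[of "x / (- y)"])
    show "0 < x / (- y)" using x False by (simp add: field_simps)
    fix s assume "0 \<le> s" "s < x / (- y)"
    thus "0 \<le> x + s * y" using False by (simp add: field_simps)
  qed
qed

lemma hw_linear: "hw j (t + s * w) = hw j t + s * (w * (sx (j + 1) - sx j))"
  by (simp add: hw_def algebra_simps)

text \<open>A segment starting at the end of a chord and leaving it has to be read in the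
  neighbouring chord from the outset, so the index depends on the velocity.\<close>

lemma valid_germ:
  assumes j: "j + 1 < d" "0 \<le> t" "t \<le> 1"
  obtains n e where "0 < e" "\<And>s. 0 \<le> s \<Longrightarrow> s < e \<Longrightarrow> valid j n (a + s * x) (t + s * w)"
proof -
  obtain n where n: "valid j n a t" using valid_ex[OF j(1)] by blast
  define i where "i = par j n"
  have i: "i + 1 < d" "wd i = wd j" using par_less par_wd j unfolding i_def by auto
  define g where "g = w * (sx (i + 1) - sx i)"
  define h where "h = hw i t"
  define al where "al = a - of_int n * wd j"
  have al: "\<bar>al\<bar> \<le> h" using n unfolding valid_def al_def h_def i_def .
  have h: "0 < h" "h < wd j"
    using hw_pos[OF i(1) j(2,3)] hw_pos[OF opp_less[OF i(1)] j(2,3)] opp_hw[OF i(1), of t] i unfolding h_def by auto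
  have v0: "valid j n (a + s * x) (t + s * w) \<longleftrightarrow> 0 \<le> (h - al) + s * (g - x) \<and> 0 \<le> (h + al) + s * (g + x)" for s
    unfolding valid_def i_def[symmetric] hw_linear[of i] g_def[symmetric] h_def[symmetric] al_def
    by (auto simp: abs_le_iff algebra_simps)
  have pm: "hw (par j (n + 1)) t' = wd j - hw i t'" "hw (par j (n - 1)) t' = wd j - hw i t'" for t'
    unfolding i_def by (rule par_hw[OF j(1)]; simp)+
  have v1: "valid j (n + 1) (a + s * x) (t + s * w) \<longleftrightarrow> 0 \<le> (al - h) + s * (x - g) \<and> 0 \<le> (2 * wd j - h - al) + s * (- g - x)" for s
    unfolding valid_def pm hw_linear[of i] g_def[symmetric] h_def[symmetric] al_def
    by (auto simp: abs_le_iff algebra_simps)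
  have v2: "valid j (n - 1) (a + s * x) (t + s * w) \<longleftrightarrow> 0 \<le> (- al - h) + s * (- x - g) \<and> 0 \<le> (2 * wd j - h + al) + s * (- g + x)" for s
    unfolding valid_def pm hw_linear[of i] g_def[symmetric] h_def[symmetric] al_def
    by (auto simp: abs_le_iff algebra_simps)
  note goal = that
  \<comment> \<open>Validity is a pair of affine inequalities in \<open>s\<close>. Each persists for
    a short time if it is strict at 0 or does not decrease.\<close>
  have both: thesis if A: "0 \<le> A" "A = 0 \<Longrightarrow> 0 \<le> B" and C: "0 \<le> C" "C = 0 \<Longrightarrow> 0 \<le> E"
    and k: "\<And>s. valid j k (a + s * x) (t + s * w) \<longleftrightarrow> 0 \<le> A + s * B \<and> 0 \<le> C + s * E" for A B C E k
  proof -
    obtain e1 where e1: "0 < e1" "\<And>s. 0 \<le> s \<Longrightarrow> s < e1 \<Longrightarrow> 0 \<le> A + s * B" using small_nonneg A by blast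
    obtain e2 where e2: "0 < e2" "\<And>s. 0 \<le> s \<Longrightarrow> s < e2 \<Longrightarrow> 0 \<le> C + s * E" using small_nonneg C by blast
    show thesis
    proof (rule goal)
      show "0 < min e1 e2" using e1 e2 by simp
      show "valid j k (a + s * x) (t + s * w)" if "0 \<le> s" "s < min e1 e2" for s
        unfolding k using e1(2) e2(2) that by simp
    qed
  qed
  consider "al = h" "x > g" | "al = - h" "- x > g" | "al = h \<longrightarrow> x \<le> g" "al = - h \<longrightarrow> - x \<le> g" by linarith
  thus thesis
  proof cases
    case 1
    show thesis by (rule both[OF _ _ _ _ v1]) (use 1 h in auto)
  next
    case 2
    show thesis by (rule both[OF _ _ _ _ v2]) (use 2 h in auto)
  next
    case 3
    show thesis by (rule both[OF _ _ _ _ v0]) (use 3 al in auto)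
  qed
qed

lemma Pt_move: "j + 1 < d \<Longrightarrow> Pt j (a + s * x) (t + s * (y / ht j)) = Pt j a t + s *\<^sub>R (kap * Complex x y)"
  using ht_pos[of j] by (simp add: Pt_def complex_eq_iff algebra_simps)

lemma D_germ:
  assumes j: "j + 1 < d" "0 \<le> t" "t \<le> 1" and e: "0 < e"
    and w: "\<And>s. 0 \<le> s \<Longrightarrow> s < e \<Longrightarrow> 0 \<le> t + s * (y / ht j) \<and> t + s * (y / ht j) \<le> 1"
  obtains e' p where "0 < e'" "p \<in> D j a t"
    "\<And>s. 0 \<le> s \<Longrightarrow> s < e' \<Longrightarrow> p + s *\<^sub>R (kap * Complex x y) \<in> P \<and>
      D j (a + s * x) (t + s * (y / ht j)) = proj d (p + s *\<^sub>R (kap * Complex x y))"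
proof -
  obtain n e1 where n: "0 < e1" "\<And>s. 0 \<le> s \<Longrightarrow> s < e1 \<Longrightarrow> valid j n (a + s * x) (t + s * (y / ht j))"
    by (rule valid_germ[OF j, of a x "y / ht j"]) blast
  have v0: "valid j n a t" using n(2)[of 0] n(1) by simp
  have mv: "Dv j n (a + s * x) (t + s * (y / ht j)) = Dv j n a t + s *\<^sub>R (kap * Complex x y)" for s
    using Pt_move[OF par_less[OF j(1)], of n "a - of_int n * wd j" s x t y] unfolding Dv_def par_ht[OF j(1)]
    by (simp add: algebra_simps)
  show ?thesis
  proof (rule that[of "min e e1" "Dv j n a t"])
    show "0 < min e e1" using e n by simp
    show "Dv j n a t \<in> D j a t" using D_eq[OF j v0] valid_in_P[OF j v0] proj_self by simp
    fix s assume s: "0 \<le> s" "s < min e e1"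
    hence v: "valid j n (a + s * x) (t + s * (y / ht j))" using n by simp
    have w': "0 \<le> t + s * (y / ht j)" "t + s * (y / ht j) \<le> 1" using w s by auto
    show "Dv j n a t + s *\<^sub>R (kap * Complex x y) \<in> P \<and>
      D j (a + s * x) (t + s * (y / ht j)) = proj d (Dv j n a t + s *\<^sub>R (kap * Complex x y))"
      using D_eq[OF j(1) w' v] valid_in_P[OF j(1) w' v] unfolding mv by simp
  qed
qed

text \<open>A line in the unrolled coordinates projects to a straight path however often it crosses
  sides, provided that it stays within the height of the cylinder.\<close>

lemma D_straight:
  assumes j: "j + 1 < d" and w: "\<And>s. 0 \<le> s \<Longrightarrow> s \<le> c \<Longrightarrow> 0 \<le> t + s * (y / ht j) \<and> t + s * (y / ht j) \<le> 1"
  shows "straight (kap * Complex x y) 0 c (\<lambda>s. D j (a + s * x) (t + s * (y / ht j)))"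
  unfolding straight_def
proof (intro ballI conjI impI)
  fix s assume s: "s \<in> {0..c}"
  have t: "0 \<le> t + s * (y / ht j)" "t + s * (y / ht j) \<le> 1" using w s by auto
  show "D j (a + s * x) (t + s * (y / ht j)) \<in> surface d" using D_surface j t by auto
  let ?\<gamma> = "\<lambda>s. D j (a + s * x) (t + s * (y / ht j))"
  show "rgerm ?\<gamma> (kap * Complex x y) s" if "s < c"
  proof -
    have 1: "0 < c - s" using that by simp
    have 2: "0 \<le> t + s * (y / ht j) + r * (y / ht j) \<and> t + s * (y / ht j) + r * (y / ht j) \<le> 1" if "0 \<le> r" "r < c - s" for r
      using w[of "s + r"] that s by (simp add: algebra_simps add_divide_distrib)
    from D_germ[OF j t 1 2] obtain e p where p: "0 < e" "p \<in> ?\<gamma> s"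
      "\<And>r. 0 \<le> r \<Longrightarrow> r < e \<Longrightarrow> p + r *\<^sub>R (kap * Complex x y) \<in> P \<and>
      D j (a + s * x + r * x) (t + s * (y / ht j) + r * (y / ht j)) = proj d (p + r *\<^sub>R (kap * Complex x y))" by metis
    have eq: "?\<gamma> (s + r) = D j (a + s * x + r * x) (t + s * (y / ht j) + r * (y / ht j))" for r
      by (simp add: algebra_simps add_divide_distrib)
    show ?thesis unfolding rgerm_def eq using p by (intro exI[of _ e] conjI bexI[of _ p] ballI) simp_all
  qed
  show "lgerm ?\<gamma> (kap * Complex x y) s" if "0 < s"
  proof -
    have 2: "0 \<le> t + s * (y / ht j) + r * (- y / ht j) \<and> t + s * (y / ht j) + r * (- y / ht j) \<le> 1" if "0 \<le> r" "r < s" for r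
      using w[of "s - r"] that s by (simp add: algebra_simps diff_divide_distrib)
    from D_germ[OF j t \<open>0 < s\<close> 2] obtain e p where p: "0 < e" "p \<in> ?\<gamma> s"
      "\<And>r. 0 \<le> r \<Longrightarrow> r < e \<Longrightarrow> p + r *\<^sub>R (kap * Complex (- x) (- y)) \<in> P \<and>
      D j (a + s * x + r * (- x)) (t + s * (y / ht j) + r * (- y / ht j)) = proj d (p + r *\<^sub>R (kap * Complex (- x) (- y)))" by metis
    have eq: "?\<gamma> (s - r) = D j (a + s * x + r * (- x)) (t + s * (y / ht j) + r * (- y / ht j))" for r
      by (simp add: algebra_simps diff_divide_distrib)
    have neg: "p + r *\<^sub>R (kap * Complex (- x) (- y)) = p - r *\<^sub>R (kap * Complex x y)" for r
      by (simp add: complex_eq_iff algebra_simps)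
    show ?thesis unfolding lgerm_def eq using p unfolding neg by (intro exI[of _ e] conjI bexI[of _ p] ballI) simp_all
  qed
qed

text \<open>Makes the shear well defined. Inside a cylinder both displacements are horizontal
  straight paths from one point with the same velocity; on the boundary they are multiples of the
  circumference and hence trivial.\<close>

lemma D_translate:
  assumes j: "j + 1 < d" "0 \<le> t" "t \<le> 1" and k: "k + 1 < d" "0 \<le> t'" "t' \<le> 1" and eq: "D j a t = D k c t'"
  shows "D j (a + 2 * of_int n * wd j * t) t = D k (c + 2 * of_int n * wd k * t') t'"
proof (cases "0 < t \<and> t < 1")
  case True
  hence l: "t' = t" "wd k = wd j" using D_level[OF j(1) _ _ k eq] by auto
  define r where "r = 2 * of_int n * wd j * t"
  have s1: "straight (kap * Complex r 0) 0 1 (\<lambda>s. D j (a + s * r) (t + s * (0 / ht j)))"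
    by (rule D_straight[OF j(1)]) (use j in auto)
  have s2: "straight (kap * Complex r 0) 0 1 (\<lambda>s. D k (c + s * r) (t + s * (0 / ht k)))"
    by (rule D_straight[OF k(1)]) (use j in auto)
  have "D j (a + 1 * r) (t + 1 * (0 / ht j)) = D k (c + 1 * r) (t + 1 * (0 / ht k))"
    by (rule straight_unique[OF s1 s2]) (use D_noncone j True eq l in auto)
  thus ?thesis by (simp add: l r_def)
next
  case False
  hence t: "t = 0 \<or> t = 1" using j by auto
  have "\<not> (0 < t' \<and> t' < 1)" using D_level[OF k(1) _ _ j eq[symmetric]] False by auto
  hence t': "t' = 0 \<or> t' = 1" using k by auto
  have "D j (a + 2 * of_int n * wd j * t) t = D j a t" using t by (elim disjE) (use D_period[OF j, of a n] in simp_all)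
  moreover have "D k (c + 2 * of_int n * wd k * t') t' = D k c t'" using t' by (elim disjE) (use D_period[OF k, of c n] in simp_all)
  ultimately show ?thesis using eq by simp
qed

text \<open>In every cylinder the inverse modulus \<open>2 wd j / ht j\<close> is \<open>2 cot b\<close>, so that the shear by an integral
  multiple of \<open>2 cot b\<close> fixes the boundaries of all cylinders pointwise.\<close>

definition shear :: "int \<Rightarrow> complex set \<Rightarrow> complex set" where
  "shear n x = (SOME y. \<exists>j a t. j + 1 < d \<and> 0 \<le> t \<and> t \<le> 1 \<and> x = D j a t \<and> y = D j (a + 2 * of_int n * wd j * t) t)"

lemma shear_D:
  assumes j: "j + 1 < d" "0 \<le> t" "t \<le> 1"
  shows "shear n (D j a t) = D j (a + 2 * of_int n * wd j * t) t"
  unfolding shear_def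
proof (rule some_equality)
  fix y assume "\<exists>k c t'. k + 1 < d \<and> 0 \<le> t' \<and> t' \<le> 1 \<and> D j a t = D k c t' \<and> y = D k (c + 2 * of_int n * wd k * t') t'"
  thus "y = D j (a + 2 * of_int n * wd j * t) t" using D_translate[OF j] by metis
qed (use j in blast)

lemma surface_D:
  assumes "x \<in> surface d" obtains j a t where "j + 1 < d" "0 \<le> t" "t \<le> 1" "\<bar>a\<bar> \<le> hw j t" "x = D j a t"
proof -
  obtain p where p: "p \<in> P" "x = proj d p" using assms surface_eq by auto
  from P_strip[OF p(1)] obtain j a t where "j + 1 < d" "0 \<le> t" "t \<le> 1" "\<bar>a\<bar> \<le> hw j t" "p = Pt j a t" .
  thus ?thesis using that[of j t a] p D_Pt[of j t a] by simp
qed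

lemma shear_surface:
  assumes "x \<in> surface d" shows "shear n x \<in> surface d"
  by (rule surface_D[OF assms]) (simp add: shear_D[simplified] D_surface[simplified])

lemma shear_inverse:
  assumes "x \<in> surface d" shows "shear (- n) (shear n x) = x"
  by (rule surface_D[OF assms]) (simp add: shear_D[simplified])

lemma shear_noncone: "x \<in> surface d \<Longrightarrow> x \<notin> cone_points d \<Longrightarrow> shear n x \<notin> cone_points d"
proof -
  assume x: "x \<in> surface d" "x \<notin> cone_points d"
  obtain j a t where j: "j + 1 < d" "0 \<le> t" "t \<le> 1" "x = D j a t" by (rule surface_D[OF x(1)])
  show ?thesis
  proof (cases "0 < t \<and> t < 1")
    case True
    thus ?thesis using j D_noncone shear_D by simp
  next
    case False
    hence "t = 0 \<or> t = 1" using j by auto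
    hence "D j (a + 2 * of_int n * wd j * t) t = D j a t" by (elim disjE) (use D_period[OF j(1-3), of a n] in simp_all)
    hence "shear n x = x" using j(4) shear_D[OF j(1-3), of n a] by simp
    thus ?thesis using x by simp
  qed
qed

section \<open>The derivative of the shear\<close>

definition shear_map :: "real \<Rightarrow> complex \<Rightarrow> complex" where
  "shear_map r z = z + of_real (r * Yc z) * kap"

definition twist :: real where "twist = 2 * cos b / sin b"

lemma twist_ht: "twist * ht j = 2 * wd j"
  using sin_b_pos by (simp add: twist_def ht_eq wd_eq field_simps)

lemma shear_map_local: "shear_map r (kap * Complex x y) = kap * Complex (x + r * y) y"
  by (simp add: shear_map_def XY_kap complex_eq_iff algebra_simps)

lemma Yc_linear: "linear Yc"
  by (auto intro!: linearI simp: Yc_def algebra_simps)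

lemma linear_shear_map: "linear (shear_map r)"
  by (rule linearI) (simp_all add: shear_map_def Yc_def algebra_simps scaleR_conv_of_real)

text \<open>A point on a horizontal diagonal must be assigned to the strip into which the segment
  moves, so the choice depends on the sign of \<open>Yc v\<close>.\<close>

lemma strip_germ:
  assumes p: "p \<in> P" and e: "0 < e" and v: "\<And>s. 0 \<le> s \<Longrightarrow> s < e \<Longrightarrow> p + s *\<^sub>R v \<in> P"
  obtains j a t e' where "j + 1 < d" "0 \<le> t" "t \<le> 1" "p = Pt j a t" "0 < e'" "e' \<le> e"
    "\<And>s. 0 \<le> s \<Longrightarrow> s < e' \<Longrightarrow> 0 \<le> t + s * (Yc v / ht j) \<and> t + s * (Yc v / ht j) \<le> 1"
proof -
  have Yl: "Yc (p + s *\<^sub>R v) = Yc p + s * Yc v" for s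
    by (simp add: linear_add[OF Yc_linear] linear_cmul[OF Yc_linear])
  \<comment> \<open>A later point of the segment shows that \<open>p\<close> is not at the extreme
    height towards which \<open>v\<close> points.\<close>
  have e2: "0 \<le> e / 2" "e / 2 < e" using e by auto
  have rng: "sy 0 \<le> Yc p + (e / 2) * Yc v" "Yc p + (e / 2) * Yc v \<le> sy (d - 1)"
    using Yc_range[OF v[OF e2]] unfolding Yl by auto
  have "\<exists>j t. j + 1 < d \<and> 0 \<le> t \<and> t \<le> 1 \<and> Yc p = sy j + t * ht j \<and> (t = 0 \<longrightarrow> 0 \<le> Yc v) \<and> (t = 1 \<longrightarrow> Yc v \<le> 0)"
  proof -
    consider "Yc v = 0" | "0 < Yc v" | "Yc v < 0" by linarith
    thus ?thesis
    proof cases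
      case 1
      obtain j a t where "j + 1 < d" "0 \<le> t" "t \<le> 1" "p = Pt j a t" by (rule P_strip[OF p])
      thus ?thesis using 1 Yc_Pt by auto
    next
      case 2
      hence "0 < (e/2) * Yc v" using e by simp
      hence "Yc p < sy (d - 1)" using rng by linarith
      from strip_ex_up[OF Yc_range(1)[OF p] this] obtain j t where "j + 1 < d" "0 \<le> t" "t < 1" "Yc p = sy j + t * ht j" .
      thus ?thesis using 2 by (intro exI[of _ j] exI[of _ t]) auto
    next
      case 3
      hence "(e/2) * Yc v < 0" using e by (simp add: mult_pos_neg)
      hence "sy 0 < Yc p" using rng by linarith
      from strip_ex_down[OF this Yc_range(2)[OF p]] obtain j t where "j + 1 < d" "0 < t" "t \<le> 1" "Yc p = sy j + t * ht j" .
      thus ?thesis using 3 by (intro exI[of _ j] exI[of _ t]) auto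
    qed
  qed
  then obtain j t where j: "j + 1 < d" "0 \<le> t" "t \<le> 1" "Yc p = sy j + t * ht j" "t = 0 \<Longrightarrow> 0 \<le> Yc v" "t = 1 \<Longrightarrow> Yc v \<le> 0" by blast
  have h: "0 < ht j" using ht_pos j by simp
  obtain e1 where e1: "0 < e1" "\<And>s. 0 \<le> s \<Longrightarrow> s < e1 \<Longrightarrow> 0 \<le> t + s * (Yc v / ht j)"
    using small_nonneg[of t "Yc v / ht j"] j h by (metis divide_nonneg_pos)
  have "t = 1 \<Longrightarrow> 0 \<le> - (Yc v / ht j)" using j(6) h by (simp add: divide_nonpos_pos)
  then obtain e2 where e2: "0 < e2" "\<And>s. 0 \<le> s \<Longrightarrow> s < e2 \<Longrightarrow> 0 \<le> (1 - t) + s * (- (Yc v / ht j))"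
    using small_nonneg[of "1 - t" "- (Yc v / ht j)"] j by (metis diff_ge_0_iff_ge eq_iff_diff_eq_0)
  show ?thesis
  proof (rule that[OF j(1-3) Pt_of_Y[OF j(4)]])
    show "0 < min e (min e1 e2)" "min e (min e1 e2) \<le> e" using e e1 e2 by auto
    fix s assume "0 \<le> s" "s < min e (min e1 e2)"
    thus "0 \<le> t + s * (Yc v / ht j) \<and> t + s * (Yc v / ht j) \<le> 1" using e1(2)[of s] e2(2)[of s] by simp
  qed
qed

lemma shear_affine: "affine_map (shear_map (of_int n * twist)) (shear n)"
  unfolding affine_map_def
proof (intro conjI ballI allI impI linear_shear_map)
  fix x assume "x \<in> surface d - cone_points d"
  thus "shear n x \<in> surface d - cone_points d" using shear_surface shear_noncone by auto
next
  fix p v assume p: "p \<in> P - V" and "\<exists>e>0. \<forall>s\<in>{0..<e}. p + s *\<^sub>R v \<in> P"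
  then obtain e where e: "0 < e" "\<And>s. 0 \<le> s \<Longrightarrow> s < e \<Longrightarrow> p + s *\<^sub>R v \<in> P" by auto
  have pP: "p \<in> P" using p by simp
  obtain j a t e1 where j: "j + 1 < d" "0 \<le> t" "t \<le> 1" "p = Pt j a t" "0 < e1" "e1 \<le> e"
    and w: "\<And>s. 0 \<le> s \<Longrightarrow> s < e1 \<Longrightarrow> 0 \<le> t + s * (Yc v / ht j) \<and> t + s * (Yc v / ht j) \<le> 1"
    by (rule strip_germ[OF pP e]) auto
  have h: "0 < ht j" using ht_pos j by simp
  have v: "v = kap * Complex (Xc v) (Yc v)" by (rule XY_local)
  define N where "N = of_int n * twist"
  have mv: "shear_map N v = kap * Complex (Xc v + N * Yc v) (Yc v)" by (subst v, rule shear_map_local)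
  have Dp: "proj d (p + s *\<^sub>R v) = D j (a + s * Xc v) (t + s * (Yc v / ht j))" if "0 \<le> s" "s < e1" for s
  proof -
    have t': "0 \<le> t + s * (Yc v / ht j)" "t + s * (Yc v / ht j) \<le> 1" using w that by auto
    have eq: "p + s *\<^sub>R v = Pt j (a + s * Xc v) (t + s * (Yc v / ht j))"
      unfolding Pt_move[OF j(1)] using v j(4) by simp
    moreover have "p + s *\<^sub>R v \<in> P" using e(2) that j by simp
    ultimately have "\<bar>a + s * Xc v\<bar> \<le> hw j (t + s * (Yc v / ht j))" using Pt_in_P[OF j(1) t'] by simp
    thus ?thesis using eq D_Pt[OF j(1) t'] by simp
  qed
  \<comment> \<open>The shear's displacement is linear in the height, and the common modulus makes
    its rate the same in every strip; this is why one linear map serves the whole surface.\<close>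
  have shift: "2 * of_int n * wd j * (t + s * (Yc v / ht j)) = 2 * of_int n * wd j * t + s * (N * Yc v)" for s
  proof -
    have "2 * wd j = twist * ht j" by (simp add: twist_ht)
    hence "2 * of_int n * wd j * (s * (Yc v / ht j)) = s * (N * Yc v)"
      using h by (simp add: N_def field_simps)
    thus ?thesis by (simp add: algebra_simps)
  qed
  define a1 where "a1 = a + 2 * of_int n * wd j * t"
  have Sp: "shear n (proj d (p + s *\<^sub>R v)) = D j (a1 + s * (Xc v + N * Yc v)) (t + s * (Yc v / ht j))" if "0 \<le> s" "s < e1" for s
  proof -
    have "shear n (proj d (p + s *\<^sub>R v)) = D j (a + s * Xc v + 2 * of_int n * wd j * (t + s * (Yc v / ht j))) (t + s * (Yc v / ht j))"
      unfolding Dp[OF that] using w[OF that] by (intro shear_D[OF j(1)]) auto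
    also have "a + s * Xc v + 2 * of_int n * wd j * (t + s * (Yc v / ht j)) = a1 + s * (Xc v + N * Yc v)"
      unfolding shift a1_def by (simp add: algebra_simps)
    finally show ?thesis .
  qed
  from D_germ[OF j(1-3,5) w, where a = a1 and x = "Xc v + N * Yc v"] obtain e' q where q: "0 < e'" "q \<in> D j a1 t"
    "\<And>s. 0 \<le> s \<Longrightarrow> s < e' \<Longrightarrow> q + s *\<^sub>R shear_map N v \<in> P \<and>
      D j (a1 + s * (Xc v + N * Yc v)) (t + s * (Yc v / ht j)) = proj d (q + s *\<^sub>R shear_map N v)"
    unfolding mv by metis
  have "shear n (proj d p) = D j a1 t" using Sp[of 0] j by simp
  thus "\<exists>e>0. \<exists>q\<in>shear n (proj d p). \<forall>s\<in>{0..<e}. q + s *\<^sub>R shear_map (of_int n * twist) v \<in> P \<and>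
      shear n (proj d (p + s *\<^sub>R v)) = proj d (q + s *\<^sub>R shear_map (of_int n * twist) v)"
    using q Sp j(5) unfolding N_def[symmetric]
    by (intro exI[of _ "min e1 e'"] conjI bexI[of _ q]) auto
qed

section \<open>Rotations of the polygon\<close>

definition turn :: "nat \<Rightarrow> complex set \<Rightarrow> complex set" where
  "turn k x = (*) (vertex d k) ` x"

lemma vertex_mult_vertex: "vertex d k * vertex d j = vertex d (k + j)"
  by (simp add: vertex_cis cis_mult algebra_simps)

text \<open>The inverse rotation is written as a positive power, since vertices have natural
  indices.\<close>

lemma vertex_inverse: "vertex d ((2 * d - 1) * k) * vertex d k = 1" "vertex d k * vertex d ((2 * d - 1) * k) = 1"
proof -
  have "(2 * d - 1) * k + k = 0 + 2 * d * k" using d_ge by (cases d) (auto simp: algebra_simps)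
  hence "vertex d ((2 * d - 1) * k + k) = vertex d 0" using vertex_mult[of 0 k] by simp
  thus "vertex d ((2 * d - 1) * k) * vertex d k = 1" unfolding vertex_mult_vertex by (simp add: vertex_cis)
  thus "vertex d k * vertex d ((2 * d - 1) * k) = 1" by (simp add: mult.commute)
qed

lemma turn_P: "p \<in> P \<Longrightarrow> vertex d k * p \<in> P"
proof -
  have "(*) (vertex d k) ` P = convex hull ((*) (vertex d k) ` V)"
    unfolding polygon_def by (rule convex_hull_linear_image) (simp add: bounded_linear.linear bounded_linear_mult_right)
  also have "\<dots> \<subseteq> P" unfolding polygon_def by (rule hull_mono) (auto simp: vertex_mult_vertex)
  finally show "p \<in> P \<Longrightarrow> vertex d k * p \<in> P" by blast
qed

lemma turn_V: "p \<in> V \<Longrightarrow> vertex d k * p \<in> V"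
  by (auto simp: vertex_mult_vertex)

lemma turn_glue: "(p, q) \<in> glue d \<Longrightarrow> (vertex d k * p, vertex d k * q) \<in> glue d"
proof -
  assume g: "(p, q) \<in> glue d"
  have step: "(vertex d k * x, vertex d k * y) \<in> side_pairing d" if xy: "(x, y) \<in> side_pairing d" for x y
  proof -
    obtain j where j: "x \<in> side d j" "y = x + side_shift d j" using xy unfolding side_pairing_def by auto
    obtain t where "0 \<le> t" "t \<le> 1" "x = (1 - t) *\<^sub>R vertex d j + t *\<^sub>R vertex d (j + 1)"
      using j(1) unfolding side_def closed_segment_def by auto
    hence "vertex d k * x \<in> side d (j + k)"
      unfolding side_def closed_segment_def
      by (auto simp: distrib_left vertex_mult_vertex add_ac intro!: exI[of _ t])
    moreover have "vertex d k * y = vertex d k * x + side_shift d (j + k)"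
      unfolding j(2) side_shift_eq by (simp add: algebra_simps vertex_mult_vertex)
    ultimately show ?thesis unfolding side_pairing_def by auto
  qed
  have "(p, q) \<in> (side_pairing d)\<^sup>*" "p \<in> P" "q \<in> P" using g unfolding glue_def by auto
  from this(1) have "(vertex d k * p, vertex d k * q) \<in> (side_pairing d)\<^sup>*"
    by induction (auto intro: rtrancl_into_rtrancl step)
  thus ?thesis using turn_P \<open>p \<in> P\<close> \<open>q \<in> P\<close> unfolding glue_def by auto
qed

lemma turn_proj: "turn k (proj d p) = proj d (vertex d k * p)"
proof (intro equalityI subsetI)
  fix q assume "q \<in> turn k (proj d p)"
  thus "q \<in> proj d (vertex d k * p)" using turn_glue unfolding turn_def by (auto simp: in_proj_iff)
next
  fix q assume "q \<in> proj d (vertex d k * p)"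
  hence "(vertex d k * p, q) \<in> glue d" by (simp add: in_proj_iff)
  from turn_glue[OF this, of "(2*d-1)*k"] have "(p, vertex d ((2*d-1)*k) * q) \<in> glue d"
    by (simp flip: mult.assoc add: vertex_inverse[simplified])
  moreover have "q = vertex d k * (vertex d ((2*d-1)*k) * q)"
    by (simp flip: mult.assoc add: vertex_inverse[simplified])
  ultimately show "q \<in> turn k (proj d p)" unfolding turn_def by (intro rev_image_eqI) (auto simp: in_proj_iff)
qed

lemma turn_inverse: "turn ((2*d-1)*k) (turn k x) = x" "turn k (turn ((2*d-1)*k) x) = x"
  unfolding turn_def image_image by (simp_all flip: mult.assoc add: vertex_inverse[simplified])

lemma turn_affine: "affine_map ((*) (vertex d k)) (turn k)"
  unfolding affine_map_def
proof (intro conjI ballI allI impI)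
  show "linear ((*) (vertex d k))" by (simp add: bounded_linear.linear bounded_linear_mult_right)
  fix x assume x: "x \<in> surface d - cone_points d"
  then obtain p where p: "p \<in> P" "x = proj d p" using surface_eq by auto
  have "vertex d k * p \<notin> V"
  proof
    assume "vertex d k * p \<in> V"
    from turn_V[OF this, of "(2*d-1)*k"] have "p \<in> V" by (simp flip: mult.assoc add: vertex_inverse[simplified])
    thus False using x p proj_cone_iff by auto
  qed
  thus "turn k x \<in> surface d - cone_points d"
    unfolding p(2) turn_proj using turn_P[OF p(1)] proj_in_surface proj_cone_iff by auto
next
  fix p v assume p: "p \<in> P - V" and "\<exists>e>0. \<forall>s\<in>{0..<e}. p + s *\<^sub>R v \<in> P"
  then obtain e where e: "0 < e" "\<And>s. 0 \<le> s \<Longrightarrow> s < e \<Longrightarrow> p + s *\<^sub>R v \<in> P" by auto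
  have eq: "vertex d k * p + s *\<^sub>R (vertex d k * v) = vertex d k * (p + s *\<^sub>R v)" for s by (simp add: algebra_simps)
  have "vertex d k * p \<in> turn k (proj d p)" using p proj_self by (auto simp: turn_def)
  thus "\<exists>e>0. \<exists>q\<in>turn k (proj d p). \<forall>s\<in>{0..<e}. q + s *\<^sub>R (vertex d k * v) \<in> P \<and>
      turn k (proj d (p + s *\<^sub>R v)) = proj d (q + s *\<^sub>R (vertex d k * v))"
    using e by (intro exI[of _ e] conjI bexI[of _ "vertex d k * p"]) (auto simp only: eq turn_proj atLeastLessThan_iff intro!: turn_P)
qed

section \<open>Invariance of the area measure\<close>

abbreviation "M \<equiv> surface_measure d"

lemma P_borel [measurable]: "P \<in> sets borel" using closed_P by (rule borel_closed)

lemma nrm_norm [simp]: "norm (nrm k) = 1" by (simp add: nrm_def)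

lemma ball_P: "ball 0 (cos b) \<subseteq> P"
proof
  fix p :: complex assume "p \<in> ball 0 (cos b)"
  hence "norm p < cos b" by simp
  hence "nrm k \<bullet> p \<le> cos b" for k using Cauchy_Schwarz_ineq2[of "nrm k" p] by simp
  thus "p \<in> P" by (rule P_halfplanes)
qed

text \<open>The interior of the polygon. Classes of its points are singletons, and its complement in
  \<open>P\<close> is null, so measure computations can be made here.\<close>

definition P0 :: "complex set" where "P0 = {p \<in> P. \<forall>k<2*d. nrm k \<bullet> p < cos b}"

lemma P0_P: "P0 \<subseteq> P" by (auto simp: P0_def)

lemma P0_nrm: "p \<in> P0 \<Longrightarrow> nrm k \<bullet> p < cos b"
proof -
  assume "p \<in> P0"
  moreover have "k mod (2 * d) < 2 * d" using d_ge by simp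
  ultimately have "nrm (k mod (2*d)) \<bullet> p < cos b" unfolding P0_def by blast
  thus ?thesis by (simp add: nrm_mod)
qed

lemma P0_proj: "p \<in> P0 \<Longrightarrow> proj d p = {p}"
  using proj_interior P0_nrm P0_P by blast

lemma P0_eq: "P0 = P \<inter> (\<Inter>k\<in>{..<2*d}. {p. nrm k \<bullet> p < cos b})"
  by (auto simp: P0_def)

lemma P0_eq': "P0 = (\<Inter>k\<in>{..<2*d}. {p. nrm k \<bullet> p < cos b})"
  unfolding P0_eq using P_halfplanes by (auto intro: less_imp_le)

lemma open_P0: "open P0"
  unfolding P0_eq' by (intro open_INT ballI open_halfspace_lt) auto

lemma P0_borel [measurable]: "P0 \<in> sets borel" using open_P0 by (rule borel_open)

lemma line_null:
  fixes a :: complex assumes "a \<noteq> 0" shows "{p. a \<bullet> p = c} \<in> null_sets lborel"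
proof -
  have "negligible {p. a \<bullet> p = c}" using assms by (intro negligible_hyperplane) auto
  moreover have "{p. a \<bullet> p = c} \<in> sets borel" by (intro borel_closed closed_hyperplane)
  ultimately show ?thesis by (simp add: negligible_iff_null_sets null_sets_completion_iff)
qed

lemma boundary_null: "P - P0 \<in> null_sets lborel"
proof -
  have "(\<Union>k\<in>{..<2*d}. {p. nrm k \<bullet> p = cos b}) \<in> null_sets lborel"
    by (intro null_sets_UN' line_null) (auto simp: nrm_def)
  moreover have "P - P0 \<subseteq> (\<Union>k\<in>{..<2*d}. {p. nrm k \<bullet> p = cos b})"
    using polygon_nrm_le by (force simp: P0_def intro: antisym)
  ultimately show ?thesis by (intro null_sets_subset[of _ lborel "P - P0"]) auto
qed

lemma emeasure_P: "emeasure lborel P \<noteq> 0" "emeasure lborel P \<noteq> \<infinity>"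
proof -
  have "emeasure lborel (ball (0::complex) (cos b)) \<le> emeasure lborel P"
    using ball_P by (intro emeasure_mono) auto
  moreover have "emeasure lborel (ball (0::complex) (cos b)) > 0"
    using cos_b_pos by (simp add: emeasure_ball unit_ball_vol_def)
  ultimately show "emeasure lborel P \<noteq> 0" by auto
  show "emeasure lborel P \<noteq> \<infinity>" using emeasure_compact_finite[OF compact_P] by auto
qed

definition pre :: "complex set set \<Rightarrow> complex set" where "pre E = {p \<in> P. proj d p \<in> E}"

text \<open>Hence the generated sigma-algebra in \<open>surface_measure\<close> contains no further
  sets, and measurability on the surface is Borel measurability of the preimage.\<close>

lemma sigma_algebra_quot: "sigma_algebra (surface d) {E. E \<subseteq> surface d \<and> pre E \<in> sets borel}"
proof (unfold sigma_algebra_iff2, intro conjI ballI allI impI)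
  fix E assume "E \<in> {E. E \<subseteq> surface d \<and> pre E \<in> sets borel}"
  moreover have "pre (surface d - E) = P - pre E" unfolding pre_def using proj_in_surface by auto
  ultimately show "surface d - E \<in> {E. E \<subseteq> surface d \<and> pre E \<in> sets borel}" by auto
next
  fix A :: "nat \<Rightarrow> complex set set" assume "range A \<subseteq> {E. E \<subseteq> surface d \<and> pre E \<in> sets borel}"
  moreover have "pre (\<Union>i. A i) = (\<Union>i. pre (A i))" unfolding pre_def by auto
  ultimately show "(\<Union>i. A i) \<in> {E. E \<subseteq> surface d \<and> pre E \<in> sets borel}" by auto
qed (auto simp: pre_def)

lemma space_M [simp]: "space M = surface d"
  by (simp add: surface_measure_def space_measure_of_conv)

lemma sets_M: "sets M = {E. E \<subseteq> surface d \<and> pre E \<in> sets borel}"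
proof -
  have "sets M = sigma_sets (surface d) {E. E \<subseteq> surface d \<and> pre E \<in> sets borel}"
    unfolding surface_measure_def pre_def by (simp add: sets_measure_of_conv) auto
  thus ?thesis using sigma_algebra.sigma_sets_eq[OF sigma_algebra_quot] by simp
qed

lemma sets_M_iff: "E \<in> sets M \<longleftrightarrow> E \<subseteq> surface d \<and> pre E \<in> sets borel"
  by (simp add: sets_M)

lemma proj_measurable: "proj d \<in> restrict_space borel P \<rightarrow>\<^sub>M M"
proof (rule measurableI)
  show "proj d x \<in> space M" if "x \<in> space (restrict_space borel P)" for x
    using that proj_in_surface by (simp add: space_restrict_space)
  fix E assume "E \<in> sets M"
  hence "pre E \<in> sets borel" by (simp add: sets_M)
  moreover have "proj d -` E \<inter> space (restrict_space borel P) = pre E"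
    by (auto simp: pre_def space_restrict_space)
  ultimately show "proj d -` E \<inter> space (restrict_space borel P) \<in> sets (restrict_space borel P)"
    by (auto simp: sets_restrict_space_iff pre_def)
qed

lemma emeasure_M:
  assumes E: "E \<in> sets M" shows "emeasure M E = emeasure lborel (pre E) / emeasure lborel P"
proof -
  let ?U = "uniform_measure (restrict_space lborel P) P"
  have m: "proj d \<in> ?U \<rightarrow>\<^sub>M sigma (surface d) {E. E \<subseteq> surface d \<and> {p \<in> P. proj d p \<in> E} \<in> sets borel}"
  proof -
    have "sets (sigma (surface d) {E. E \<subseteq> surface d \<and> {p \<in> P. proj d p \<in> E} \<in> sets borel}) = sets M"
      unfolding surface_measure_def by simp
    moreover have "sets ?U = sets (restrict_space borel P)" by (simp add: sets_restrict_space)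
    ultimately show ?thesis using proj_measurable measurable_cong_sets by blast
  qed
  have preE: "pre E \<in> sets borel" "pre E \<subseteq> P" using E by (auto simp: sets_M pre_def)
  have E': "E \<in> sets (sigma (surface d) {E. E \<subseteq> surface d \<and> {p \<in> P. proj d p \<in> E} \<in> sets borel})"
    using E unfolding surface_measure_def by simp
  have "emeasure M E = emeasure ?U (proj d -` E \<inter> space ?U)"
    unfolding surface_measure_def by (rule emeasure_distr[OF m E'])
  also have "proj d -` E \<inter> space ?U = pre E" by (auto simp: pre_def space_restrict_space)
  also have "emeasure ?U (pre E) = emeasure (restrict_space lborel P) (P \<inter> pre E) / emeasure (restrict_space lborel P) P"
    using preE by (intro emeasure_uniform_measure) (auto simp: sets_restrict_space_iff)
  also have "\<dots> = emeasure lborel (pre E) / emeasure lborel P"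
    using preE by (simp add: emeasure_restrict_space Int_absorb1)
  finally show ?thesis .
qed

lemma prob_space_M: "prob_space M"
proof
  have "pre (surface d) = P" by (auto simp: pre_def proj_in_surface)
  hence "emeasure M (surface d) = emeasure lborel P / emeasure lborel P"
    by (subst emeasure_M) (auto simp: sets_M_iff)
  also have "\<dots> = 1" using emeasure_P by (simp add: ennreal_divide_self less_top)
  finally show "emeasure M (space M) = 1" by simp
qed

lemma emeasure_M_mono:
  assumes "E \<in> sets M" "F \<in> sets M" "emeasure lborel (pre E) \<le> emeasure lborel (pre F)"
  shows "emeasure M E \<le> emeasure M F"
  using assms by (simp add: emeasure_M divide_right_mono_ennreal)

definition preserving :: "(complex set \<Rightarrow> complex set) \<Rightarrow> bool" where
  "preserving \<phi> \<longleftrightarrow> \<phi> \<in> M \<rightarrow>\<^sub>M M \<and> (\<forall>E\<in>sets M. emeasure M (\<phi> -` E \<inter> surface d) = emeasure M E)"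

text \<open>On a probability space one inequality suffices: applied to the complement it gives the
  other.\<close>

lemma preservingI:
  assumes m: "\<phi> \<in> M \<rightarrow>\<^sub>M M" and le: "\<And>E. E \<in> sets M \<Longrightarrow> emeasure M (\<phi> -` E \<inter> surface d) \<le> emeasure M E"
  shows "preserving \<phi>"
  unfolding preserving_def
proof (intro conjI ballI m)
  interpret prob_space M by (rule prob_space_M)
  fix E assume E: "E \<in> sets M"
  have fE: "\<phi> -` E \<inter> surface d \<in> sets M" using measurable_sets[OF m E] by simp
  have "prob (\<phi> -` E \<inter> surface d) \<le> prob E" using le[OF E] by (simp add: emeasure_eq_measure)
  moreover have "prob (\<phi> -` (surface d - E) \<inter> surface d) \<le> prob (surface d - E)"
    using le[of "surface d - E"] E sets.compl_sets[OF E] by (simp add: emeasure_eq_measure)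
  moreover have "\<phi> -` (surface d - E) \<inter> surface d = space M - (\<phi> -` E \<inter> surface d)"
    using measurable_space[OF m] by auto
  moreover have "prob (surface d - E) = 1 - prob E" using prob_compl[OF E] by simp
  ultimately have "prob (\<phi> -` E \<inter> surface d) = prob E" using prob_compl[OF fE] by simp
  thus "emeasure M (\<phi> -` E \<inter> surface d) = emeasure M E" by (simp add: emeasure_eq_measure)
qed

lemma preserving_comp:
  assumes 1: "preserving \<phi>" and 2: "preserving \<psi>" shows "preserving (\<phi> \<circ> \<psi>)"
  unfolding preserving_def
proof (intro conjI ballI)
  have m: "\<phi> \<in> M \<rightarrow>\<^sub>M M" "\<psi> \<in> M \<rightarrow>\<^sub>M M" using 1 2 by (auto simp: preserving_def)
  show "\<phi> \<circ> \<psi> \<in> M \<rightarrow>\<^sub>M M" using m by (rule measurable_comp[rotated])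
  fix E assume E: "E \<in> sets M"
  have fE: "\<phi> -` E \<inter> surface d \<in> sets M" using measurable_sets[OF m(1) E] by simp
  have "(\<phi> \<circ> \<psi>) -` E \<inter> surface d = \<psi> -` (\<phi> -` E \<inter> surface d) \<inter> surface d"
    using measurable_space[OF m(2)] by auto
  moreover have "emeasure M (\<psi> -` (\<phi> -` E \<inter> surface d) \<inter> surface d) = emeasure M E"
    using 1 2 E fE unfolding preserving_def by metis
  ultimately show "emeasure M ((\<phi> \<circ> \<psi>) -` E \<inter> surface d) = emeasure M E" by (simp only:)
qed

lemma pre_vimage:
  assumes "\<And>x. x \<in> surface d \<Longrightarrow> \<phi> x \<in> surface d"
  shows "pre (\<phi> -` E \<inter> surface d) = {p \<in> P. \<phi> (proj d p) \<in> E}"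
  by (auto simp: pre_def proj_in_surface)

text \<open>Such a map lifts to a piecewise affine map of the polygon whose pieces share the
  area-preserving derivative \<open>m\<close>. Off a null set the lift is injective, so it cannot
  increase the area of preimages.\<close>

lemma preserving_piecewise:
  fixes C :: "nat \<Rightarrow> complex set"
  assumes m: "area_preserving m" "area_preserving m'" "\<And>z. m' (m z) = z" "\<And>z. m (m' z) = z"
    and surf: "\<And>x. x \<in> surface d \<Longrightarrow> \<phi> x \<in> surface d" and inj: "inj_on \<phi> (surface d)"
    and C: "\<And>i. C i \<in> sets borel" and cov: "P \<subseteq> (\<Union>i. C i)"
    and piece: "\<And>i p. p \<in> P \<Longrightarrow> p \<in> C i \<Longrightarrow> m p + c i \<in> P \<and> \<phi> (proj d p) = proj d (m p + c i)"
  shows "preserving \<phi>"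
proof (rule preservingI)
  have mm[measurable]: "m \<in> borel \<rightarrow>\<^sub>M borel" using m(1) by (rule area_preserving_measurable)
  have T[measurable]: "(\<lambda>p. m p + c i) \<in> borel \<rightarrow>\<^sub>M borel" for i by measurable
  have Tv: "(\<lambda>p. m p + c i) -` S \<in> sets borel" if "S \<in> sets borel" for i S
    using measurable_sets[OF T that] by simp
  have pv: "pre (\<phi> -` E \<inter> surface d) = {p \<in> P. \<phi> (proj d p) \<in> E}" for E
    by (rule pre_vimage) (rule surf)
  have eq: "{p \<in> P. \<phi> (proj d p) \<in> E} = (\<Union>i. P \<inter> C i \<inter> (\<lambda>p. m p + c i) -` pre E)" for E
    using cov piece by (fastforce simp: pre_def)
  have meas: "\<phi> -` E \<inter> surface d \<in> sets M" if "E \<in> sets M" for E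
  proof -
    have "pre E \<in> sets borel" using that by (simp add: sets_M_iff)
    hence "(\<Union>i. P \<inter> C i \<inter> (\<lambda>p. m p + c i) -` pre E) \<in> sets borel" using C Tv P_borel by auto
    thus ?thesis unfolding sets_M_iff pv eq by simp
  qed
  show "\<phi> \<in> M \<rightarrow>\<^sub>M M"
    by (rule measurableI) (use surf meas in auto)
  fix E assume E: "E \<in> sets M"
  \<comment> \<open>Both the point and its image are kept in the interior: there classes are
    singletons, so \<open>f\<close> reads off the image point and inherits injectivity from
    \<open>\<phi>\<close>.\<close>
  define A where "A i = C i \<inter> P0 \<inter> (\<lambda>p. m p + c i) -` P0" for i
  have A: "A i \<in> sets borel" for i unfolding A_def using C Tv P0_borel by auto
  define f where "f p = the_elem (\<phi> (proj d p))" for p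
  have fA: "p \<in> P0" "m p + c i \<in> P0" "f p = m p + c i" "\<phi> (proj d p) = {f p}" if "p \<in> A i" for p i
  proof -
    show p: "p \<in> P0" "m p + c i \<in> P0" using that by (auto simp: A_def)
    have "p \<in> C i" using that by (auto simp: A_def)
    hence e: "\<phi> (proj d p) = {m p + c i}" using piece[of p i] p P0_P P0_proj by auto
    show "f p = m p + c i" unfolding f_def e by simp
    thus "\<phi> (proj d p) = {f p}" using e by simp
  qed
  have injf: "inj_on f (\<Union>i. A i)"
  proof (rule inj_onI)
    fix p q assume pq: "p \<in> (\<Union>i. A i)" "q \<in> (\<Union>i. A i)" "f p = f q"
    hence e: "\<phi> (proj d p) = \<phi> (proj d q)" "p \<in> P0" "q \<in> P0" using fA by auto
    moreover from this have "proj d p \<in> surface d" "proj d q \<in> surface d" using proj_in_surface P0_P by auto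
    ultimately have "proj d p = proj d q" using inj_onD[OF inj] by blast
    thus "p = q" using P0_proj e by simp
  qed
  have N: "(\<lambda>p. m p + c i) -` (P - P0) \<in> null_sets lborel" for i
  proof (rule null_setsI)
    have PB: "P - P0 \<in> sets borel" by auto
    show "(\<lambda>p. m p + c i) -` (P - P0) \<in> sets lborel" using Tv[OF PB] by simp
    have "(\<lambda>p. m p + c i) -` (P - P0) = m -` ((+) (c i) -` (P - P0))" by (auto simp: add.commute)
    moreover have sb: "(+) (c i) -` (P - P0) \<in> sets borel" using measurable_sets[of "(+) (c i)" borel borel, OF _ PB] by simp
    ultimately have "emeasure lborel ((\<lambda>p. m p + c i) -` (P - P0)) = emeasure lborel ((+) (c i) -` (P - P0))"
      using area_preserving_emeasure[OF m(1)] by simp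
    also have "\<dots> = emeasure (distr lborel borel ((+) (c i))) (P - P0)"
      using PB by (subst emeasure_distr) auto
    also have "\<dots> = 0" using boundary_null by (simp add: lborel_distr_plus null_setsD1)
    finally show "emeasure lborel ((\<lambda>p. m p + c i) -` (P - P0)) = 0" .
  qed
  \<comment> \<open>Contains the boundary points and all points that one of the affine maps sends to
    the boundary; each of the countably many preimages is null.\<close>
  define Z where "Z = (P - P0) \<union> (\<Union>i. (\<lambda>p. m p + c i) -` (P - P0))"
  have Z: "Z \<in> null_sets lborel" unfolding Z_def using boundary_null N by (intro null_sets.Un null_sets_UN) auto
  have preE: "pre E \<in> sets borel" using E by (simp add: sets_M_iff)
  have sub: "pre (\<phi> -` E \<inter> surface d) \<subseteq> {p \<in> \<Union>i. A i. f p \<in> pre E} \<union> Z"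
  proof
    fix p assume "p \<in> pre (\<phi> -` E \<inter> surface d)"
    hence p: "p \<in> P" "\<phi> (proj d p) \<in> E" unfolding pv by auto
    show "p \<in> {p \<in> \<Union>i. A i. f p \<in> pre E} \<union> Z"
    proof (cases "p \<in> Z")
      case False
      obtain i where i: "p \<in> C i" using cov p by auto
      have "m p + c i \<in> P" "\<phi> (proj d p) = proj d (m p + c i)" using piece p i by auto
      moreover from this have "p \<in> A i" using False p i by (auto simp: A_def Z_def)
      ultimately show ?thesis using p fA[of p i] by (auto simp: pre_def)
    qed simp
  qed
  note pw = emeasure_vimage_piecewise_affine_le[OF m(2-4) m(1) A fA(3) injf preE]
  have "emeasure lborel (pre (\<phi> -` E \<inter> surface d)) \<le> emeasure lborel ({p \<in> \<Union>i. A i. f p \<in> pre E} \<union> Z)"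
    using sub pw(2) Z by (intro emeasure_mono) (auto simp: null_sets_def)
  also have "\<dots> = emeasure lborel {p \<in> \<Union>i. A i. f p \<in> pre E}"
    using pw(2) Z by (intro emeasure_Un_null_set) auto
  also have "\<dots> \<le> emeasure lborel (pre E)" by (rule pw(1))
  finally show "emeasure M (\<phi> -` E \<inter> surface d) \<le> emeasure M E"
    by (rule emeasure_M_mono[OF meas[OF E] E])
qed

lemma Xc_measurable [measurable]: "Xc \<in> borel \<rightarrow>\<^sub>M borel" and Yc_measurable [measurable]: "Yc \<in> borel \<rightarrow>\<^sub>M borel"
  unfolding Xc_def[abs_def] Yc_def[abs_def] by measurable

lemma area_preserving_shear_map: "area_preserving (shear_map r)"
proof -
  have "shear_map r = (\<lambda>z. kap * z) \<circ> (\<lambda>z. Complex (Re z + r * Im z) (Im z)) \<circ> (\<lambda>z. cnj kap * z)"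
  proof
    fix z
    have "shear_map r z = kap * Complex (Xc z + r * Yc z) (Yc z)"
      by (subst XY_local[of z], subst shear_map_local) simp
    thus "shear_map r z = ((\<lambda>z. kap * z) \<circ> (\<lambda>z. Complex (Re z + r * Im z) (Im z)) \<circ> (\<lambda>z. cnj kap * z)) z"
      by (simp add: Xc_def Yc_def)
  qed
  moreover have "area_preserving \<dots>"
    by (intro area_preserving_comp area_preserving_rotation area_preserving_shear_x) simp_all
  ultimately show ?thesis by simp
qed

lemma shear_map_inverse: "shear_map (- r) (shear_map r z) = z" "shear_map r (shear_map (- r) z) = z"
proof -
  have "Yc (shear_map s z) = Yc z" for s
    by (subst XY_local[of z], subst shear_map_local) (simp add: XY_kap)
  thus "shear_map (- r) (shear_map r z) = z" "shear_map r (shear_map (- r) z) = z"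
    by (simp_all add: shear_map_def[of "- r" "shear_map r z"] shear_map_def[of r "shear_map (-r) z"]) (simp_all add: shear_map_def)
qed

lemma shear_preserving: "preserving (shear n)"
proof -
  define tt where "tt j p = (Yc p - sy j) / ht j" for j p
  have tm[measurable]: "tt j \<in> borel \<rightarrow>\<^sub>M borel" for j unfolding tt_def[abs_def] by measurable
  have hm[measurable]: "hw i \<in> borel \<rightarrow>\<^sub>M borel" for i unfolding hw_def[abs_def] by measurable
  \<comment> \<open>A piece is given by the strip \<open>j\<close> of the point and the number
    \<open>N\<close> of the unrolled chord in which its sheared image lands. Pieces may
    overlap.\<close>
  define B where "B = (\<lambda>(j, N). if j + 1 < d then {p. 0 \<le> tt j p \<and> tt j p \<le> 1 \<and> \<bar>Xc p\<bar> \<le> hw j (tt j p) \<and>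
      valid j N (Xc p + 2 * of_int n * wd j * tt j p) (tt j p)} else {})"
  \<comment> \<open>Corrects the linear shear, which fixes height 0 instead of the bottom of the
    strip, and translates chord \<open>N\<close> back to its strip in the polygon.\<close>
  define k where "k = (\<lambda>(j, N). kap * Complex (- (of_int n * twist * sy j) - of_int N * wd j) (sy (par j N) - sy j))"
  define nn :: "nat \<Rightarrow> nat \<times> int" where "nn = from_nat"
  show ?thesis
  proof (rule preserving_piecewise[where C = "\<lambda>i. B (nn i)" and c = "\<lambda>i. k (nn i)"])
    show "area_preserving (shear_map (of_int n * twist))" "area_preserving (shear_map (- (of_int n * twist)))"
      by (rule area_preserving_shear_map)+
    show "shear_map (- (of_int n * twist)) (shear_map (of_int n * twist) z) = z" "shear_map (of_int n * twist) (shear_map (- (of_int n * twist)) z) = z" for z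
      by (rule shear_map_inverse)+
    show "shear n x \<in> surface d" if "x \<in> surface d" for x by (rule shear_surface[OF that])
    show "inj_on (shear n) (surface d)" using shear_inverse by (rule inj_on_inverseI)
    show "B (nn i) \<in> sets borel" for i unfolding B_def valid_def by (cases "nn i") simp
    have BP: "\<exists>t. 0 \<le> t \<and> t \<le> 1 \<and> t = tt j p \<and> j + 1 < d \<and> p = Pt j (Xc p) t" if "p \<in> B (j, N)" for p j N
    proof -
      have j: "j + 1 < d" using that by (auto simp: B_def split: if_splits)
      have "Yc p = sy j + tt j p * ht j" using ht_pos[OF j] by (simp add: tt_def)
      from Pt_of_Y[OF this] show ?thesis using j that by (auto simp: B_def)
    qed
    show "P \<subseteq> (\<Union>i. B (nn i))"
    proof
      fix p assume "p \<in> P"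
      then obtain j a t where j: "j + 1 < d" "0 \<le> t" "t \<le> 1" "\<bar>a\<bar> \<le> hw j t" "p = Pt j a t" by (rule P_strip)
      have t: "tt j p = t" using ht_pos[OF j(1)] by (simp add: tt_def j(5) Yc_Pt)
      obtain N where N: "valid j N (a + 2 * of_int n * wd j * t) t" using valid_ex[OF j(1)] by blast
      have "p \<in> B (j, N)" using j N t by (simp add: B_def Xc_Pt)
      moreover have "nn (to_nat (j, N)) = (j, N)" by (simp add: nn_def)
      ultimately show "p \<in> (\<Union>i. B (nn i))" by (metis UN_I UNIV_I)
    qed
    fix i p assume p: "p \<in> P" "p \<in> B (nn i)"
    obtain j N where jN: "nn i = (j, N)" by (cases "nn i")
    obtain t where t: "0 \<le> t" "t \<le> 1" "t = tt j p" "j + 1 < d" "p = Pt j (Xc p) t" using BP p jN by metis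
    define a where "a = Xc p + 2 * of_int n * wd j * t"
    have h: "\<bar>Xc p\<bar> \<le> hw j t" and v: "valid j N a t"
      using p(2) t unfolding jN a_def by (auto simp: B_def)
    have "shear n (proj d p) = D j a t"
      using D_Pt[OF t(4,1,2) h] shear_D[OF t(4,1,2)] t(5) unfolding a_def by metis
    also have "\<dots> = proj d (Dv j N a t)" by (rule D_eq[OF t(4,1,2) v])
    also have "Dv j N a t = shear_map (of_int n * twist) p + k (j, N)"
    proof -
      have Yp: "Yc p = sy j + t * ht j" by (metis t(5) Yc_Pt)
      have "of_int n * twist * Yc p = of_int n * twist * sy j + of_int n * t * (twist * ht j)" unfolding Yp by (simp add: algebra_simps)
      hence e: "of_int n * twist * Yc p = of_int n * twist * sy j + 2 * of_int n * wd j * t" by (simp add: twist_ht algebra_simps)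
      have "shear_map (of_int n * twist) p = kap * Complex (Xc p + of_int n * twist * Yc p) (Yc p)"
        by (subst XY_local[of p], subst shear_map_local) simp
      hence "shear_map (of_int n * twist) p + k (j, N) = kap * (Complex (Xc p + of_int n * twist * Yc p) (Yc p) +
          Complex (- (of_int n * twist * sy j) - of_int N * wd j) (sy (par j N) - sy j))"
        by (simp add: k_def distrib_left)
      also have "\<dots> = Dv j N a t"
        unfolding Dv_def Pt_def e par_ht[OF t(4)] a_def by (simp add: Yp complex_eq_iff algebra_simps)
      finally show ?thesis by simp
    qed
    finally show "shear_map (of_int n * twist) p + k (nn i) \<in> P \<and> shear n (proj d p) = proj d (shear_map (of_int n * twist) p + k (nn i))"
      using valid_in_P[OF t(4,1,2) v] \<open>Dv j N a t = shear_map (of_int n * twist) p + k (j, N)\<close> jN by simp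
  qed
qed

lemma turn_preserving: "preserving (turn k)"
proof (rule preserving_piecewise[where C = "\<lambda>i. UNIV" and c = "\<lambda>i. 0" and m = "(*) (vertex d k)" and m' = "(*) (vertex d ((2*d-1)*k))"])
  show "area_preserving ((*) (vertex d k))" "area_preserving ((*) (vertex d ((2*d-1)*k)))"
    by (rule area_preserving_rotation; simp)+
  show "turn k x \<in> surface d" if "x \<in> surface d" for x
    using that turn_P by (auto simp: surface_eq turn_proj)
  show "inj_on (turn k) (surface d)" using turn_inverse(1) by (rule inj_on_inverseI)
qed (simp_all flip: mult.assoc add: vertex_inverse[simplified] turn_proj turn_P)

section \<open>Forward orbits of the linear flow\<close>

definition transverse :: "complex \<Rightarrow> bool" where "transverse u \<longleftrightarrow> (\<forall>k. nrm k \<bullet> u \<noteq> 0)"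

definition heads :: "complex \<Rightarrow> nat set" where "heads u = {k. k < 2 * d \<and> 0 < nrm k \<bullet> u}"

definition exit_time :: "complex \<Rightarrow> complex \<Rightarrow> real" where
  "exit_time u p = Min ((\<lambda>k. (cos b - nrm k \<bullet> p) / (nrm k \<bullet> u)) ` heads u)"

definition exit_pt :: "complex \<Rightarrow> complex \<Rightarrow> complex" where
  "exit_pt u p = p + exit_time u p *\<^sub>R u"

text \<open>The sum has at most one nonzero term unless \<open>q\<close> is a vertex; writing it as a sum makes measurability
  immediate.\<close>

definition hop :: "complex \<Rightarrow> complex \<Rightarrow> complex" where
  "hop u q = q + (\<Sum>k<2*d. if q \<in> side d k \<and> 0 < nrm k \<bullet> u then side_shift d k else 0)"

text \<open>For \<open>u\<close> transverse to all sides, the representatives from which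
  \<open>u\<close> points strictly into the polygon: each non-cone class has exactly one.\<close>

definition out :: "complex \<Rightarrow> complex \<Rightarrow> bool" where
  "out u p \<longleftrightarrow> p \<in> P \<and> p \<notin> V \<and> (\<forall>k. p \<in> side d k \<longrightarrow> nrm k \<bullet> u < 0)"

lemma transverse_uminus: "transverse u \<Longrightarrow> transverse (- u)" by (simp add: transverse_def)

lemma finite_heads: "finite (heads u)" by (simp add: heads_def)

lemma heads_nonempty: "transverse u \<Longrightarrow> heads u \<noteq> {}"
proof -
  assume "transverse u"
  hence "nrm 0 \<bullet> u \<noteq> 0" by (simp add: transverse_def)
  hence "0 < nrm 0 \<bullet> u \<or> 0 < nrm (0 + d) \<bullet> u" unfolding nrm_add_d by auto
  moreover have "(0::nat) < 2 * d" "0 + d < 2 * d" using d_ge by auto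
  ultimately show ?thesis unfolding heads_def by blast
qed

lemma exit_time_ge_iff:
  assumes u: "transverse u" shows "s \<le> exit_time u p \<longleftrightarrow> (\<forall>k\<in>heads u. nrm k \<bullet> (p + s *\<^sub>R u) \<le> cos b)"
proof -
  have "s \<le> exit_time u p \<longleftrightarrow> (\<forall>k\<in>heads u. s \<le> (cos b - nrm k \<bullet> p) / (nrm k \<bullet> u))"
    unfolding exit_time_def using finite_heads heads_nonempty[OF u] by (subst Min_ge_iff) auto
  also have "\<dots> \<longleftrightarrow> (\<forall>k\<in>heads u. nrm k \<bullet> (p + s *\<^sub>R u) \<le> cos b)"
    by (intro ball_cong refl) (auto simp: heads_def inner_add_right field_simps)
  finally show ?thesis .
qed

lemma exit_time_nonneg: "transverse u \<Longrightarrow> p \<in> P \<Longrightarrow> 0 \<le> exit_time u p"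
  using polygon_nrm_le by (simp add: exit_time_ge_iff)

lemma in_P_iff_exit:
  assumes u: "transverse u" and p: "p \<in> P" and s: "0 \<le> s"
  shows "p + s *\<^sub>R u \<in> P \<longleftrightarrow> s \<le> exit_time u p"
proof
  assume "s \<le> exit_time u p"
  hence h: "nrm k \<bullet> (p + s *\<^sub>R u) \<le> cos b" if "k \<in> heads u" for k using that by (simp add: exit_time_ge_iff[OF u])
  show "p + s *\<^sub>R u \<in> P"
  proof (rule P_halfplanes)
    fix k assume k: "k < 2 * d"
    show "nrm k \<bullet> (p + s *\<^sub>R u) \<le> cos b"
    proof (cases "0 < nrm k \<bullet> u")
      case False
      hence "s * (nrm k \<bullet> u) \<le> 0" using s by (simp add: mult_nonneg_nonpos)
      thus ?thesis using polygon_nrm_le[OF p, of k] by (simp add: inner_add_right)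
    qed (use h k in \<open>auto simp: heads_def\<close>)
  qed
qed (use polygon_nrm_le in \<open>auto simp: exit_time_ge_iff[OF u]\<close>)

text \<open>Along the chord each side functional is affine and, by transversality, not constant; it
  is bounded by \<open>cos b\<close> at both ends and hence strictly smaller in between.\<close>

lemma chord_interior:
  assumes u: "transverse u" and p: "p \<in> P" and s: "0 < s" "s < exit_time u p"
  shows "p + s *\<^sub>R u \<in> P0"
proof -
  have P: "p + s *\<^sub>R u \<in> P" using in_P_iff_exit[OF u p] s by simp
  have e: "p + exit_time u p *\<^sub>R u \<in> P" using in_P_iff_exit[OF u p exit_time_nonneg[OF u p]] by simp
  have "nrm k \<bullet> (p + s *\<^sub>R u) < cos b" for k
  proof (rule ccontr)
    assume n: "\<not> ?thesis"
    have le: "nrm k \<bullet> p \<le> cos b" "nrm k \<bullet> p + exit_time u p * (nrm k \<bullet> u) \<le> cos b"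
      using polygon_nrm_le[OF p, of k] polygon_nrm_le[OF e, of k] by (auto simp: inner_add_right)
    have ge: "cos b \<le> nrm k \<bullet> p + s * (nrm k \<bullet> u)" using n by (simp add: inner_add_right)
    have "nrm k \<bullet> u \<noteq> 0" using u by (simp add: transverse_def)
    then consider "0 < nrm k \<bullet> u" | "nrm k \<bullet> u < 0" by linarith
    thus False
    proof cases
      case 1
      hence "s * (nrm k \<bullet> u) < exit_time u p * (nrm k \<bullet> u)" using s by simp
      thus False using le ge by linarith
    next
      case 2
      hence "s * (nrm k \<bullet> u) < 0" using s by (simp add: mult_pos_neg)
      thus False using le ge by linarith
    qed
  qed
  thus ?thesis using P by (simp add: P0_def)
qed

lemma exit_side:
  assumes u: "transverse u" and p: "p \<in> P"
  obtains k where "k < 2 * d" "exit_pt u p \<in> side d k" "0 < nrm k \<bullet> u"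
proof -
  have "exit_time u p \<in> (\<lambda>k. (cos b - nrm k \<bullet> p) / (nrm k \<bullet> u)) ` heads u"
    unfolding exit_time_def using finite_heads heads_nonempty[OF u] by (intro Min_in) auto
  then obtain k where k: "k \<in> heads u" "exit_time u p = (cos b - nrm k \<bullet> p) / (nrm k \<bullet> u)" by auto
  have h: "0 < nrm k \<bullet> u" "k < 2 * d" using k(1) by (auto simp: heads_def)
  have "nrm k \<bullet> exit_pt u p = cos b" unfolding exit_pt_def k(2) using h by (simp add: inner_add_right)
  moreover have "exit_pt u p \<in> P"
    unfolding exit_pt_def using in_P_iff_exit[OF u p exit_time_nonneg[OF u p]] by simp
  ultimately show ?thesis using that h side_iff by blast
qed

lemma out_exit_pos:
  assumes u: "transverse u" and p: "out u p" shows "0 < exit_time u p"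
proof -
  have P: "p \<in> P" using p by (simp add: out_def)
  have "exit_time u p \<noteq> 0"
  proof
    assume "exit_time u p = 0"
    then obtain k where "p \<in> side d k" "0 < nrm k \<bullet> u"
      using exit_side[OF u P] unfolding exit_pt_def by (metis add.right_neutral scaleR_zero_left)
    thus False using p by (auto simp: out_def)
  qed
  thus ?thesis using exit_time_nonneg[OF u P] by simp
qed

lemma hop_side:
  assumes "k < 2 * d" "q \<in> side d k" "q \<notin> V" "0 < nrm k \<bullet> u" shows "hop u q = q + side_shift d k"
proof -
  have "(\<Sum>i<2*d. if q \<in> side d i \<and> 0 < nrm i \<bullet> u then side_shift d i else 0) = (\<Sum>i<2*d. if i = k then side_shift d k else 0)"
  proof (rule sum.cong[OF refl])
    fix i assume i: "i \<in> {..<2*d}"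
    show "(if q \<in> side d i \<and> 0 < nrm i \<bullet> u then side_shift d i else 0) = (if i = k then side_shift d k else 0)"
    proof (cases "q \<in> side d i")
      case True
      have "k mod (2*d) = i mod (2*d)" by (rule side_unique[OF assms(2) True assms(3)])
      hence "i = k" using i assms(1) by simp
      thus ?thesis using assms by simp
    next
      case False
      hence "i \<noteq> k" using assms(2) by auto
      thus ?thesis using False by simp
    qed
  qed
  thus ?thesis using assms(1) by (simp add: hop_def)
qed

lemma hop_none:
  assumes "\<And>k. q \<in> side d k \<Longrightarrow> nrm k \<bullet> u \<le> 0" shows "hop u q = q"
proof -
  have "(\<Sum>k<2*d. if q \<in> side d k \<and> 0 < nrm k \<bullet> u then side_shift d k else 0) = 0"
  proof (rule sum.neutral, intro ballI)
    fix k
    show "(if q \<in> side d k \<and> 0 < nrm k \<bullet> u then side_shift d k else 0) = 0" using assms[of k] by auto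
  qed
  thus ?thesis by (simp add: hop_def)
qed

lemma nrm_cong_mod: "k mod (2*d) = j mod (2*d) \<Longrightarrow> nrm k = nrm j" by (metis nrm_mod)

lemma hop_out:
  assumes u: "transverse u" and q: "q \<in> P" "q \<notin> V" shows "out u (hop u q)" "proj d (hop u q) = proj d q"
proof -
  have "out u (hop u q) \<and> proj d (hop u q) = proj d q"
  proof (cases "\<exists>k. q \<in> side d k \<and> 0 < nrm k \<bullet> u")
    case True
    then obtain k0 where k0: "q \<in> side d k0" "0 < nrm k0 \<bullet> u" by auto
    define k where "k = k0 mod (2*d)"
    have k: "k < 2*d" "q \<in> side d k" "0 < nrm k \<bullet> u" using k0 d_ge by (simp_all add: k_def side_mod nrm_mod)
    have h: "hop u q = q + side_shift d k" by (rule hop_side) (use k q in auto)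
    have s: "hop u q \<in> side d (k + d)" unfolding h by (rule side_shift_in[OF k(2)])
    have nv: "hop u q \<notin> V" unfolding h by (rule shift_nonvertex[OF k(2) q(2)])
    have "nrm i \<bullet> u < 0" if "hop u q \<in> side d i" for i
      using nrm_cong_mod[OF side_unique[OF that s nv]] k(3) by (simp add: nrm_add_d)
    moreover have "proj d (hop u q) = proj d q"
      using glue_shift[OF k(2)] proj_eq_iff[of q "hop u q"] q s side_subset_P unfolding h by auto
    moreover have "hop u q \<in> P" using s side_subset_P by blast
    ultimately show ?thesis using nv unfolding out_def by blast
  next
    case False
    hence h: "hop u q = q" by (intro hop_none) force
    have "nrm k \<bullet> u \<noteq> 0" for k using u by (simp add: transverse_def)
    hence "nrm k \<bullet> u < 0" if "q \<in> side d k" for k using False that by (meson linorder_neqE_linordered_idom)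
    thus ?thesis using h q by (simp add: out_def)
  qed
  thus "out u (hop u q)" "proj d (hop u q) = proj d q" by auto
qed

lemma out_unique:
  assumes p: "out u p" and q: "out u q" and eq: "proj d p = proj d q" shows "p = q"
proof (rule ccontr)
  assume "p \<noteq> q"
  have "(p, q) \<in> glue d" using eq proj_eq_iff p q by (auto simp: out_def)
  from glue_nonvertexD[OF this _ \<open>p \<noteq> q\<close>[symmetric]] p obtain k where k: "p \<in> side d k" "q = p + side_shift d k"
    by (auto simp: out_def)
  have "q \<in> side d (k + d)" using k side_shift_in by auto
  hence "nrm (k + d) \<bullet> u < 0" "nrm k \<bullet> u < 0" using p q k by (auto simp: out_def)
  thus False by (simp add: nrm_add_d)
qed

section \<open>The sequence of side crossings\<close>

definition step :: "complex \<Rightarrow> complex \<Rightarrow> complex" where "step u p = hop u (exit_pt u p)"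
definition st :: "complex \<Rightarrow> nat \<Rightarrow> complex \<Rightarrow> complex" where "st u n = step u ^^ n"
definition tm :: "complex \<Rightarrow> nat \<Rightarrow> complex \<Rightarrow> real" where "tm u n p = (\<Sum>i<n. exit_time u (st u i p))"
text \<open>The forward orbit meets no vertex and its crossing times do not accumulate, so that it
  is defined for all times.\<close>

definition alive :: "complex \<Rightarrow> complex \<Rightarrow> bool" where
  "alive u p \<longleftrightarrow> (\<forall>n. exit_pt u (st u n p) \<notin> V) \<and> (\<forall>N::nat. \<exists>n. real N < tm u n p)"
text \<open>At a crossing time the minimal index selects the point already transferred to the
  opposite side, so every later segment starts at an \<open>out\<close> point.\<close>

definition forward_flow :: "complex \<Rightarrow> complex \<Rightarrow> real \<Rightarrow> complex" where
  "forward_flow u p t = (let n = (LEAST n. t < tm u (Suc n) p) in st u n p + (t - tm u n p) *\<^sub>R u)"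

lemma st_0 [simp]: "st u 0 p = p" and st_Suc: "st u (Suc n) p = step u (st u n p)"
  by (simp_all add: st_def)
lemma tm_0 [simp]: "tm u 0 p = 0" and tm_Suc: "tm u (Suc n) p = tm u n p + exit_time u (st u n p)"
  by (simp_all add: tm_def)

lemma exit_pt_P: "transverse u \<Longrightarrow> p \<in> P \<Longrightarrow> exit_pt u p \<in> P"
  unfolding exit_pt_def using in_P_iff_exit[OF _ _ exit_time_nonneg] by simp

lemma st_out:
  assumes u: "transverse u" and p: "out u p" and n: "\<And>i. i < n \<Longrightarrow> exit_pt u (st u i p) \<notin> V"
  shows "out u (st u n p)"
  using n
proof (induction n)
  case (Suc n)
  hence "out u (st u n p)" by simp
  hence "exit_pt u (st u n p) \<in> P" using exit_pt_P[OF u] by (simp add: out_def)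
  thus ?case unfolding st_Suc step_def using hop_out(1)[OF u] Suc by simp
qed (use p in simp)

context
  fixes u p assumes u: "transverse u" and p: "out u p" and al: "alive u p"
begin

lemma al_out: "out u (st u n p)" by (rule st_out[OF u p]) (use al in \<open>simp add: alive_def\<close>)

lemma al_st_P: "st u n p \<in> P" using al_out by (simp add: out_def)

lemma tm_strict: "tm u n p < tm u (Suc n) p" using out_exit_pos[OF u al_out] by (simp add: tm_Suc)

lemma tm_mono: "m \<le> n \<Longrightarrow> tm u m p \<le> tm u n p"
  using lift_Suc_mono_le[of "\<lambda>n. tm u n p"] tm_strict by (meson less_imp_le)

lemma tm_unbounded: "\<exists>n. t < tm u n p"
proof -
  obtain N :: nat where "t < real N" using reals_Archimedean2 by blast
  moreover have "\<exists>n. real N < tm u n p" using al unfolding alive_def by blast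
  ultimately show ?thesis by (meson less_trans)
qed

lemma forward_flow_eq:
  assumes "tm u n p \<le> t" "t < tm u (Suc n) p" shows "forward_flow u p t = st u n p + (t - tm u n p) *\<^sub>R u"
proof -
  have "(LEAST n. t < tm u (Suc n) p) = n"
  proof (rule Least_equality)
    fix m assume "t < tm u (Suc m) p"
    thus "n \<le> m" using assms(1) tm_mono[of "Suc m" n] by (cases "n \<le> m") auto
  qed (rule assms(2))
  thus ?thesis by (simp add: forward_flow_def)
qed

lemma segment_right: assumes "0 \<le> t" obtains n where "tm u n p \<le> t" "t < tm u (Suc n) p"
proof -
  define n where "n = (LEAST n. t < tm u n p)"
  have n: "t < tm u n p" unfolding n_def using tm_unbounded by (rule LeastI_ex)
  hence "n \<noteq> 0" using assms by (cases n) auto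
  then obtain m where m: "n = Suc m" by (cases n) auto
  have "\<not> t < tm u m p" using not_less_Least[of m "\<lambda>n. t < tm u n p"] m unfolding n_def by simp
  thus ?thesis using that[of m] n m by simp
qed

lemma segment_left: assumes "0 < t" obtains n where "tm u n p < t" "t \<le> tm u (Suc n) p"
proof -
  obtain n where n: "tm u n p \<le> t" "t < tm u (Suc n) p" using segment_right assms less_imp_le by metis
  show ?thesis
  proof (cases "tm u n p = t")
    case True
    then obtain m where "n = Suc m" using assms by (cases n) auto
    thus ?thesis using that[of m] True tm_strict[of m] by simp
  next
    case False
    thus ?thesis using that[of n] n by simp
  qed
qed

lemma st_seg_P: "0 \<le> s \<Longrightarrow> s \<le> exit_time u (st u n p) \<Longrightarrow> st u n p + s *\<^sub>R u \<in> P"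
  using in_P_iff_exit[OF u al_st_P] by simp

text \<open>The formula of a segment remains correct on the surface at its end, where the lift has
  already jumped to the glued point. This yields the left germs.\<close>

lemma forward_flow_proj:
  assumes "tm u n p \<le> t" "t \<le> tm u (Suc n) p"
  shows "proj d (forward_flow u p t) = proj d (st u n p + (t - tm u n p) *\<^sub>R u)"
proof (cases "t = tm u (Suc n) p")
  case True
  have "forward_flow u p t = st u (Suc n) p" using forward_flow_eq[of "Suc n" t] True tm_strict[of "Suc n"] by simp
  moreover have "proj d (st u (Suc n) p) = proj d (exit_pt u (st u n p))"
    unfolding st_Suc step_def using hop_out(2)[OF u exit_pt_P[OF u al_st_P]] al by (simp add: alive_def)
  ultimately show ?thesis using True by (simp add: exit_pt_def tm_Suc)
qed (use forward_flow_eq assms in simp)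

lemma forward_flow_P: assumes t: "0 \<le> t" shows "forward_flow u p t \<in> P"
proof -
  obtain n where n: "tm u n p \<le> t" "t < tm u (Suc n) p" using segment_right[OF t] .
  show ?thesis unfolding forward_flow_eq[OF n] by (rule st_seg_P) (use n in \<open>auto simp: tm_Suc\<close>)
qed

lemma forward_flow_noncone: assumes t: "0 \<le> t" shows "proj d (forward_flow u p t) \<notin> cone_points d"
proof -
  obtain n where n: "tm u n p \<le> t" "t < tm u (Suc n) p" using segment_right[OF t] .
  have "forward_flow u p t \<notin> V"
  proof (cases "t = tm u n p")
    case True
    thus ?thesis unfolding forward_flow_eq[OF n] using al_out by (simp add: out_def)
  next
    case False
    hence "forward_flow u p t \<in> P0" unfolding forward_flow_eq[OF n] using n by (intro chord_interior[OF u al_st_P]) (auto simp: tm_Suc)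
    thus ?thesis using P0_nrm nrm_vertex_same(1) by (metis imageE order_less_irrefl)
  qed
  thus ?thesis using proj_cone_iff forward_flow_P t by simp
qed

lemma forward_flow_rgerm: assumes t: "0 \<le> t" shows "rgerm (\<lambda>t. proj d (forward_flow u p t)) u t"
proof -
  obtain n where n: "tm u n p \<le> t" "t < tm u (Suc n) p" using segment_right[OF t] .
  define q where "q = st u n p + (t - tm u n p) *\<^sub>R u"
  have qs: "q + s *\<^sub>R u = st u n p + (t + s - tm u n p) *\<^sub>R u" for s by (simp add: q_def algebra_simps)
  have "q + s *\<^sub>R u \<in> P \<and> proj d (forward_flow u p (t + s)) = proj d (q + s *\<^sub>R u)" if "s \<in> {0..<tm u (Suc n) p - t}" for s
    unfolding qs using that n by (auto intro!: st_seg_P forward_flow_proj simp: tm_Suc)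
  moreover have "q \<in> proj d (forward_flow u p t)"
    unfolding forward_flow_eq[OF n] q_def by (rule proj_self, rule st_seg_P) (use n in \<open>auto simp: tm_Suc\<close>)
  ultimately show ?thesis unfolding rgerm_def using n by (intro exI[of _ "tm u (Suc n) p - t"] conjI bexI[of _ q]) auto
qed

lemma forward_flow_lgerm: assumes t: "0 < t" shows "lgerm (\<lambda>t. proj d (forward_flow u p t)) u t"
proof -
  obtain n where n: "tm u n p < t" "t \<le> tm u (Suc n) p" using segment_left[OF t] .
  define q where "q = st u n p + (t - tm u n p) *\<^sub>R u"
  have qs: "q - s *\<^sub>R u = st u n p + (t - s - tm u n p) *\<^sub>R u" for s by (simp add: q_def algebra_simps)
  have *: "q - s *\<^sub>R u \<in> P \<and> proj d (forward_flow u p (t - s)) = proj d (q - s *\<^sub>R u)" if "s \<in> {0..<t - tm u n p}" for s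
    unfolding qs using that n by (auto intro!: st_seg_P forward_flow_proj simp: tm_Suc)
  moreover have "q \<in> proj d (forward_flow u p t)" using *[of 0] n proj_self[of q] by simp
  ultimately show ?thesis unfolding lgerm_def using n by (intro exI[of _ "t - tm u n p"] conjI bexI[of _ q]) auto
qed

lemma forward_flow_0: "forward_flow u p 0 = p"
  using forward_flow_eq[of 0 0] tm_strict[of 0] by simp

end

text \<open>A trajectory follows the crossing sequence by uniqueness of straight paths and meets no
  vertex. If the crossing times increased to a finite limit, its left germ there would run through
  the interior just before the limit, whereas each crossing time lies on a side.\<close>

lemma trajectory_alive:
  assumes u: "transverse u" and p: "out u p" and g: "linear_trajectory d u \<gamma>" "\<gamma> 0 = proj d p"
  shows "alive u p"
proof -
  have ind0: "out u (st u n p) \<and> \<gamma> (tm u n p) = proj d (st u n p) \<and> (0 < n \<longrightarrow> exit_pt u (st u (n - 1) p) \<notin> V)" for n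
  proof (induction n)
    case (Suc n)
    define q where "q = st u n p"
    define T where "T = tm u n p"
    have q: "out u q" "q \<in> P" "\<gamma> T = proj d q" using Suc by (auto simp: q_def T_def out_def)
    have g': "linear_trajectory d u (\<lambda>t. \<gamma> (t + T))" by (rule linear_trajectory_shift[OF g(1)])
    have e: "0 \<le> exit_time u q" by (rule exit_time_nonneg[OF u q(2)])
    have "\<gamma> (exit_time u q + T) = proj d (q + exit_time u q *\<^sub>R u)"
    proof (rule straight_unique[OF linear_trajectory_straight[OF g', of 0 "exit_time u q"]])
      show "straight u 0 (exit_time u q) (\<lambda>s. proj d (q + s *\<^sub>R u))"
        by (rule straight_polygon) (use in_P_iff_exit[OF u q(2)] in auto)
    qed (use linear_trajectory_noncone[OF g'] q e in auto)
    hence ge: "\<gamma> (tm u (Suc n) p) = proj d (exit_pt u q)"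
      by (simp add: exit_pt_def tm_Suc q_def T_def add.commute)
    have "exit_pt u q \<notin> V" using ge linear_trajectory_noncone[OF g(1)] proj_cone_iff[OF exit_pt_P[OF u q(2)]] by metis
    from hop_out[OF u exit_pt_P[OF u q(2)] this] ge this show ?case unfolding st_Suc step_def q_def by simp
  qed (use p g in simp)
  hence ind: "out u (st u n p)" "\<gamma> (tm u n p) = proj d (st u n p)" for n by auto
  have nv: "exit_pt u (st u n p) \<notin> V" for n using ind0[of "Suc n"] by simp
  have inP: "st u n p \<in> P" for n using ind by (simp add: out_def)
  have side: "\<exists>k. st u (Suc n) p \<in> side d k" for n
  proof -
    obtain k where k: "k < 2*d" "exit_pt u (st u n p) \<in> side d k" "0 < nrm k \<bullet> u" using exit_side[OF u inP] .
    from hop_side[OF k(1,2) nv k(3)] side_shift_in[OF k(2)] show ?thesis unfolding st_Suc step_def by auto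
  qed
  have inc: "tm u n p < tm u (Suc n) p" for n using ind out_exit_pos[OF u] by (simp add: tm_Suc)
  have "\<exists>n. real N < tm u n p" for N
  proof (rule ccontr)
    assume "\<nexists>n. real N < tm u n p"
    hence bd: "tm u n p \<le> real N" for n by (simp add: not_less)
    define L where "L = (SUP n. tm u n p)"
    have bdd: "bdd_above (range (\<lambda>n. tm u n p))" using bd by (auto intro!: bdd_aboveI)
    have le: "tm u n p \<le> L" for n unfolding L_def by (rule cSUP_upper[OF _ bdd]) simp
    have lt: "tm u n p < L" for n using inc[of n] le[of "Suc n"] by linarith
    have "lgerm \<gamma> u L" using g(1) by (simp add: linear_trajectory_iff)
    then obtain e q where q: "0 < e" "q \<in> \<gamma> L" "\<And>s. 0 \<le> s \<Longrightarrow> s < e \<Longrightarrow> q - s *\<^sub>R u \<in> P \<and> \<gamma> (L - s) = proj d (q - s *\<^sub>R u)"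
      unfolding lgerm_def by auto
    have "L - e < L" using q by simp
    then obtain n0 where "L - e < tm u n0 p" unfolding L_def using less_cSUP_iff[OF _ bdd] by blast
    hence n: "L - e < tm u (Suc n0) p" using inc[of n0] by linarith
    define s where "s = L - tm u (Suc n0) p"
    have s: "0 < s" "s < e" using lt n by (auto simp: s_def)
    \<comment> \<open>Starting earlier than the crossing time places that crossing strictly between
      two points of a chord, hence in \<open>P0\<close>.\<close>
    define s' where "s' = (s + e) / 2"
    have s': "s < s'" "s' < e" "0 \<le> s'" using s by (auto simp: s'_def)
    have p': "q - s' *\<^sub>R u \<in> P" "q \<in> P" using q(3)[OF s'(3,2)] q(3)[of 0] q(1) by auto
    have "s' \<le> exit_time u (q - s' *\<^sub>R u)" using in_P_iff_exit[OF u p'(1) s'(3)] p'(2) by simp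
    hence "q - s' *\<^sub>R u + (s' - s) *\<^sub>R u \<in> P0" using s s' by (intro chord_interior[OF u p'(1)]) auto
    hence in0: "q - s *\<^sub>R u \<in> P0" by (simp add: algebra_simps)
    have "\<gamma> (tm u (Suc n0) p) = proj d (q - s *\<^sub>R u)" using q(3)[of s] s by (simp add: s_def)
    hence "proj d (st u (Suc n0) p) = {q - s *\<^sub>R u}" using ind P0_proj[OF in0] by metis
    hence "st u (Suc n0) p = q - s *\<^sub>R u" using proj_self[OF inP[of "Suc n0"]] by auto
    thus False using side[of n0] P0_nrm[OF in0] side_nrm by (metis order_less_irrefl)
  qed
  thus ?thesis using nv by (simp add: alive_def)
qed

section \<open>A pointwise lift of the flow\<close>

definition good :: "complex \<Rightarrow> complex \<Rightarrow> bool" where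
  "good u p \<longleftrightarrow> p \<in> P \<and> p \<notin> V \<and> alive u (hop u p) \<and> alive (- u) (hop (- u) p)"

text \<open>The flow on the polygon itself, built from measurable pieces. For negative time it uses
  the forward orbit in the opposite direction, which may start at a different representative of the
  same class.\<close>

definition lifted_flow :: "complex \<Rightarrow> real \<Rightarrow> complex \<Rightarrow> complex" where
  "lifted_flow u t p = (if good u p then (if 0 \<le> t then forward_flow u (hop u p) t else forward_flow (- u) (hop (- u) p) (- t)) else p)"

lemma good_trajectory:
  assumes u: "transverse u" and g: "good u p"
  shows "linear_trajectory d u (\<lambda>t. proj d (lifted_flow u t p)) \<and> proj d (lifted_flow u 0 p) = proj d p \<and> lifted_flow u t p \<in> P"
proof -
  note u' = transverse_uminus[OF u]
  have p: "p \<in> P" "p \<notin> V" and al: "alive u (hop u p)" "alive (- u) (hop (- u) p)" using g by (auto simp: good_def)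
  note o = hop_out(1)[OF u p] hop_out(1)[OF u' p]
  define g1 where "g1 t = proj d (forward_flow u (hop u p) t)" for t
  define g2 where "g2 t = proj d (forward_flow (- u) (hop (- u) p) t)" for t
  define \<gamma> where "\<gamma> t = proj d (lifted_flow u t p)" for t
  have z: "g1 0 = proj d p" "g2 0 = proj d p"
    unfolding g1_def g2_def forward_flow_0[OF u o(1) al(1)] forward_flow_0[OF u' o(2) al(2)] using hop_out(2) u u' p by auto
  have g1: "\<gamma> t = g1 t" if "0 \<le> t" for t using that g by (simp add: \<gamma>_def lifted_flow_def g1_def)
  have g2: "\<gamma> t = g2 (- t)" if "t \<le> 0" for t
    using that g z g1[of 0] by (cases "t = 0") (auto simp: \<gamma>_def lifted_flow_def g2_def)
  have r1: "rgerm \<gamma> u t" if t: "0 \<le> t" for t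
  proof -
    have "rgerm g1 u t" unfolding g1_def[abs_def] by (rule forward_flow_rgerm[OF u o(1) al(1) t])
    thus ?thesis unfolding rgerm_def using g1 t by simp
  qed
  have l1: "lgerm \<gamma> u t" if t: "0 < t" for t
  proof -
    have "lgerm g1 u t" unfolding g1_def[abs_def] by (rule forward_flow_lgerm[OF u o(1) al(1) t])
    then obtain e q where q: "0 < e" "q \<in> g1 t" "\<And>s. 0 \<le> s \<Longrightarrow> s < e \<Longrightarrow> q - s *\<^sub>R u \<in> P \<and> g1 (t - s) = proj d (q - s *\<^sub>R u)"
      unfolding lgerm_def by auto
    show ?thesis unfolding lgerm_def using q g1 t by (intro exI[of _ "min e t"] conjI bexI[of _ q]) auto
  qed
  have l2: "lgerm \<gamma> u t" if t: "t \<le> 0" for t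
  proof -
    have "rgerm g2 (- u) (- t)" unfolding g2_def[abs_def] by (rule forward_flow_rgerm[OF u' o(2) al(2)]) (use t in simp)
    then obtain e q where q: "0 < e" "q \<in> g2 (- t)" "\<And>s. 0 \<le> s \<Longrightarrow> s < e \<Longrightarrow> q - s *\<^sub>R u \<in> P \<and> g2 (- t + s) = proj d (q - s *\<^sub>R u)"
      unfolding rgerm_def by auto
    show ?thesis unfolding lgerm_def using q g2 t by (intro exI[of _ e] conjI bexI[of _ q]) auto
  qed
  have r2: "rgerm \<gamma> u t" if t: "t < 0" for t
  proof -
    have "lgerm g2 (- u) (- t)" unfolding g2_def[abs_def] by (rule forward_flow_lgerm[OF u' o(2) al(2)]) (use t in simp)
    then obtain e q where q: "0 < e" "q \<in> g2 (- t)" "\<And>s. 0 \<le> s \<Longrightarrow> s < e \<Longrightarrow> q + s *\<^sub>R u \<in> P \<and> g2 (- t - s) = proj d (q + s *\<^sub>R u)"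
      unfolding lgerm_def by auto
    show ?thesis unfolding rgerm_def using q g2 t by (intro exI[of _ "min e (- t)"] conjI bexI[of _ q]) auto
  qed
  have inP: "lifted_flow u t p \<in> P" for t
    using forward_flow_P[OF u o(1) al(1)] forward_flow_P[OF u' o(2) al(2)] g by (simp add: lifted_flow_def)
  have nc: "\<gamma> t \<notin> cone_points d" for t
    using forward_flow_noncone[OF u o(1) al(1)] forward_flow_noncone[OF u' o(2) al(2)] g by (simp add: \<gamma>_def lifted_flow_def)
  have "linear_trajectory d u \<gamma>" unfolding linear_trajectory_iff
    using inP nc r1 r2 l1 l2 proj_in_surface by (metis \<gamma>_def DiffI not_le)
  thus ?thesis using z g1[of 0] inP unfolding \<gamma>_def[abs_def] by simp
qed

lemma lifted_flow_eq:
  assumes u: "transverse u" and p: "p \<in> P"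
  shows "linear_flow d u t (proj d p) = proj d (lifted_flow u t p)" "lifted_flow u t p \<in> P"
proof -
  have "linear_flow d u t (proj d p) = proj d (lifted_flow u t p) \<and> lifted_flow u t p \<in> P"
  proof (cases "good u p")
    case True
    note g = good_trajectory[OF u True]
    have "linear_flow d u t (proj d (lifted_flow u 0 p)) = proj d (lifted_flow u t p)" using linear_flow_eq g by blast
    thus ?thesis using g by simp
  next
    case False
    have "\<nexists>\<gamma>. linear_trajectory d u \<gamma> \<and> \<gamma> 0 = proj d p"
    proof
      assume "\<exists>\<gamma>. linear_trajectory d u \<gamma> \<and> \<gamma> 0 = proj d p"
      then obtain \<gamma> where g: "linear_trajectory d u \<gamma>" "\<gamma> 0 = proj d p" by auto
      have pV: "p \<notin> V" using linear_trajectory_noncone[OF g(1), of 0] g(2) proj_cone_iff[OF p] by simp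
      have "alive u (hop u p)"
        by (rule trajectory_alive[OF u hop_out(1)[OF u p pV] g(1)]) (use hop_out(2)[OF u p pV] g in simp)
      moreover have "alive (- u) (hop (- u) p)"
        by (rule trajectory_alive[OF transverse_uminus[OF u] hop_out(1)[OF transverse_uminus[OF u] p pV] linear_trajectory_reflect[OF g(1)]])
          (use hop_out(2)[OF transverse_uminus[OF u] p pV] g in simp)
      ultimately show False using False p pV by (simp add: good_def)
    qed
    thus ?thesis using linear_flow_id False p by (simp add: lifted_flow_def)
  qed
  thus "linear_flow d u t (proj d p) = proj d (lifted_flow u t p)" "lifted_flow u t p \<in> P" by auto
qed

section \<open>The linear flow preserves area\<close>

lemma exit_time_measurable [measurable]: "transverse u \<Longrightarrow> exit_time u \<in> borel \<rightarrow>\<^sub>M borel"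
proof -
  assume u: "transverse u"
  have "(\<lambda>p. exit_time u p) \<in> borel_measurable borel"
  proof (rule borel_measurableI_ge)
    fix c
    have "{x \<in> space borel. c \<le> exit_time u x} = (\<Inter>k\<in>heads u. {x. nrm k \<bullet> x + c * (nrm k \<bullet> u) \<le> cos b})"
      by (auto simp: exit_time_ge_iff[OF u] inner_add_right)
    also have "\<dots> \<in> sets borel"
      using finite_heads heads_nonempty[OF u] by (intro sets.finite_INT) auto
    finally show "{x \<in> space borel. c \<le> exit_time u x} \<in> sets borel" .
  qed
  thus ?thesis by simp
qed

lemma side_borel [measurable]: "side d k \<in> sets borel"
  unfolding side_def by (intro borel_closed closed_segment)

lemma V_borel [measurable]: "V \<in> sets borel"
  using finite_V by (intro borel_closed finite_imp_closed)

lemma hop_measurable [measurable]: "hop u \<in> borel \<rightarrow>\<^sub>M borel"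
  unfolding hop_def[abs_def] by measurable

context
  fixes u assumes u: "transverse u"
begin

lemma exit_time_measurable' [measurable]: "exit_time u \<in> borel \<rightarrow>\<^sub>M borel"
  using u by (rule exit_time_measurable)

lemma exit_pt_measurable [measurable]: "exit_pt u \<in> borel \<rightarrow>\<^sub>M borel"
  unfolding exit_pt_def[abs_def] by measurable

lemma st_measurable [measurable]: "st u n \<in> borel \<rightarrow>\<^sub>M borel"
proof (induction n)
  case 0
  have "st u 0 = (\<lambda>p. p)" by (auto simp: st_def)
  thus ?case by simp
next
  case (Suc n)
  have "st u (Suc n) = (\<lambda>p. hop u (exit_pt u (st u n p)))" by (intro ext) (simp add: st_Suc step_def)
  thus ?case using Suc by simp
qed

lemma tm_measurable [measurable]: "tm u n \<in> borel \<rightarrow>\<^sub>M borel"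
  unfolding tm_def[abs_def] by measurable

lemma alive_borel [measurable]: "Measurable.pred borel (alive u)"
  unfolding alive_def[abs_def] by measurable

text \<open>The segment number takes countably many values, so it is enough to treat it as a
  constant.\<close>

lemma forward_flow_measurable [measurable]: "(\<lambda>(p, t). forward_flow u p t) \<in> borel \<Otimes>\<^sub>M borel \<rightarrow>\<^sub>M borel"
proof -
  have "(\<lambda>x. (\<lambda>n x. st u n (fst x) + (snd x - tm u n (fst x)) *\<^sub>R u) (LEAST n. snd x < tm u (Suc n) (fst x)) x)
      \<in> (borel :: complex measure) \<Otimes>\<^sub>M (borel :: real measure) \<rightarrow>\<^sub>M borel"
    by (rule measurable_compose_countable) measurable
  thus ?thesis by (simp add: forward_flow_def Let_def case_prod_beta)
qed

end

lemma good_borel: "transverse u \<Longrightarrow> Measurable.pred borel (good u)"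
proof -
  assume u: "transverse u"
  note [measurable] = alive_borel[OF u] alive_borel[OF transverse_uminus[OF u]]
  show ?thesis unfolding good_def[abs_def] by measurable
qed

lemma lifted_flow_measurable: "transverse u \<Longrightarrow> (\<lambda>(t, p). lifted_flow u t p) \<in> borel \<Otimes>\<^sub>M borel \<rightarrow>\<^sub>M borel"
proof -
  assume u: "transverse u"
  note [measurable] = good_borel[OF u] forward_flow_measurable[OF u] forward_flow_measurable[OF transverse_uminus[OF u]]
  have [measurable]: "(\<lambda>x::real \<times> complex. forward_flow u (hop u (snd x)) (fst x)) \<in> borel \<Otimes>\<^sub>M borel \<rightarrow>\<^sub>M borel"
    by (rule measurable_compose[of "\<lambda>x. (hop u (snd x), fst x)" _ "borel \<Otimes>\<^sub>M borel" "\<lambda>(p, t). forward_flow u p t", simplified]) measurable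
  have [measurable]: "(\<lambda>x::real \<times> complex. forward_flow (- u) (hop (- u) (snd x)) (- fst x)) \<in> borel \<Otimes>\<^sub>M borel \<rightarrow>\<^sub>M borel"
    by (rule measurable_compose[of "\<lambda>x. (hop (- u) (snd x), - fst x)" _ "borel \<Otimes>\<^sub>M borel" "\<lambda>(p, t). forward_flow (- u) p t", simplified]) measurable
  show ?thesis unfolding lifted_flow_def[abs_def] case_prod_beta by measurable
qed

text \<open>A measurable section of the quotient map; off the cone points it picks the representative from which
  direction \<open>u\<close> points into the polygon.\<close>

definition out_rep :: "complex \<Rightarrow> complex set \<Rightarrow> complex" where
  "out_rep u x = (if x \<in> cone_points d then (SOME p. p \<in> x) else hop u (SOME p. p \<in> x))"

lemma out_rep_in: assumes u: "transverse u" and x: "x \<in> surface d" shows "out_rep u x \<in> P" "proj d (out_rep u x) = x"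
proof -
  define p where "p = (SOME p. p \<in> x)"
  have "\<exists>p. p \<in> x" using x proj_self surface_eq by auto
  hence p: "p \<in> x" unfolding p_def by (rule someI_ex)
  have pP: "p \<in> P" "x = proj d p" using in_surfaceD[OF x p] by auto
  have "out_rep u x \<in> P \<and> proj d (out_rep u x) = x"
  proof (cases "x \<in> cone_points d")
    case False
    hence "p \<notin> V" using pP proj_cone_iff by simp
    from hop_out[OF u pP(1) this] show ?thesis unfolding out_rep_def p_def[symmetric] using False
      by (simp add: out_def pP(2)[symmetric])
  next
    case True
    thus ?thesis unfolding out_rep_def p_def[symmetric] using pP by simp
  qed
  thus "out_rep u x \<in> P" "proj d (out_rep u x) = x" by auto
qed

text \<open>The arbitrary choice disappears after \<open>hop\<close>, since a non-cone class has
  only one \<open>out\<close> representative.\<close>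

lemma out_rep_proj: assumes u: "transverse u" and p: "p \<in> P" "p \<notin> V" shows "out_rep u (proj d p) = hop u p"
proof -
  define q where "q = (SOME q. q \<in> proj d p)"
  have q: "q \<in> proj d p" unfolding q_def using proj_self[OF p(1)] by (rule someI)
  have qP: "q \<in> P" "proj d p = proj d q" using in_surfaceD[OF proj_in_surface[OF p(1)] q] by auto
  have nc: "proj d p \<notin> cone_points d" using p proj_cone_iff by simp
  hence qV: "q \<notin> V" using qP proj_cone_iff by simp
  have "hop u q = hop u p"
    by (rule out_unique[OF hop_out(1)[OF u qP(1) qV] hop_out(1)[OF u p]]) (use hop_out(2) u p qP qV in simp)
  thus ?thesis using nc by (simp add: out_rep_def q_def[symmetric])
qed

lemma out_rep_measurable: assumes u: "transverse u" shows "out_rep u \<in> M \<rightarrow>\<^sub>M borel"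
proof (rule measurableI)
  fix B :: "complex set" assume B: "B \<in> sets borel"
  have "pre (out_rep u -` B \<inter> surface d) = {p \<in> P. p \<notin> V \<and> hop u p \<in> B} \<union> {p \<in> V. out_rep u (proj d p) \<in> B}"
    using out_rep_proj[OF u] by (auto simp: pre_def proj_in_surface)
  also have "\<dots> \<in> sets borel"
  proof (rule sets.Un)
    show "{p \<in> P. p \<notin> V \<and> hop u p \<in> B} \<in> sets borel" using B by measurable
    \<comment> \<open>At cone points the choice is arbitrary, but only finitely many points are
      concerned.\<close>
    show "{p \<in> V. out_rep u (proj d p) \<in> B} \<in> sets borel"
      using finite_V by (intro borel_closed finite_imp_closed) auto
  qed
  finally show "out_rep u -` B \<inter> space M \<in> sets M" by (simp add: sets_M_iff)
qed simp

lemma linear_flow_measurable: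
  assumes u: "transverse u" shows "(\<lambda>(t, x). linear_flow d u t x) \<in> borel \<Otimes>\<^sub>M M \<rightarrow>\<^sub>M M"
proof -
  note [measurable] = out_rep_measurable[OF u]
  have 1: "(\<lambda>x. lifted_flow u (fst x) (out_rep u (snd x))) \<in> borel \<Otimes>\<^sub>M M \<rightarrow>\<^sub>M borel"
    by (rule measurable_compose[of "\<lambda>x. (fst x, out_rep u (snd x))" _ "borel \<Otimes>\<^sub>M borel" "\<lambda>(t, p). lifted_flow u t p", simplified])
      (use lifted_flow_measurable[OF u] in measurable)
  have 2: "(\<lambda>x. lifted_flow u (fst x) (out_rep u (snd x))) \<in> borel \<Otimes>\<^sub>M M \<rightarrow>\<^sub>M restrict_space borel P"
    by (rule measurable_restrict_space2[OF _ 1]) (use lifted_flow_eq(2)[OF u] out_rep_in[OF u] in \<open>auto simp: space_pair_measure\<close>)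
  have "(\<lambda>x. proj d (lifted_flow u (fst x) (out_rep u (snd x)))) \<in> borel \<Otimes>\<^sub>M M \<rightarrow>\<^sub>M M"
    by (rule measurable_compose[OF 2 proj_measurable])
  moreover have "proj d (lifted_flow u (fst x) (out_rep u (snd x))) = (\<lambda>(t, x). linear_flow d u t x) x" if "x \<in> space (borel \<Otimes>\<^sub>M M)" for x
    using that lifted_flow_eq(1)[OF u, of "out_rep u (snd x)" "fst x"] out_rep_in[OF u, of "snd x"] by (auto simp: space_pair_measure)
  ultimately show ?thesis by (rule measurable_cong[THEN iffD1, rotated])
qed

text \<open>Lists of sides index the translations generated by the gluing. There are countably many
  of them, so for fixed time the lifted flow is a countable piecewise translation.\<close>

definition shifts :: "nat list \<Rightarrow> complex" where "shifts l = sum_list (map (side_shift d) l)"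

lemma hop_shifts: "\<exists>l. hop u q = q + shifts l"
proof -
  have "(\<Sum>k<n. if Q k then side_shift d k else 0) = shifts (filter Q [0..<n])" for n and Q :: "nat \<Rightarrow> bool"
    by (induction n) (auto simp: shifts_def)
  from this[of "\<lambda>k. q \<in> side d k \<and> 0 < nrm k \<bullet> u" "2 * d"] show ?thesis unfolding hop_def by auto
qed

lemma shifts_append: "shifts (l @ l') = shifts l + shifts l'" by (simp add: shifts_def)

lemma st_shifts: "\<exists>l. st u n p = p + tm u n p *\<^sub>R u + shifts l"
proof (induction n)
  case 0
  show ?case by (intro exI[of _ "[]"]) (simp add: shifts_def)
next
  case (Suc n)
  then obtain l where l: "st u n p = p + tm u n p *\<^sub>R u + shifts l" by blast
  obtain l' where "st u (Suc n) p = exit_pt u (st u n p) + shifts l'" unfolding st_Suc step_def using hop_shifts by blast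
  hence "st u (Suc n) p = p + tm u (Suc n) p *\<^sub>R u + shifts (l @ l')"
    using l by (simp add: exit_pt_def tm_Suc shifts_append algebra_simps)
  thus ?case by blast
qed

lemma forward_flow_shifts: "\<exists>l. forward_flow u p t = p + t *\<^sub>R u + shifts l"
proof -
  define n where "n = (LEAST n. t < tm u (Suc n) p)"
  obtain l where "st u n p = p + tm u n p *\<^sub>R u + shifts l" using st_shifts by blast
  hence "forward_flow u p t = p + t *\<^sub>R u + shifts l" by (simp add: forward_flow_def Let_def n_def[symmetric] algebra_simps)
  thus ?thesis by blast
qed

lemma lifted_flow_shifts: "lifted_flow u t p = p \<or> (\<exists>l. lifted_flow u t p = p + (t *\<^sub>R u + shifts l))"
proof -
  obtain l1 where 1: "forward_flow u (hop u p) t = hop u p + t *\<^sub>R u + shifts l1" using forward_flow_shifts by blast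
  obtain l2 where 2: "hop u p = p + shifts l2" using hop_shifts by blast
  obtain l3 where 3: "forward_flow (- u) (hop (- u) p) (- t) = hop (- u) p + (- t) *\<^sub>R (- u) + shifts l3" using forward_flow_shifts by blast
  obtain l4 where 4: "hop (- u) p = p + shifts l4" using hop_shifts by blast
  have "forward_flow u (hop u p) t = p + (t *\<^sub>R u + shifts (l1 @ l2))" using 1 2 by (simp add: shifts_append algebra_simps)
  moreover have "forward_flow (- u) (hop (- u) p) (- t) = p + (t *\<^sub>R u + shifts (l3 @ l4))" using 3 4 by (simp add: shifts_append algebra_simps)
  ultimately show ?thesis unfolding lifted_flow_def by auto
qed

lemma linear_flow_inj: "inj_on (linear_flow d u t) A"
  using linear_flow_inverse(1) by (rule inj_on_inverseI)

lemma linear_flow_preserving: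
  assumes u: "transverse u" shows "preserving (linear_flow d u t)"
proof -
  \<comment> \<open>Index 0 is reserved for the points that the flow leaves fixed.\<close>
  define c where "c i = (case i of 0 \<Rightarrow> 0 | Suc k \<Rightarrow> t *\<^sub>R u + shifts (from_nat k))" for i
  have fm: "lifted_flow u t \<in> borel \<rightarrow>\<^sub>M borel"
    by (rule measurable_compose[of "\<lambda>p. (t, p)" _ "borel \<Otimes>\<^sub>M borel" "\<lambda>(t, p). lifted_flow u t p", simplified])
      (use lifted_flow_measurable[OF u] in measurable)
  show ?thesis
  proof (rule preserving_piecewise[where m = "\<lambda>z. z" and m' = "\<lambda>z. z" and c = c and C = "\<lambda>i. {p. lifted_flow u t p = p + c i}"])
    show "area_preserving (\<lambda>z. z)" "area_preserving (\<lambda>z. z)" using area_preserving_rotation[of 1] by auto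
    show "linear_flow d u t x \<in> surface d" if "x \<in> surface d" for x using that by (rule linear_flow_surface)
    show "inj_on (linear_flow d u t) (surface d)" by (rule linear_flow_inj)
    show "{p. lifted_flow u t p = p + c i} \<in> sets borel" for i
      using fm by measurable
    show "P \<subseteq> (\<Union>i. {p. lifted_flow u t p = p + c i})"
    proof
      fix p
      have "\<exists>i. lifted_flow u t p = p + c i"
      proof (cases "lifted_flow u t p = p")
        case True
        thus ?thesis by (intro exI[of _ 0]) (simp add: c_def)
      next
        case False
        then obtain l where "lifted_flow u t p = p + (t *\<^sub>R u + shifts l)" using lifted_flow_shifts by blast
        thus ?thesis by (intro exI[of _ "Suc (to_nat l)"]) (simp add: c_def)
      qed
      thus "p \<in> (\<Union>i. {p. lifted_flow u t p = p + c i})" by blast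
    qed
    fix i p assume "p \<in> P" "p \<in> {p. lifted_flow u t p = p + c i}"
    thus "p + c i \<in> P \<and> linear_flow d u t (proj d p) = proj d (p + c i)" using lifted_flow_eq[OF u, of p t] by simp
  qed simp_all
qed

lemma linear_flow_measure_preserving:
  assumes u: "transverse u" shows "measure_preserving_flow M (linear_flow d u)"
  unfolding measure_preserving_flow_def
  using linear_flow_measurable[OF u] linear_flow_preserving[OF u] linear_flow_0 linear_flow_add
  by (auto simp: preserving_def)

section \<open>Approximation by parabolic directions\<close>

text \<open>An affine automorphism together with its inverse; preservation of the wedge means that
  the derivative has determinant 1.\<close>

definition affine_aut :: "(complex \<Rightarrow> complex) \<Rightarrow> (complex set \<Rightarrow> complex set) \<Rightarrow>
    (complex \<Rightarrow> complex) \<Rightarrow> (complex set \<Rightarrow> complex set) \<Rightarrow> bool" where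
  "affine_aut m \<phi> m' \<psi> \<longleftrightarrow> affine_map m \<phi> \<and> affine_map m' \<psi> \<and> (\<forall>z. m' (m z) = z) \<and> (\<forall>z. m (m' z) = z) \<and>
    (\<forall>x\<in>surface d. \<psi> (\<phi> x) = x) \<and> (\<forall>x\<in>surface d. \<phi> (\<psi> x) = x) \<and> preserving \<phi> \<and> preserving \<psi> \<and>
    (\<forall>z w. wedge (m z) (m w) = wedge z w)"

definition Veech :: "(complex \<Rightarrow> complex) set" where "Veech = {m. \<exists>\<phi> m' \<psi>. affine_aut m \<phi> m' \<psi>}"

lemma preserving_surface: "preserving \<phi> \<Longrightarrow> x \<in> surface d \<Longrightarrow> \<phi> x \<in> surface d"
  unfolding preserving_def using measurable_space[of \<phi> M M x] by simp

lemma affine_aut_comp: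
  assumes 1: "affine_aut m1 \<phi>1 m1' \<psi>1" and 2: "affine_aut m2 \<phi>2 m2' \<psi>2"
  shows "affine_aut (m1 \<circ> m2) (\<phi>1 \<circ> \<phi>2) (m2' \<circ> m1') (\<psi>2 \<circ> \<psi>1)"
  using 1 2 preserving_surface unfolding affine_aut_def
  by (simp add: affine_map_comp preserving_comp)

lemma Veech_comp: "m1 \<in> Veech \<Longrightarrow> m2 \<in> Veech \<Longrightarrow> m1 \<circ> m2 \<in> Veech"
  unfolding Veech_def using affine_aut_comp by blast

lemma Veech_shear: "shear_map (of_int n * twist) \<in> Veech"
proof -
  have "wedge (shear_map r z) (shear_map r w) = wedge z w" for r z w
  proof -
    have l: "shear_map r z = kap * Complex (Xc z + r * Yc z) (Yc z)" for z by (subst XY_local[of z], rule shear_map_local)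
    have "wedge (shear_map r z) (shear_map r w) = wedge (kap * Complex (Xc z) (Yc z)) (kap * Complex (Xc w) (Yc w))"
      unfolding l wedge_rotate[OF norm_kap] by (simp add: wedge_def algebra_simps)
    thus ?thesis by (simp only: XY_local[symmetric])
  qed
  moreover have "shear n (shear (- n) x) = x" if "x \<in> surface d" for x
    using shear_inverse[OF that, of "- n"] by simp
  moreover have "affine_map (shear_map (- (of_int n * twist))) (shear (- n))" using shear_affine[of "- n"] by simp
  ultimately have "affine_aut (shear_map (of_int n * twist)) (shear n) (shear_map (- (of_int n * twist))) (shear (- n))"
    unfolding affine_aut_def by (simp add: shear_affine shear_map_inverse shear_inverse shear_preserving)
  thus ?thesis unfolding Veech_def by blast
qed

lemma Veech_turn: "(*) (vertex d k) \<in> Veech"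
proof -
  have "affine_aut ((*) (vertex d k)) (turn k) ((*) (vertex d ((2*d-1)*k))) (turn ((2*d-1)*k))"
    unfolding affine_aut_def by (simp add: turn_affine turn_inverse[simplified] turn_preserving wedge_rotate vertex_inverse[simplified] flip: mult.assoc)
  thus ?thesis unfolding Veech_def by blast
qed

text \<open>Only even multiples of \<open>b\<close> occur, since the polygon is invariant under
  rotation by \<open>2 * b\<close>, not by \<open>b\<close>.\<close>

lemma Veech_rotation: "(*) (cis (2 * of_int z * b)) \<in> Veech"
proof -
  define k where "k = nat (z mod int (2 * d))"
  define q where "q = z div int (2 * d)"
  have "0 \<le> z mod int (2 * d)" using d_ge by simp
  hence z: "z = int k + int (2 * d) * q" unfolding k_def q_def by simp
  have "2 * of_int z * b = 2 * real k * b + of_int q * (2 * (2 * real d * b))" unfolding z by (simp add: algebra_simps)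
  also have "\<dots> = 2 * real k * b + 2 * pi * of_int q" unfolding db by simp
  finally have "cis (2 * of_int z * b) = vertex d k" unfolding vertex_cis by (simp add: cis_mult[symmetric] cis_multiple_2pi)
  thus ?thesis using Veech_turn by simp
qed

lemma Veech_linear: "m \<in> Veech \<Longrightarrow> linear m"
  unfolding Veech_def affine_aut_def affine_map_def by auto

lemma Veech_wedge: "m \<in> Veech \<Longrightarrow> wedge (m z) (m w) = wedge z w"
  unfolding Veech_def affine_aut_def by auto

text \<open>The fan of directions at multiples of \<open>b\<close> from the horizontal one, counted
  counterclockwise for \<open>s = 1\<close> and clockwise for \<open>s = -1\<close>.\<close>

definition ray :: "int \<Rightarrow> nat \<Rightarrow> complex" where "ray s k = kap * cis (of_int s * (real k * b))"
lemma rot_ray: "cis x * ray s j = kap * cis (x + of_int s * (real j * b))"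
  unfolding ray_def cis_mult[symmetric] by (rule mult.left_commute)

text \<open>For \<open>k > 0\<close> this is the Chebyshev polynomial of the second kind of degree
  \<open>k - 1\<close>, evaluated at \<open>cos b\<close>.\<close>

definition sin_ratio :: "nat \<Rightarrow> real" where "sin_ratio k = sin (real k * b) / sin b"

lemma sin_ratio_0: "sin_ratio 0 = 0" and sin_ratio_1: "sin_ratio 1 = 1" and sin_ratio_2d: "sin_ratio (2 * d) = 0"
  using sin_b_pos db by (simp_all add: sin_ratio_def)

lemma sin_ratio_ge: assumes "1 \<le> k" "k < 2 * d" shows "1 \<le> sin_ratio k"
proof -
  have db2: "real d * b = pi / 2" using db by simp
  have mp: "- (pi / 2) \<le> b" using b_pos pi_gt_zero by linarith
  have "sin b \<le> sin (real k * b)"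
  proof (cases "k \<le> d")
    case True
    have "1 * b \<le> real k * b" "real k * b \<le> real d * b" using assms True b_pos by (auto intro!: mult_right_mono)
    thus ?thesis using db2 mp by (intro sin_monotone_2pi_le) linarith+
  next
    case False
    have e: "sin (real k * b) = sin (real (2 * d - k) * b)"
    proof -
      have "real (2 * d - k) * b = pi - real k * b" using assms db by (simp add: of_nat_diff algebra_simps)
      thus ?thesis by simp
    qed
    have "1 * b \<le> real (2 * d - k) * b" "real (2 * d - k) * b \<le> real d * b"
      using assms False b_pos by (auto intro!: mult_right_mono simp: of_nat_diff)
    thus ?thesis unfolding e using db2 mp by (intro sin_monotone_2pi_le) linarith+
  qed
  thus ?thesis using sin_b_pos by (simp add: sin_ratio_def)
qed

lemma sin_ratio_nonneg: "k \<le> 2 * d \<Longrightarrow> 0 \<le> sin_ratio k"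
  using sin_ratio_ge[of k] sin_ratio_0 sin_ratio_2d by (cases "k = 0 \<or> k = 2 * d") auto

lemma sin_ratio_le: "sin_ratio k \<le> 1 / sin b" unfolding sin_ratio_def using sin_b_pos by (intro divide_right_mono) auto

text \<open>Consecutive sheared rays span area 1 in units of the original sector, which makes the
  coordinates in a subsector explicit.\<close>

lemma sin_ratio_det: "sin_ratio (k + 1) * sin_ratio (k + 1) - sin_ratio k * sin_ratio (k + 2) = 1"
proof -
  define x where "x = real k * b"
  define S where "S = sin b"
  define T where "T = cos b"
  have S: "S \<noteq> 0" "S ^ 2 = 1 - T ^ 2" using sin_b_pos by (auto simp: S_def T_def sin_squared_eq)
  have 1: "real (k + 1) * b = x + b" "real (k + 2) * b = (x + b) + b" by (simp_all add: x_def algebra_simps)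
  have "sin (x + b) * sin (x + b) - sin x * sin ((x + b) + b) = S ^ 2 * (sin x ^ 2 + cos x ^ 2)"
    unfolding sin_add cos_add S_def[symmetric] T_def[symmetric] using S(2) by algebra
  hence "sin (x + b) * sin (x + b) - sin x * sin ((x + b) + b) = S ^ 2" by simp
  thus ?thesis using S unfolding sin_ratio_def 1 x_def[symmetric] S_def[symmetric] by (simp add: field_simps power2_eq_square)
qed

text \<open>The shear squeezes the fan of rays with indices \<open>0\<close> to
  \<open>2 * d - 1\<close> into the sector between \<open>ray s 0\<close> and
  \<open>ray s 1\<close>, fixing the first ray and moving the last one to \<open>ray s 1\<close>.
  This is the subdivision used for the Farey step.\<close>

lemma shear_ray:
  assumes s: "s = 1 \<or> s = -1"
  shows "shear_map (of_int s * twist) (ray s k) = sin_ratio (k + 1) *\<^sub>R ray s 0 + sin_ratio k *\<^sub>R ray s 1"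
proof -
  define x where "x = real k * b"
  have 1: "real (k + 1) * b = x + b" by (simp add: x_def algebra_simps)
  have r: "ray s k = kap * Complex (cos x) (of_int s * sin x)"
    using s unfolding ray_def x_def by (auto simp: complex_eq_iff)
  have r1: "ray s 0 = kap * Complex 1 0" "ray s 1 = kap * Complex (cos b) (of_int s * sin b)"
    using s unfolding ray_def by (auto simp: complex_eq_iff)
  have s2: "of_int s * of_int s = (1::real)" using s by auto
  have e: "cos x + of_int s * twist * (of_int s * sin x) = sin_ratio (k + 1) + sin_ratio k * cos b"
  proof -
    have "of_int s * twist * (of_int s * sin x) = (of_int s * of_int s) * twist * sin x" by (simp add: algebra_simps)
    also have "\<dots> = 2 * cos b / sin b * sin x" unfolding s2 twist_def by simp
    finally show ?thesis using sin_b_pos unfolding sin_ratio_def 1 x_def[symmetric] sin_add by (simp add: field_simps)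
  qed
  have "sin_ratio k * sin b = sin x" using sin_b_pos by (simp add: sin_ratio_def x_def)
  hence e2: "of_int s * sin x = sin_ratio k * (of_int s * sin b)" by simp
  show ?thesis unfolding r shear_map_local r1 unfolding e unfolding e2 by (simp add: complex_eq_iff algebra_simps)
qed

lemma subsector:
  assumes "0 \<le> \<alpha>" "0 \<le> \<beta>"
  obtains k x y where "k + 1 < 2 * d" "0 \<le> x" "0 \<le> y"
    "\<alpha> = x * sin_ratio (k + 1) + y * sin_ratio (k + 2)" "\<beta> = x * sin_ratio k + y * sin_ratio (k + 1)"
proof -
  \<comment> \<open>The sign of this determinant tells on which side of the \<open>k\<close>-th
    sheared ray the vector lies; a discrete intermediate value argument finds the subsector.\<close>
  define f where "f k = \<alpha> * sin_ratio k - \<beta> * sin_ratio (k + 1)" for k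
  have "\<exists>k<n. f k \<le> 0 \<and> 0 \<le> f (k + 1)" if "f 0 \<le> 0" "0 \<le> f n" "0 < n" for n
    using that
  proof (induction n)
    case (Suc n)
    show ?case
    proof (cases "f n \<le> 0")
      case True
      thus ?thesis using Suc by (intro exI[of _ n]) auto
    next
      case False
      hence "0 < n" using Suc by (cases n) auto
      then obtain k where "k < n" "f k \<le> 0" "0 \<le> f (k + 1)" using Suc False by auto
      thus ?thesis by (intro exI[of _ k]) auto
    qed
  qed simp
  moreover have "f 0 \<le> 0" using assms sin_ratio_0 sin_ratio_1 by (simp add: f_def)
  moreover have "2 * d - 1 + 1 = 2 * d" using d_ge by simp
  hence "0 \<le> f (2 * d - 1)" using assms sin_ratio_2d sin_ratio_nonneg[of "2 * d - 1"] unfolding f_def by simp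
  moreover have "0 < 2 * d - 1" using d_ge by simp
  ultimately obtain k where k: "k < 2 * d - 1" "f k \<le> 0" "0 \<le> f (k + 1)" by blast
  have det: "sin_ratio (k + 1) * sin_ratio (k + 1) - sin_ratio k * sin_ratio (k + 2) = 1" by (rule sin_ratio_det)
  define A1 B1 C1 where "A1 = sin_ratio k" and "B1 = sin_ratio (k + 1)" and "C1 = sin_ratio (k + 2)"
  have det': "B1 * B1 - A1 * C1 = 1" using det by (simp add: A1_def B1_def C1_def)
  have f1: "f k = \<alpha> * A1 - \<beta> * B1" "f (k + 1) = \<alpha> * B1 - \<beta> * C1"
    by (simp_all add: f_def A1_def B1_def C1_def numeral_2_eq_2)
  have "\<alpha> = f (k + 1) * B1 + (- f k) * C1" "\<beta> = f (k + 1) * A1 + (- f k) * B1"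
    unfolding f1 using det' by algebra+
  thus ?thesis using k by (intro that[of k "f (k + 1)" "- f k"]) (auto simp: A1_def B1_def C1_def)
qed

text \<open>The linear functional with value 1 on two unit vectors at angle \<open>b\<close>. It
  replaces the norm as a measure of size because it is additive on combinations of the two boundary
  vectors.\<close>

definition weight :: "complex \<Rightarrow> complex \<Rightarrow> complex \<Rightarrow> real" where
  "weight E0 E1 v = (v \<bullet> (E0 + E1)) / (1 + cos b)"

lemma weight_lin: "weight E0 E1 (x *\<^sub>R v + y *\<^sub>R w) = x * weight E0 E1 v + y * weight E0 E1 w"
  by (simp add: weight_def inner_add_left add_divide_distrib)

lemma weight_le: assumes "norm E0 = 1" "norm E1 = 1" shows "weight E0 E1 v \<le> 2 * norm v"
proof -
  have "v \<bullet> (E0 + E1) \<le> norm v * norm (E0 + E1)" by (rule norm_cauchy_schwarz)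
  also have "\<dots> \<le> norm v * 2" using norm_triangle_ineq[of E0 E1] assms by (intro mult_left_mono) auto
  finally have "weight E0 E1 v \<le> norm v * 2 / (1 + cos b)"
    unfolding weight_def using cos_b_pos by (intro divide_right_mono) auto
  also have "\<dots> \<le> norm v * 2 / 1" using cos_b_pos by (intro divide_left_mono) auto
  finally show ?thesis by simp
qed

text \<open>Sectors between the images of \<open>kap\<close> and of an adjacent direction under the Veech group: they are
  subdivided as in the Farey algorithm.\<close>

definition farey :: "(complex \<Rightarrow> real) \<Rightarrow> complex \<Rightarrow> (complex \<Rightarrow> complex) \<Rightarrow> int \<Rightarrow> real \<Rightarrow> bool" where
  "farey W u m s T \<longleftrightarrow> m \<in> Veech \<and> (s = 1 \<or> s = -1) \<and>
     (\<exists>\<alpha>\<ge>0. \<exists>\<beta>\<ge>0. u = \<alpha> *\<^sub>R m (ray s 0) + \<beta> *\<^sub>R m (ray s 1)) \<and>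
     1 \<le> W (m (ray s 0)) \<and> 1 \<le> W (m (ray s 1)) \<and>
     norm (m (ray s 0)) \<le> W (m (ray s 0)) \<and> norm (m (ray s 1)) \<le> W (m (ray s 1)) \<and>
     T = W (m (ray s 0)) + W (m (ray s 1))"

text \<open>Any two adjacent rays of the subdivision include one inner ray, whose weight is at least
  the sum \<open>T\<close> of the old weights, while the other has weight at least 1. The upper
  bound comes from \<open>sin_ratio\<close> being at most \<open>1 / sin b\<close>.\<close>

lemma farey_step:
  assumes W: "\<And>x y v w. W (x *\<^sub>R v + y *\<^sub>R w) = x * W v + y * W w" and f: "farey W u m s T"
  shows "\<exists>m' s' T'. farey W u m' s' T' \<and> T + 1 \<le> T' \<and> T' \<le> (2 / sin b) * T"
proof -
  define A B where "A = m (ray s 0)" and "B = m (ray s 1)"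
  from f obtain \<alpha> \<beta> where m: "m \<in> Veech" and s: "s = 1 \<or> s = -1" and ab: "0 \<le> \<alpha>" "0 \<le> \<beta>" "u = \<alpha> *\<^sub>R A + \<beta> *\<^sub>R B"
    and WAB: "1 \<le> W A" "1 \<le> W B" "norm A \<le> W A" "norm B \<le> W B" and T: "T = W A + W B"
    unfolding farey_def A_def B_def by blast
  have lm: "linear m" by (rule Veech_linear[OF m])
  obtain k x y where k: "k + 1 < 2 * d" and xy: "0 \<le> x" "0 \<le> y"
    and al: "\<alpha> = x * sin_ratio (k + 1) + y * sin_ratio (k + 2)" and be: "\<beta> = x * sin_ratio k + y * sin_ratio (k + 1)"
    using subsector[OF ab(1,2)] .
  define h where "h = shear_map (of_int s * twist)"
  define Ch where "Ch i = m (h (ray s i))" for i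
  have hV: "m \<circ> h \<in> Veech" unfolding h_def by (rule Veech_comp[OF m Veech_shear])
  have Ch: "Ch i = sin_ratio (i + 1) *\<^sub>R A + sin_ratio i *\<^sub>R B" for i
    unfolding Ch_def h_def shear_ray[OF s] A_def B_def using lm by (simp add: linear_add linear_cmul)
  have WC: "W (Ch i) = sin_ratio (i + 1) * W A + sin_ratio i * W B" for i unfolding Ch W ..
  \<comment> \<open>Domination of the norm by \<open>W\<close> passes to nonnegative
    combinations.\<close>
  have nC: "norm (Ch i) \<le> W (Ch i)" if "i + 1 \<le> 2 * d" for i
  proof -
    have c: "0 \<le> sin_ratio (i + 1)" "0 \<le> sin_ratio i" using sin_ratio_nonneg that by auto
    have "norm (Ch i) \<le> norm (sin_ratio (i + 1) *\<^sub>R A) + norm (sin_ratio i *\<^sub>R B)" unfolding Ch by (rule norm_triangle_ineq)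
    also have "\<dots> \<le> sin_ratio (i + 1) * W A + sin_ratio i * W B" using c WAB by (auto intro!: add_mono mult_left_mono)
    finally show ?thesis unfolding WC .
  qed
  have interior: "W A + W B \<le> W (Ch i)" if "1 \<le> i" "i + 1 < 2 * d" for i
  proof -
    have "1 * W A \<le> sin_ratio (i + 1) * W A" "1 * W B \<le> sin_ratio i * W B"
      using sin_ratio_ge[of i] sin_ratio_ge[of "i + 1"] that WAB by (auto intro!: mult_right_mono)
    thus ?thesis unfolding WC by simp
  qed
  have C0: "Ch 0 = A" unfolding Ch using sin_ratio_0 sin_ratio_1 by simp
  have d1: "2 * d - 1 + 1 = 2 * d" using d_ge by simp
  have Cl: "Ch (2 * d - 1) = B"
  proof -
    have "sin_ratio (2 * d - 1) = 1"
    proof -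
      have "real (2 * d - 1) * b = pi - b" using d_ge db by (simp add: of_nat_diff algebra_simps)
      thus ?thesis using sin_b_pos by (simp add: sin_ratio_def)
    qed
    thus ?thesis unfolding Ch d1 using sin_ratio_2d by simp
  qed
  have W1: "1 \<le> W (Ch i)" if "i < 2 * d" for i
  proof -
    consider "i = 0" | "i = 2 * d - 1" | "1 \<le> i" "i + 1 < 2 * d" using \<open>i < 2 * d\<close> by linarith
    thus ?thesis by cases (use C0 Cl WAB interior[of i] in auto)
  qed
  have sum: "T + 1 \<le> W (Ch k) + W (Ch (k + 1))"
  proof (cases "k = 0")
    case True
    have "T \<le> W (Ch 1)" unfolding T by (rule interior) (use d_ge in auto)
    thus ?thesis using True C0 WAB by simp
  next
    case False
    have "T \<le> W (Ch k)" unfolding T by (rule interior) (use False k in auto)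
    thus ?thesis using W1[of "k + 1"] k by simp
  qed
  have up: "W (Ch i) \<le> (1 / sin b) * T" for i
  proof -
    have "sin_ratio (i + 1) * W A \<le> (1 / sin b) * W A" "sin_ratio i * W B \<le> (1 / sin b) * W B"
      using WAB by (intro mult_right_mono[OF sin_ratio_le], linarith)+
    thus ?thesis unfolding WC T by (simp only: distrib_left)
  qed
  have u: "u = x *\<^sub>R Ch k + y *\<^sub>R Ch (k + 1)"
    unfolding Ch ab(3) al be by (simp add: algebra_simps numeral_2_eq_2)
  define T' where "T' = W (Ch k) + W (Ch (k + 1))"
  have T': "T + 1 \<le> T'" "T' \<le> (2 / sin b) * T" using sum up[of k] up[of "k + 1"] unfolding T'_def by auto
  \<comment> \<open>Only rays of even index are images of \<open>kap\<close> under Veech rotations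
    followed by the shear. For odd \<open>k\<close> the boundary rays of the new sector are
    therefore exchanged and the orientation \<open>s\<close> is reversed.\<close>
  show ?thesis
  proof (cases "even k")
    case True
    then obtain i where i: "k = 2 * i" by blast
    define m' where "m' = m \<circ> h \<circ> (*) (cis (2 * of_int (s * int i) * b))"
    have V: "m' \<in> Veech" unfolding m'_def by (intro Veech_comp hV Veech_rotation)
    have an: "2 * of_int (s * int i) * b = of_int s * (real k * b)" unfolding i by simp
    have r0: "m' (ray s 0) = Ch k" unfolding m'_def an comp_def rot_ray Ch_def by (simp add: ray_def)
    have r1: "m' (ray s 1) = Ch (k + 1)" unfolding m'_def an comp_def rot_ray Ch_def by (simp add: ray_def algebra_simps)
    have "farey W u m' s T'"
      unfolding farey_def r0 r1 using V s u xy W1[of k] W1[of "k + 1"] nC[of k] nC[of "k + 1"] k T'_def by auto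
    thus ?thesis using T' by blast
  next
    case False
    hence "even (k + 1)" by simp
    then obtain i where i: "k + 1 = 2 * i" by blast
    define m' where "m' = m \<circ> h \<circ> (*) (cis (2 * of_int (s * int i) * b))"
    have V: "m' \<in> Veech" unfolding m'_def by (intro Veech_comp hV Veech_rotation)
    have "2 * real i = real (k + 1)" using i by (metis of_nat_mult of_nat_numeral)
    hence an: "2 * of_int (s * int i) * b = of_int s * (real (k + 1) * b)" by (simp add: mult_ac)
    have r0: "m' (ray (- s) 0) = Ch (k + 1)" unfolding m'_def an comp_def rot_ray Ch_def by (simp add: ray_def)
    have r1: "m' (ray (- s) 1) = Ch k" unfolding m'_def an comp_def rot_ray Ch_def by (simp add: ray_def algebra_simps)
    have "u = y *\<^sub>R Ch (k + 1) + x *\<^sub>R Ch k" using u by (simp add: add.commute)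
    hence "farey W u m' (- s) T'"
      unfolding farey_def r0 r1 using V s xy W1[of k] W1[of "k + 1"] nC[of k] nC[of "k + 1"] k T'_def by auto
    thus ?thesis using T' by blast
  qed
qed

lemma farey_init:
  assumes u: "norm u = 1"
  obtains E0 E1 m s where "norm E0 = 1" "norm E1 = 1" "farey (weight E0 E1) u m s 2"
proof -
  have n1: "norm (cnj kap * u) = 1" using u by (simp add: norm_mult)
  hence nz: "cnj kap * u \<noteq> 0" by force
  define \<theta> where "\<theta> = Arg (cnj kap * u)"
  have th: "cnj kap * u = cis \<theta>" using cis_Arg[OF nz] n1 by (simp add: \<theta>_def sgn_eq)
  have u\<theta>: "u = kap * cis \<theta>" unfolding th[symmetric] mult.assoc[symmetric] kap_cnj by simp
  define k where "k = \<lfloor>\<theta> / b\<rfloor>"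
  define ph where "ph = \<theta> - of_int k * b"
  have "of_int k \<le> \<theta> / b" "\<theta> / b < of_int k + 1" unfolding k_def by linarith+
  hence ph: "0 \<le> ph" "ph \<le> b" using b_pos by (auto simp: ph_def field_simps)
  have sp: "0 \<le> sin ph" "0 \<le> sin (b - ph)" using ph b_le by (auto intro!: sin_ge_zero)
  have comb: "cis ph = (sin (b - ph) / sin b) *\<^sub>R 1 + (sin ph / sin b) *\<^sub>R cis b"
    using sin_b_pos by (simp add: complex_eq_iff sin_diff field_simps)
  \<comment> \<open>The boundary ray with an even multiple of \<open>b\<close> becomes
    \<open>ray s 0\<close>; \<open>s\<close> records on which side of it \<open>u\<close>
    lies.\<close>
  obtain s i :: int where s: "s = 1 \<or> s = -1" and si: "(s = 1 \<and> k = 2 * i) \<or> (s = -1 \<and> k + 1 = 2 * i)"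
  proof (cases "even k")
    case True
    then obtain i where "k = 2 * i" by blast
    thus ?thesis by (intro that[of 1 i]) auto
  next
    case False
    then obtain i where "k = 2 * i + 1" by (elim oddE)
    thus ?thesis by (intro that[of "-1" "i + 1"]) auto
  qed
  define m where "m = (*) (cis (2 * of_int i * b))"
  define E0 E1 where "E0 = m (ray s 0)" and "E1 = m (ray s 1)"
  have n: "norm E0 = 1" "norm E1 = 1" by (simp_all add: E0_def E1_def m_def ray_def norm_mult)
  have E: "E0 = kap * cis (2 * of_int i * b)" "E1 = kap * cis (2 * of_int i * b + of_int s * b)"
    by (simp_all add: E0_def E1_def m_def rot_ray)
  have dot: "E0 \<bullet> E1 = cos b" unfolding E kap_inner inner_cis using s by auto
  have w: "weight E0 E1 E0 = 1" "weight E0 E1 E1 = 1"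
  proof -
    have "E1 \<bullet> E0 = cos b" using dot by (simp only: inner_commute)
    moreover have "E0 \<bullet> E0 = 1" "E1 \<bullet> E1 = 1" using n by (simp_all only: norm_eq_1)
    ultimately show "weight E0 E1 E0 = 1" "weight E0 E1 E1 = 1"
      using dot cos_b_pos by (simp_all add: weight_def inner_add_right)
  qed
  have "\<exists>\<alpha>\<ge>0. \<exists>\<beta>\<ge>0. u = \<alpha> *\<^sub>R E0 + \<beta> *\<^sub>R E1"
  proof -
    have tk: "\<theta> = of_int k * b + ph" by (simp add: ph_def)
    have uk: "u = kap * cis (of_int k * b) * cis ph" unfolding u\<theta> tk by (simp add: cis_mult)
    have uk': "u = (sin (b - ph) / sin b) *\<^sub>R (kap * cis (of_int k * b)) + (sin ph / sin b) *\<^sub>R (kap * cis (of_int k * b + b))"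
      unfolding uk comb by (simp add: algebra_simps cis_mult)
    have nn: "0 \<le> sin (b - ph) / sin b" "0 \<le> sin ph / sin b" using sp sin_b_pos by auto
    from si show ?thesis
    proof
      assume a: "s = 1 \<and> k = 2 * i"
      have "E0 = kap * cis (of_int k * b)" "E1 = kap * cis (of_int k * b + b)" unfolding E using a by simp_all
      thus ?thesis using uk' nn by metis
    next
      assume a: "s = -1 \<and> k + 1 = 2 * i"
      have "2 * of_int i = (of_int k + 1 :: real)" using a by linarith
      hence i2: "2 * of_int i * b = of_int k * b + b" by (simp add: distrib_right)
      have "E0 = kap * cis (of_int k * b + b)" "E1 = kap * cis (of_int k * b)" unfolding E i2 using a by simp_all
      thus ?thesis using uk' nn by (metis add.commute)
    qed
  qed
  moreover have "m \<in> Veech" unfolding m_def by (rule Veech_rotation)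
  ultimately have "farey (weight E0 E1) u m s 2"
    unfolding farey_def E0_def[symmetric] E1_def[symmetric] using s w n by simp
  thus ?thesis using that n by blast
qed

text \<open>Each step raises \<open>T\<close> by at least 1, so \<open>N\<close> is reached; the
  last step multiplies a value below \<open>N\<close> by at most \<open>2 / sin b\<close>.\<close>

lemma farey_ex:
  assumes W: "\<And>x y v w. W (x *\<^sub>R v + y *\<^sub>R w) = x * W v + y * W w" and f: "farey W u m s 2" and N: "2 < N"
  obtains m s T where "farey W u m s T" "N \<le> T" "T \<le> (2 / sin b) * N"
proof -
  have "(\<exists>m s T. farey W u m s T \<and> N \<le> T \<and> T \<le> (2 / sin b) * N) \<or> (\<exists>m s T. farey W u m s T \<and> real n \<le> T \<and> T < N)" for n
  proof (induction n)
    case 0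
    show ?case using f N by force
  next
    case (Suc n)
    show ?case
    proof (cases "\<exists>m s T. farey W u m s T \<and> N \<le> T \<and> T \<le> (2 / sin b) * N")
      case False
      then obtain m s T where T: "farey W u m s T" "real n \<le> T" "T < N" using Suc by blast
      obtain m' s' T' where T': "farey W u m' s' T'" "T + 1 \<le> T'" "T' \<le> (2 / sin b) * T" using farey_step[OF W T(1)] by blast
      have "(2 / sin b) * T \<le> (2 / sin b) * N" using T sin_b_pos by (intro mult_left_mono) auto
      hence "T' \<le> (2 / sin b) * N" using T' by linarith
      hence "T' < N" using False T'(1) by (meson not_le)
      moreover have "real (Suc n) \<le> T'" using T T' by simp
      ultimately show ?thesis using T'(1) by blast
    qed blast
  qed
  moreover obtain n :: nat where "N < real n" using reals_Archimedean2 by blast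
  ultimately have "\<exists>m s T. farey W u m s T \<and> N \<le> T \<and> T \<le> (2 / sin b) * N" by (meson less_le_trans less_asym)
  thus ?thesis using that by blast
qed

definition approx :: "real \<Rightarrow> complex set" where
  "approx N = {p. \<exists>m\<in>Veech. p = (1 / norm (m kap)) *\<^sub>R m kap \<and> m kap \<noteq> 0 \<and> (\<forall>z. norm (m z) \<le> N * norm z)}"

text \<open>In the basis \<open>ray s 0\<close>, \<open>ray s 1\<close> the coordinates of
  \<open>z\<close> are at most \<open>2 / sin b\<close> times its norm, and \<open>W\<close> bounds
  the images of the basis.\<close>

lemma farey_norm:
  assumes f: "farey W u m s T" shows "norm (m z) \<le> (2 / sin b) * T * norm z"
proof -
  from f have m: "m \<in> Veech" and s: "s = 1 \<or> s = -1" and n: "norm (m (ray s 0)) \<le> W (m (ray s 0))" "norm (m (ray s 1)) \<le> W (m (ray s 1))"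
    and T: "T = W (m (ray s 0)) + W (m (ray s 1))" unfolding farey_def by auto
  have lm: "linear m" by (rule Veech_linear[OF m])
  define z' where "z' = cnj kap * z"
  have zn: "norm z' = norm z" by (simp add: z'_def norm_mult)
  define q where "q = of_int s * Im z' / sin b"
  define p where "p = Re z' - q * cos b"
  have s2: "of_int s * (of_int s :: real) = 1" using s by auto
  have "z' = p *\<^sub>R 1 + q *\<^sub>R cis (of_int s * b)"
    using s sin_b_pos by (auto simp: complex_eq_iff p_def q_def)
  hence "kap * z' = p *\<^sub>R ray s 0 + q *\<^sub>R ray s 1" by (simp add: ray_def algebra_simps)
  hence z: "z = p *\<^sub>R ray s 0 + q *\<^sub>R ray s 1" unfolding z'_def mult.assoc[symmetric] kap_cnj by simp
  have qa: "\<bar>q\<bar> \<le> (1 / sin b) * norm z"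
  proof -
    have "\<bar>q\<bar> = \<bar>Im z'\<bar> / sin b" using s sin_b_pos by (auto simp: q_def abs_mult)
    also have "\<dots> \<le> norm z / sin b" using abs_Im_le_cmod[of z'] zn sin_b_pos by (intro divide_right_mono) auto
    finally show ?thesis by simp
  qed
  have sb: "1 \<le> 1 / sin b" using sin_b_pos by simp
  have pa: "\<bar>p\<bar> \<le> (2 / sin b) * norm z"
  proof -
    have "\<bar>p\<bar> \<le> \<bar>Re z'\<bar> + \<bar>q\<bar> * \<bar>cos b\<bar>" unfolding p_def by (metis abs_mult abs_triangle_ineq4)
    also have "\<bar>q\<bar> * \<bar>cos b\<bar> \<le> \<bar>q\<bar> * 1" by (intro mult_left_mono) auto
    also have "\<bar>Re z'\<bar> \<le> 1 * norm z" using abs_Re_le_cmod[of z'] zn by simp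
    also have "1 * norm z \<le> (1 / sin b) * norm z" using sb by (intro mult_right_mono) auto
    finally show ?thesis using qa by (simp add: add_divide_distrib)
  qed
  have qa': "\<bar>q\<bar> \<le> (2 / sin b) * norm z"
  proof -
    have "(1 / sin b) * norm z \<le> (2 / sin b) * norm z" using sin_b_pos by (intro mult_right_mono divide_right_mono) auto
    thus ?thesis using qa by linarith
  qed
  have "m z = p *\<^sub>R m (ray s 0) + q *\<^sub>R m (ray s 1)" using z lm by (simp add: linear_add linear_cmul)
  hence "norm (m z) \<le> \<bar>p\<bar> * norm (m (ray s 0)) + \<bar>q\<bar> * norm (m (ray s 1))"
    by (metis norm_scaleR norm_triangle_ineq)
  also have "\<dots> \<le> ((2 / sin b) * norm z) * W (m (ray s 0)) + ((2 / sin b) * norm z) * W (m (ray s 1))"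
    using n pa qa' sin_b_pos by (intro add_mono mult_mono) auto
  also have "\<dots> = (2 / sin b) * T * norm z" unfolding T by (simp add: algebra_simps add_divide_distrib)
  finally show ?thesis .
qed

definition approx_const :: real where "approx_const = 200 / sin b ^ 2"

text \<open>For a sector spanned by \<open>A\<close> and \<open>B\<close> the sine of the angle
  between \<open>A\<close> and \<open>u\<close> is the coefficient of \<open>B\<close> times their
  wedge over the norm of \<open>A\<close>. That coefficient is at most \<open>2 / W B\<close>, and
  the product of the weights is at least half their sum, whence an angle of order
  \<open>1 / N\<close>.\<close>

lemma approx_ubiquitous:
  assumes u: "norm u = 1" and N: "approx_const \<le> N"
  shows "\<exists>p\<in>approx N. dist p u \<le> approx_const / N"
proof -
  \<comment> \<open>Two factors \<open>2 / sin b\<close> will be lost, in overshooting the threshold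
    and in bounding the norm of \<open>m\<close>.\<close>
  define N0 where "N0 = N * sin b ^ 2 / 4"
  have N0: "50 \<le> N0" using N sin_b_pos by (simp add: N0_def approx_const_def field_simps)
  obtain E0 E1 m0 s0 where E: "norm E0 = 1" "norm E1 = 1" and f0: "farey (weight E0 E1) u m0 s0 2" using farey_init[OF u] .
  define W where "W = weight E0 E1"
  have Wl: "W (x *\<^sub>R v + y *\<^sub>R w) = x * W v + y * W w" for x y v w unfolding W_def by (rule weight_lin)
  have Wle: "W v \<le> 2 * norm v" for v unfolding W_def by (rule weight_le[OF E])
  obtain m s T where f: "farey W u m s T" and T: "N0 \<le> T" "T \<le> (2 / sin b) * N0"
    using farey_ex[of W u m0 s0 N0, OF Wl f0[folded W_def]] N0 by auto
  define A B where "A = m (ray s 0)" and "B = m (ray s 1)"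
  from f obtain \<alpha> \<beta> where m: "m \<in> Veech" and s: "s = 1 \<or> s = -1" and ab: "0 \<le> \<alpha>" "0 \<le> \<beta>" "u = \<alpha> *\<^sub>R A + \<beta> *\<^sub>R B"
    and WAB: "1 \<le> W A" "1 \<le> W B" "norm A \<le> W A" "norm B \<le> W B" and TW: "T = W A + W B"
    unfolding farey_def A_def B_def by blast
  have Ak: "A = m kap" by (simp add: A_def ray_def)
  have nA: "W A / 2 \<le> norm A" using Wle[of A] by simp
  hence nA0: "0 < norm A" using WAB by linarith
  have nAi: "1 / norm A \<le> 2 / W A" using nA nA0 WAB by (simp add: field_simps)
  have Wu: "\<alpha> * W A + \<beta> * W B \<le> 2" using Wle[of u] u unfolding ab(3) Wl by simp
  have "\<beta> * W B \<le> 2" using Wu mult_nonneg_nonneg[OF ab(1), of "W A"] WAB by linarith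
  hence be: "\<beta> \<le> 2 / W B" using WAB by (simp add: field_simps)
  have wAB: "\<bar>wedge A B\<bar> \<le> 1"
  proof -
    have "wedge A B = wedge (ray s 0) (ray s 1)" unfolding A_def B_def by (rule Veech_wedge[OF m])
    also have "\<bar>\<dots>\<bar> \<le> norm (ray s 0) * norm (ray s 1)" by (rule wedge_le)
    also have "\<dots> = 1" by (simp add: ray_def norm_mult)
    finally show ?thesis .
  qed
  define p where "p = (1 / norm A) *\<^sub>R A"
  have p: "norm p = 1" using nA0 by (simp add: p_def)
  \<comment> \<open>With both weights at least 1 the product is at least \<open>T - 1\<close>, and
    \<open>T\<close> is at least 2.\<close>
  have prod: "T / 2 \<le> W A * W B"
  proof -
    have "0 \<le> (W A - 1) * (W B - 1)" using WAB by (intro mult_nonneg_nonneg) auto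
    thus ?thesis unfolding TW using WAB by (simp add: algebra_simps)
  qed
  have T0: "0 < T" using T N0 by linarith
  have "\<bar>wedge p u\<bar> = (1 / norm A) * (\<beta> * \<bar>wedge A B\<bar>)"
    unfolding p_def wedge_scale ab(3) wedge_linear using ab by (simp add: abs_mult)
  also have "\<dots> \<le> (2 / W A) * ((2 / W B) * 1)"
    using nAi be wAB ab WAB nA0 by (intro mult_mono) auto
  also have "\<dots> = 4 / (W A * W B)" by simp
  also have "\<dots> \<le> 4 / (T / 2)" using prod T0 by (intro divide_left_mono) auto
  finally have wpu: "\<bar>wedge p u\<bar> \<le> 8 / T" by simp
  have "8 / T \<le> 8 / N0" using T N0 by (intro divide_left_mono) auto
  hence wpu': "2 * \<bar>wedge p u\<bar> \<le> 16 / N0" using wpu by linarith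
  \<comment> \<open>The wedge determines the direction only up to sign. The opposite sign is
    impossible: \<open>W\<close> is at least 1 at \<open>p\<close> and nonnegative at
    \<open>u\<close>, but would be below 1 at their short sum.\<close>
  have "norm (p - u) \<le> 16 / N0"
  proof (rule disjE[OF unit_dist_wedge[OF p u]])
    assume "norm (p + u) \<le> 2 * \<bar>wedge p u\<bar>"
    hence n: "norm (p + u) \<le> 16 / N0" using wpu' by linarith
    have "16 / N0 \<le> 16 / 50" using N0 by (intro divide_left_mono) auto
    hence "W (1 *\<^sub>R p + 1 *\<^sub>R u) < 1" using Wle[of "1 *\<^sub>R p + 1 *\<^sub>R u"] n by simp
    moreover have "1 \<le> W p"
    proof -
      have "W ((1 / norm A) *\<^sub>R A + 0 *\<^sub>R A) = (1 / norm A) * W A" unfolding Wl by simp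
      hence "W p = W A / norm A" by (simp add: p_def)
      thus ?thesis using WAB nA0 by simp
    qed
    moreover have "0 \<le> W u" unfolding ab(3) Wl using ab WAB by (intro add_nonneg_nonneg mult_nonneg_nonneg) auto
    ultimately show ?thesis unfolding Wl by simp
  qed (use wpu' in linarith)
  moreover have "16 / N0 \<le> approx_const / N"
    using N sin_b_pos by (simp add: N0_def approx_const_def field_simps)
  ultimately have "dist p u \<le> approx_const / N" by (simp add: dist_norm)
  moreover have "p \<in> approx N"
  proof -
    have "norm (m z) \<le> N * norm z" for z
    proof -
      have "(2 / sin b) * T \<le> (2 / sin b) * ((2 / sin b) * N0)" using T sin_b_pos by (intro mult_left_mono) auto
      also have "\<dots> = N" using sin_b_pos by (simp add: N0_def power2_eq_square)
      finally have "(2 / sin b) * T * norm z \<le> N * norm z" by (rule mult_right_mono) simp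
      thus ?thesis using farey_norm[OF f, of z] by linarith
    qed
    thus ?thesis unfolding approx_def p_def Ak using m nA0 Ak by auto
  qed
  ultimately show ?thesis by blast
qed

section \<open>A criterion for rigidity\<close>

lemma pre_image: "B \<subseteq> P0 \<Longrightarrow> pre (proj d ` B) = B"
proof (intro equalityI subsetI)
  fix p assume B: "B \<subseteq> P0" and "p \<in> pre (proj d ` B)"
  then obtain q where q: "p \<in> P" "q \<in> B" "proj d p = proj d q" by (auto simp: pre_def)
  hence "proj d p = {q}" using P0_proj B by auto
  thus "p \<in> B" using proj_self[OF q(1)] q(2) by auto
qed (use P0_P in \<open>auto simp: pre_def\<close>)

lemma image_sets: "B \<subseteq> P0 \<Longrightarrow> B \<in> sets borel \<Longrightarrow> proj d ` B \<in> sets M"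
  unfolding sets_M_iff using pre_image P0_P proj_in_surface by auto

lemma measure_M: "E \<in> sets M \<Longrightarrow> measure M E = measure lborel (pre E) / measure lborel P"
proof -
  assume E: "E \<in> sets M"
  interpret prob_space M by (rule prob_space_M)
  have fin: "emeasure lborel (pre E) \<noteq> \<infinity>"
    using emeasure_mono[of "pre E" P lborel] emeasure_P(2) by (auto simp: pre_def top_unique)
  have "ennreal (measure M E) = ennreal (measure lborel (pre E)) / ennreal (measure lborel P)"
    using emeasure_M[OF E] fin emeasure_P by (simp add: emeasure_eq_measure emeasure_eq_ennreal_measure)
  also have "\<dots> = ennreal (measure lborel (pre E) / measure lborel P)"
    using emeasure_P by (intro divide_ennreal) (auto simp: measure_def enn2real_positive_iff less_top zero_less_iff_neq_zero)
  finally show ?thesis by simp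
qed

lemma measure_P_pos: "0 < measure lborel P"
  using emeasure_P by (simp add: measure_def enn2real_positive_iff less_top zero_less_iff_neq_zero)

lemma measure_M_image: "B \<subseteq> P0 \<Longrightarrow> B \<in> sets borel \<Longrightarrow> measure M (proj d ` B) = measure lborel B / measure lborel P"
  using measure_M[OF image_sets] pre_image by simp

lemma measure_P0: "measure lborel P0 = measure lborel P"
proof -
  have "P = P0 \<union> (P - P0)" using P0_P by auto
  moreover have "emeasure lborel (P0 \<union> (P - P0)) = emeasure lborel P0"
    using boundary_null by (intro emeasure_Un_null_set) auto
  ultimately show ?thesis by (simp add: measure_def)
qed

lemma emeasure_sub_P0: "B \<subseteq> P0 \<Longrightarrow> emeasure lborel B \<noteq> \<infinity>"
proof -
  assume "B \<subseteq> P0"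
  hence "emeasure lborel B \<le> emeasure lborel P" using P0_P by (intro emeasure_mono) auto
  thus ?thesis using emeasure_P(2) by (auto simp: top_unique)
qed

text \<open>Continuity of measure gives the limit along \<open>1 / (k + 1)\<close>, and monotonicity
  of \<open>B\<close> transfers it to any positive null sequence.\<close>

lemma exhaust_tendsto:
  assumes B: "\<And>x. 0 < x \<Longrightarrow> B x \<subseteq> P0" "\<And>x. B x \<in> sets borel" "\<And>x y. 0 < x \<Longrightarrow> x \<le> y \<Longrightarrow> B y \<subseteq> B x"
    and N: "N \<in> null_sets lborel" "P0 - N \<subseteq> (\<Union>k. B (1 / real (Suc k)))"
    and e: "e \<longlonglongrightarrow> 0" "\<And>k. 0 < e k"
  shows "(\<lambda>k. measure M (proj d ` B (e k))) \<longlonglongrightarrow> 1"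
proof -
  interpret prob_space M by (rule prob_space_M)
  define C where "C k = B (1 / real (Suc k))" for k
  have CP: "C k \<subseteq> P0" for k unfolding C_def by (rule B(1)) simp
  have UP: "(\<Union>k. C k) \<subseteq> P0" using CP by blast
  have Cb: "C k \<in> sets lborel" for k using B(2) by (simp add: C_def)
  have "incseq C" unfolding C_def by (intro incseq_SucI B(3)) (auto simp: field_simps)
  moreover have "range C \<subseteq> sets lborel" using Cb by auto
  ultimately have "(\<lambda>k. measure lborel (C k)) \<longlonglongrightarrow> measure lborel (\<Union>k. C k)"
    using emeasure_sub_P0[OF UP] by (intro Lim_measure_incseq) auto
  also have "measure lborel (\<Union>k. C k) = measure lborel P0"
  proof -
    have UB: "(\<Union>k. C k) \<in> sets lborel" using Cb by auto
    have "emeasure lborel P0 \<le> emeasure lborel ((\<Union>k. C k) \<union> N)"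
      using N(2) UB N(1) unfolding C_def by (intro emeasure_mono) auto
    also have "\<dots> = emeasure lborel (\<Union>k. C k)" using N(1) UB by (intro emeasure_Un_null_set) auto
    finally have "emeasure lborel (\<Union>k. C k) = emeasure lborel P0"
      using emeasure_mono[OF UP, of lborel] by (simp add: antisym)
    thus ?thesis by (simp add: measure_def)
  qed
  finally have lim: "(\<lambda>k. measure lborel (C k) / measure lborel P) \<longlonglongrightarrow> measure lborel P0 / measure lborel P"
    by (intro tendsto_divide tendsto_const) (use measure_P_pos in auto)
  have "(\<lambda>k. measure M (proj d ` B (1 / real (Suc k)))) \<longlonglongrightarrow> 1"
    using lim measure_M_image[OF CP] Cb measure_P_pos unfolding measure_P0 C_def by simp
  hence lim': "(\<lambda>k. (\<lambda>x. if 0 < x then measure M (proj d ` B x) else 1) (1 / real (Suc k))) \<longlonglongrightarrow> 1" by simp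
  have "(\<lambda>k. (\<lambda>x. if 0 < x then measure M (proj d ` B x) else 1) (e k)) \<longlonglongrightarrow> 1"
  proof (rule antitone_tendsto[OF _ _ lim' e])
    fix x y :: real assume xy: "0 < x" "x \<le> y"
    hence "measure M (proj d ` B y) \<le> measure M (proj d ` B x)"
      using B by (intro finite_measure_mono image_mono image_sets) auto
    thus "(if 0 < y then measure M (proj d ` B y) else 1) \<le> (if 0 < x then measure M (proj d ` B x) else 1)" using xy by simp
  qed (simp add: prob_le_1)
  thus ?thesis using e(2) by simp
qed

definition inner_part :: "real \<Rightarrow> complex set" where
  "inner_part e = {p \<in> P. \<forall>k<2*d. nrm k \<bullet> p < cos b - e}"

definition off_levels :: "real \<Rightarrow> complex set" where
  "off_levels r = {p \<in> P0. \<forall>i<d. r < \<bar>Yc p - sy i\<bar>}"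

lemma inner_part_P0: "0 < e \<Longrightarrow> inner_part e \<subseteq> P0"
  unfolding inner_part_def P0_def by force

lemma inner_part_move:
  assumes e: "0 < e" and p: "p \<in> inner_part e" and v: "norm v \<le> e" shows "p + v \<in> P0"
proof -
  have h: "nrm k \<bullet> (p + v) < cos b" if "k < 2 * d" for k
  proof -
    have "nrm k \<bullet> v \<le> norm (nrm k) * norm v" by (rule norm_cauchy_schwarz)
    also have "\<dots> \<le> e" using v by simp
    finally have "nrm k \<bullet> v \<le> e" .
    moreover have "nrm k \<bullet> p < cos b - e" using p that by (simp add: inner_part_def)
    ultimately show ?thesis by (simp add: inner_add_right)
  qed
  thus ?thesis unfolding P0_eq' by auto
qed

lemma inner_part_borel: "inner_part x \<in> sets borel"
proof -
  have "0 \<in> {..<2*d}" using d_ge by simp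
  hence ne: "{..<2*d} \<noteq> {}" by blast
  have "inner_part x = P \<inter> (\<Inter>k\<in>{..<2*d}. {p. nrm k \<bullet> p < cos b - x})" by (auto simp: inner_part_def)
  also have "\<dots> \<in> sets borel" using ne by (intro sets.Int P_borel sets.finite_INT) (auto intro: borel_open open_halfspace_lt)
  finally show ?thesis .
qed

lemma inner_part_tendsto:
  assumes e: "e \<longlonglongrightarrow> 0" "\<And>k. 0 < e k" shows "(\<lambda>k. measure M (proj d ` inner_part (e k))) \<longlonglongrightarrow> 1"
proof (rule exhaust_tendsto[OF inner_part_P0 _ _ _ _ e])
  show "inner_part x \<in> sets borel" for x by (rule inner_part_borel)
  show "inner_part y \<subseteq> inner_part x" if "x \<le> y" for x y using that by (force simp: inner_part_def)
  show "{} \<in> null_sets lborel" by simp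
  show "P0 - {} \<subseteq> (\<Union>k. inner_part (1 / real (Suc k)))"
  proof
    fix p assume "p \<in> P0 - {}"
    hence p: "p \<in> P" "\<And>k. nrm k \<bullet> p < cos b" using P0_nrm P0_P by auto
    define m where "m = Min ((\<lambda>k. cos b - nrm k \<bullet> p) ` {..<2*d})"
    have "0 \<in> {..<2*d}" using d_ge by simp
    hence ne: "{..<2*d} \<noteq> {}" by blast
    have "m \<in> (\<lambda>k. cos b - nrm k \<bullet> p) ` {..<2*d}" unfolding m_def using ne by (intro Min_in) auto
    hence "0 < m" using p(2) by auto
    then obtain k where k: "inverse (real (Suc k)) < m" using reals_Archimedean by blast
    have "p \<in> inner_part (1 / real (Suc k))"
    proof -
      have "nrm i \<bullet> p < cos b - 1 / real (Suc k)" if "i < 2 * d" for i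
      proof -
        have "m \<le> cos b - nrm i \<bullet> p" unfolding m_def using that by (intro Min_le) auto
        moreover have "1 / real (Suc k) < m" using k by (simp add: inverse_eq_divide)
        ultimately show ?thesis by linarith
      qed
      thus ?thesis using p by (simp add: inner_part_def)
    qed
    thus "p \<in> (\<Union>k. inner_part (1 / real (Suc k)))" by blast
  qed
qed

lemma off_levels_borel: "off_levels x \<in> sets borel"
  unfolding off_levels_def by measurable

lemma off_levels_tendsto:
  assumes e: "e \<longlonglongrightarrow> 0" "\<And>k. 0 < e k" shows "(\<lambda>k. measure M (proj d ` off_levels (e k))) \<longlonglongrightarrow> 1"
proof (rule exhaust_tendsto[OF _ _ _ _ _ e])
  show "off_levels x \<subseteq> P0" for x by (auto simp: off_levels_def)
  show "off_levels x \<in> sets borel" for x by (rule off_levels_borel)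
  show "off_levels y \<subseteq> off_levels x" if "x \<le> y" for x y using that by (force simp: off_levels_def)
  have Y: "Yc p = (kap * \<i>) \<bullet> p" for p
    by (subst (2) XY_local[of p], unfold kap_inner) (simp add: inner_complex_def)
  show "(\<Union>i<d. {p. (kap * \<i>) \<bullet> p = sy i}) \<in> null_sets lborel"
    by (intro null_sets_UN' line_null) auto
  show "P0 - (\<Union>i<d. {p. (kap * \<i>) \<bullet> p = sy i}) \<subseteq> (\<Union>k. off_levels (1 / real (Suc k)))"
  proof
    fix p assume p: "p \<in> P0 - (\<Union>i<d. {p. (kap * \<i>) \<bullet> p = sy i})"
    define m where "m = Min ((\<lambda>i. \<bar>Yc p - sy i\<bar>) ` {..<d})"
    have "0 \<in> {..<d}" using d_ge by simp
    hence ne: "{..<d} \<noteq> {}" by blast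
    have "m \<in> (\<lambda>i. \<bar>Yc p - sy i\<bar>) ` {..<d}" unfolding m_def using ne by (intro Min_in) auto
    hence "0 < m" using p by (auto simp: Y[symmetric])
    then obtain k where k: "inverse (real (Suc k)) < m" using reals_Archimedean by blast
    have "1 / real (Suc k) < \<bar>Yc p - sy i\<bar>" if "i < d" for i
    proof -
      have "m \<le> \<bar>Yc p - sy i\<bar>" unfolding m_def using that by (intro Min_le) auto
      thus ?thesis using k by (simp add: inverse_eq_divide)
    qed
    hence "p \<in> off_levels (1 / real (Suc k))" using p by (simp add: off_levels_def)
    thus "p \<in> (\<Union>k. off_levels (1 / real (Suc k)))" by blast
  qed
qed

text \<open>Approximate the lift of \<open>A\<close> by a compact set inside and an open set
  outside. A point of the compact set that returns closer than the gap stays in the open set, so it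
  can leave \<open>A\<close> only by entering the small difference, whose preimage under the flow is
  equally small.\<close>

lemma rigid_criterion:
  assumes u: "transverse u" and Q: "filterlim Q at_top sequentially"
    and Z: "\<And>n. Z n \<in> sets M" "(\<lambda>n. measure M (Z n)) \<longlonglongrightarrow> 1"
    and e: "e \<longlonglongrightarrow> 0"
    and close: "\<And>n x. x \<in> Z n \<Longrightarrow> \<exists>p\<in>P0. \<exists>q\<in>P0. x = proj d p \<and> linear_flow d u (Q n) x = proj d q \<and> dist p q \<le> e n"
  shows "rigid_flow M (linear_flow d u)"
proof -
  interpret prob_space M by (rule prob_space_M)
  have pres: "preserving (linear_flow d u t)" for t by (rule linear_flow_preserving[OF u])
  have meas: "linear_flow d u t -` E \<inter> surface d \<in> sets M" if "E \<in> sets M" for t E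
    using measurable_sets[of "linear_flow d u t" M M E] pres[of t] that by (simp add: preserving_def)
  have pm: "prob (linear_flow d u t -` E \<inter> surface d) = prob E" if "E \<in> sets M" for t E
    using pres[of t] that by (simp add: preserving_def measure_def)
  \<comment> \<open>Points leaving and points entering \<open>A\<close> have equal measure because
    the flow preserves it.\<close>
  have diff: "prob (sym_diff (linear_flow d u t ` A) A) = 2 * prob {x \<in> A. linear_flow d u t x \<notin> A}" if A: "A \<in> sets M" for t A
  proof -
    define A' where "A' = linear_flow d u t ` A"
    have As: "A \<subseteq> surface d" using A by (simp add: sets_M_iff)
    have im: "linear_flow d u t ` B = linear_flow d u (- t) -` B \<inter> surface d" if "B \<subseteq> surface d" for B
    proof (intro equalityI subsetI)
      fix y assume "y \<in> linear_flow d u (- t) -` B \<inter> surface d"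
      hence "linear_flow d u (- t) y \<in> B" by simp
      moreover have "y = linear_flow d u t (linear_flow d u (- t) y)" by (simp add: linear_flow_inverse)
      ultimately show "y \<in> linear_flow d u t ` B" by (rule rev_image_eqI)
    qed (use that linear_flow_surface in \<open>auto simp: linear_flow_inverse\<close>)
    have A'm: "A' \<in> sets M" unfolding A'_def im[OF As] by (rule meas[OF A])
    have pA': "prob A' = prob A" unfolding A'_def im[OF As] by (rule pm[OF A])
    define B where "B = {x \<in> A. linear_flow d u t x \<notin> A}"
    have B: "B = A - (linear_flow d u t -` A \<inter> surface d)" using As by (auto simp: B_def)
    have Bm: "B \<in> sets M" unfolding B using A meas[OF A] by auto
    have "A' - A = linear_flow d u t ` B" unfolding A'_def B_def by auto
    also have "\<dots> = linear_flow d u (- t) -` B \<inter> surface d" by (rule im) (use As in \<open>auto simp: B_def\<close>)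
    finally have p1: "prob (A' - A) = prob B" using pm[OF Bm] by simp
    have "prob A' = prob (A' - A) + prob (A' \<inter> A)"
      using finite_measure_Diff'[OF A'm A] by simp
    moreover have "prob A = prob (A - A') + prob (A \<inter> A')"
      using finite_measure_Diff'[OF A A'm] by simp
    ultimately have p2: "prob (A - A') = prob (A' - A)" using pA' by (simp add: Int_commute)
    have "prob (sym_diff A' A) = prob (A' - A) + prob (A - A')"
      using A A'm by (subst finite_measure_Union) auto
    thus ?thesis using p1 p2 unfolding A'_def B_def by simp
  qed
  have "(\<lambda>n. prob (sym_diff (linear_flow d u (Q n) ` A) A)) \<longlonglongrightarrow> 0" if A: "A \<in> sets M" for A
  proof (rule LIMSEQ_I)
    fix r :: real assume r: "0 < r"
    define a where "a = measure lborel P"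
    have a: "0 < a" unfolding a_def by (rule measure_P_pos)
    \<comment> \<open>Losses of at most \<open>r / 6\<close> outside \<open>Z n\<close> and twice
      \<open>r / 12\<close> after normalization by the area \<open>a\<close> add up to less than
      \<open>r / 2\<close>, which \<open>diff\<close> doubles.\<close>
    define h where "h = r * a / 12"
    have h: "0 < h" using r a by (simp add: h_def)
    define A0 where "A0 = pre A \<inter> P0"
    have A0: "A0 \<in> sets borel" "A0 \<subseteq> P0" using A by (auto simp: A0_def sets_M_iff)
    obtain U where U: "open U" "A0 \<subseteq> U" "emeasure lborel (U - A0) < ennreal h"
      using outer_regular_lborel[OF A0(1) h] by blast
    have PA: "P - A0 \<in> sets borel" using A0 by auto
    \<comment> \<open>Outer regularity of the complement within the compact polygon supplies the
      compact set inside.\<close>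
    obtain U' where U': "open U'" "P - A0 \<subseteq> U'" "emeasure lborel (U' - (P - A0)) < ennreal h"
      using outer_regular_lborel[OF PA h] by blast
    define K where "K = P - U'"
    have K: "compact K" unfolding K_def using compact_P U'(1) by (rule compact_diff)
    have KA: "K \<subseteq> A0" using U'(2) by (auto simp: K_def)
    have "\<exists>s>0. \<forall>x\<in>K. \<forall>y\<in>- U. s \<le> dist x y"
      by (rule separate_compact_closed[OF K]) (use U KA in \<open>auto simp: closed_Compl\<close>)
    then obtain s where s: "0 < s" "\<And>x y. x \<in> K \<Longrightarrow> y \<notin> U \<Longrightarrow> s \<le> dist x y" by blast
    define E1 where "E1 = A0 - K"
    define E2 where "E2 = (U - A0) \<inter> P0"
    have E1: "E1 \<subseteq> P0" "E1 \<in> sets borel" using A0 K by (auto simp: E1_def borel_compact)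
    have E2: "E2 \<subseteq> P0" "E2 \<in> sets borel" using A0 U by (auto simp: E2_def)
    have small: "measure lborel B \<le> h" if "B \<subseteq> C" "C \<in> sets lborel" "emeasure lborel C < ennreal h" for B C
    proof -
      have "emeasure lborel B \<le> ennreal h" using emeasure_mono[OF that(1,2)] that(3) by simp
      thus ?thesis using h by (simp add: measure_def enn2real_leI)
    qed
    have m1: "measure lborel E1 \<le> h"
      by (rule small[OF _ _ U'(3)]) (use A0 P0_P U' PA in \<open>auto simp: E1_def K_def\<close>)
    have m2: "measure lborel E2 \<le> h"
      by (rule small[OF _ _ U(3)]) (use A0 U in \<open>auto simp: E2_def\<close>)
    have "eventually (\<lambda>n. e n < s) sequentially" using e s by (intro order_tendstoD(2)) auto
    moreover have "eventually (\<lambda>n. 1 - r / 6 < prob (Z n)) sequentially" using Z(2) r by (intro order_tendstoD(1)) auto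
    ultimately have "eventually (\<lambda>n. norm (prob (sym_diff (linear_flow d u (Q n) ` A) A) - 0) < r) sequentially"
    proof eventually_elim
      case (elim n)
      let ?S = "linear_flow d u (Q n)"
      define F where "F = (surface d - Z n) \<union> proj d ` E1 \<union> (?S -` (proj d ` E2) \<inter> surface d)"
      have Em: "proj d ` E1 \<in> sets M" "proj d ` E2 \<in> sets M" using image_sets E1 E2 by auto
      have Cm: "surface d - Z n \<in> sets M" using sets.compl_sets[OF Z(1)[of n]] by simp
      have sub: "{x \<in> A. ?S x \<notin> A} \<subseteq> F"
      proof
        fix x assume x: "x \<in> {x \<in> A. ?S x \<notin> A}"
        have xs: "x \<in> surface d" using x A by (auto simp: sets_M_iff)
        show "x \<in> F"
        proof (cases "x \<in> Z n")
          case True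
          from close[OF this] obtain p q where pq: "p \<in> P0" "q \<in> P0" "x = proj d p" "?S x = proj d q" "dist p q \<le> e n" by blast
          have pA: "p \<in> A0" using pq x P0_P by (auto simp: A0_def pre_def)
          show ?thesis
          proof (cases "p \<in> K")
            case True
            have "q \<in> U" using s(2)[OF True] pq(5) elim(1) by (meson not_le order_trans)
            moreover have "q \<notin> A0" using x pq by (auto simp: A0_def pre_def)
            ultimately have "q \<in> E2" using pq by (simp add: E2_def)
            thus ?thesis using pq xs by (auto simp: F_def)
          qed (use pA pq in \<open>auto simp: F_def E1_def\<close>)
        qed (use xs in \<open>auto simp: F_def\<close>)
      qed
      have Fm: "F \<in> sets M" unfolding F_def using Em Cm meas[OF Em(2)] by auto
      have "prob {x \<in> A. ?S x \<notin> A} \<le> prob F" by (rule finite_measure_mono[OF sub Fm])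
      also have "\<dots> \<le> prob (surface d - Z n) + prob (proj d ` E1) + prob (?S -` (proj d ` E2) \<inter> surface d)"
        unfolding F_def using Em Cm meas[OF Em(2)]
        by (intro order_trans[OF measure_Un_le] add_right_mono measure_Un_le) auto
      also have "prob (surface d - Z n) = 1 - prob (Z n)" using prob_compl[OF Z(1)[of n]] by simp
      also have "prob (?S -` (proj d ` E2) \<inter> surface d) = prob (proj d ` E2)" by (rule pm[OF Em(2)])
      also have "prob (proj d ` E1) \<le> h / a" unfolding measure_M_image[OF E1] a_def[symmetric] using m1 a by (intro divide_right_mono) auto
      also have "prob (proj d ` E2) \<le> h / a" unfolding measure_M_image[OF E2] a_def[symmetric] using m2 a by (intro divide_right_mono) auto
      also have "h / a = r / 12" using a by (simp add: h_def)
      finally have "prob {x \<in> A. ?S x \<notin> A} < r / 2" using elim(2) r by simp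
      thus ?case unfolding diff[OF A] by simp
    qed
    thus "\<exists>no. \<forall>n\<ge>no. norm (prob (sym_diff (linear_flow d u (Q n) ` A) A) - 0) < r"
      by (simp add: eventually_sequentially)
  qed
  thus ?thesis unfolding rigid_flow_def using prob_space_M linear_flow_measure_preserving[OF u] Q by auto
qed

section \<open>Rigid directions\<close>

lemma wd_le: "wd j \<le> 2"
proof -
  have "sx j \<le> 1" "sx (j + 1) \<le> 1" unfolding sx_def by (rule sin_le_one)+
  thus ?thesis unfolding wd_def by linarith
qed

text \<open>In the plane an area-preserving linear map and its inverse have the same norm: the
  squared length of \<open>v\<close> is its wedge with \<open>\<i> * v\<close>, which may be
  evaluated after applying \<open>m\<close>.\<close>

lemma affine_aut_norm_inverse:
  assumes a: "affine_aut m \<phi> m' \<psi>" and N: "\<And>z. norm (m z) \<le> N * norm z" shows "norm (m' z) \<le> N * norm z"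
proof (cases "m' z = 0")
  case True
  have "norm (m 1) \<le> N * 1" using N[of 1] by simp
  hence "0 \<le> N" using norm_ge_zero[of "m 1"] by linarith
  thus ?thesis using True by simp
next
  case False
  define v where "v = m' z"
  have mv: "m v = z" using a by (simp add: v_def affine_aut_def)
  have "norm v ^ 2 = wedge v (\<i> * v)"
    unfolding cmod_power2 wedge_def by (simp add: power2_eq_square)
  also have "\<dots> = wedge z (m (\<i> * v))" using a mv by (metis affine_aut_def)
  also have "\<dots> \<le> norm z * norm (m (\<i> * v))" using wedge_le[of z "m (\<i> * v)"] by linarith
  also have "\<dots> \<le> norm z * (N * norm v)" using N[of "\<i> * v"] by (intro mult_left_mono) (simp_all add: norm_mult)
  finally have "norm v * norm v \<le> (N * norm z) * norm v" by (simp add: power2_eq_square mult_ac)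
  thus ?thesis using False by (simp add: v_def)
qed

lemma wedge_kap: "wedge kap z = Yc z" by (simp add: wedge_def Yc_def)

text \<open>Dirichlet's theorem for the ratios of the circumferences. The additional factor
  \<open>n ^ 2\<close> makes the common near-period large even if the denominator \<open>q\<close>
  is small, and is paid for by the accuracy \<open>n ^ -4\<close>.\<close>

lemma simultaneous_period:
  assumes n: "0 < n"
  obtains T :: real and z :: "nat \<Rightarrow> int" where "2 * wd 0 * real n ^ 2 \<le> T" "T \<le> 4 * real n ^ (4 * d + 2)"
    "\<And>j. j + 1 < d \<Longrightarrow> \<bar>T - 2 * of_int (z j) * wd j\<bar> \<le> 4 / real n ^ 2"
proof -
  have w0: "0 < wd 0" using wd_pos[of 0] d_ge by simp
  have nn: "0 < n ^ 4" using n by simp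
  obtain q p where q: "0 < q" "q \<le> int ((n ^ 4) ^ d)"
    and p: "\<And>i. i < d \<Longrightarrow> \<bar>of_int q * (wd 0 / wd i) - of_int (p i)\<bar> < 1 / real (n ^ 4)"
    using Dirichlet_approx_simult[OF nn, of d "\<lambda>i. wd 0 / wd i"] by blast
  define r where "r = real n ^ 2"
  have r: "0 < r" using n by (simp add: r_def)
  define T where "T = r * of_int q * (2 * wd 0)"
  have q1: "1 \<le> (of_int q :: real)" using q(1) by simp
  have q2: "of_int q \<le> real n ^ (4 * d)"
  proof -
    have "of_int q \<le> (of_int (int ((n ^ 4) ^ d)) :: real)" using q(2) by (simp only: of_int_le_iff)
    thus ?thesis by (simp add: power_mult)
  qed
  show ?thesis
  proof (rule that[of T "\<lambda>j. int (n ^ 2) * p j"])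
    have "r * 1 * (2 * wd 0) \<le> T" unfolding T_def using r q1 w0 by (intro mult_right_mono mult_left_mono) auto
    thus "2 * wd 0 * real n ^ 2 \<le> T" by (simp add: r_def mult_ac)
    have "T \<le> r * real n ^ (4 * d) * 4"
      unfolding T_def using r q1 q2 w0 wd_le[of 0] by (intro mult_mono) auto
    also have "r * real n ^ (4 * d) * 4 = 4 * real n ^ (4 * d + 2)"
      unfolding r_def by (simp add: power_add power2_eq_square)
    finally show "T \<le> 4 * real n ^ (4 * d + 2)" .
    fix j assume j: "j + 1 < d"
    have w: "0 < wd j" using wd_pos j by simp
    have "T - 2 * of_int (int (n ^ 2) * p j) * wd j = 2 * wd j * r * (of_int q * (wd 0 / wd j) - of_int (p j))"
      using w by (simp add: T_def r_def field_simps)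
    hence "\<bar>T - 2 * of_int (int (n ^ 2) * p j) * wd j\<bar> = 2 * wd j * r * \<bar>of_int q * (wd 0 / wd j) - of_int (p j)\<bar>"
      using w r by (simp add: abs_mult)
    also have "\<dots> \<le> 2 * 2 * r * (1 / real (n ^ 4))"
      using p[of j] j wd_le[of j] w r by (intro mult_mono) auto
    also have "\<dots> = 4 / real n ^ 2" using n by (simp add: r_def field_simps power_add[symmetric])
    finally show "\<bar>T - 2 * of_int (int (n ^ 2) * p j) * wd j\<bar> \<le> 4 / real n ^ 2" .
  qed
qed

lemma off_levels_Pt:
  assumes p: "p \<in> off_levels r" and r: "0 \<le> r"
  obtains j a t where "j + 1 < d" "0 < t" "t < 1" "r < t * ht j" "r < (1 - t) * ht j" "\<bar>a\<bar> \<le> hw j t" "p = Pt j a t"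
proof -
  have pP: "p \<in> P" using p P0_P by (auto simp: off_levels_def)
  obtain j a t where j: "j + 1 < d" "0 \<le> t" "t \<le> 1" "\<bar>a\<bar> \<le> hw j t" "p = Pt j a t" using P_strip[OF pP] .
  have h: "0 < ht j" by (rule ht_pos[OF j(1)])
  have "r < \<bar>Yc p - sy j\<bar>" "r < \<bar>Yc p - sy (j + 1)\<bar>" using p j by (auto simp: off_levels_def)
  moreover have "Yc p - sy j = t * ht j" "Yc p - sy (j + 1) = - ((1 - t) * ht j)"
    unfolding j(5) Yc_Pt by (simp_all add: ht_def algebra_simps)
  moreover have "0 \<le> t * ht j" "0 \<le> (1 - t) * ht j" using j h by auto
  ultimately have a: "r < t * ht j" "r < (1 - t) * ht j" by auto
  have "t \<noteq> 0" "t \<noteq> 1" using a r by auto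
  thus ?thesis using that[of j t a] j a by simp
qed

text \<open>The affine automorphism \<open>\<psi>\<close> turns the trajectory into one that stays in a single horizontal
  cylinder, where its endpoint is known explicitly.\<close>

lemma close_return:
  assumes a: "affine_aut m \<phi> m' \<psi>" and n: "0 < n" "2 * c \<le> real n" and c: "0 \<le> c"
    and mn: "\<And>z. norm (m z) \<le> real n * norm z" and m0: "m kap \<noteq> 0"
    and u: "norm u = 1" and up: "norm (u - (1 / norm (m kap)) *\<^sub>R m kap) \<le> c / real n ^ (4 * d + 7)"
    and e: "(4 + 8 * c) / real n \<le> e" "0 < e" and r: "8 * c / real n \<le> r" "0 \<le> r"
  obtains Q where "2 * wd 0 * real n \<le> Q"
    "\<And>x. x \<in> proj d ` inner_part e \<inter> (\<psi> -` (proj d ` off_levels r) \<inter> surface d) \<Longrightarrow>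
      \<exists>p\<in>P0. \<exists>q\<in>P0. x = proj d p \<and> linear_flow d u Q x = proj d q \<and> dist p q \<le> e"
proof -
  define R where "R = real n"
  have R: "1 \<le> R" using n by (simp add: R_def)
  define tau where "tau = 4 * d + 7"
  have af: "affine_map m \<phi>" "affine_map m' \<psi>" and inv: "\<And>z. m' (m z) = z" "\<And>z. m (m' z) = z"
    and inv': "\<And>x. x \<in> surface d \<Longrightarrow> \<phi> (\<psi> x) = x"
    using a by (auto simp: affine_aut_def)
  have lin: "linear m'" "linear m" using af by (auto simp: affine_map_def)
  define v where "v = m' u"
  have mv: "m v = u" by (simp add: v_def inv)
  have vR: "norm v \<le> R" using affine_aut_norm_inverse[OF a mn, of u] u by (simp add: v_def R_def)
  have v1: "1 / R \<le> norm v" using mn[of v] u R unfolding mv R_def[symmetric] by (simp add: field_simps)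
  \<comment> \<open>As wedges are preserved, the vertical part of the pulled-back velocity is the
    wedge of \<open>m kap\<close> with \<open>u\<close>, small because \<open>u\<close> is nearly
    parallel to \<open>m kap\<close>.\<close>
  have Yv: "\<bar>Yc v\<bar> \<le> R * (c / R ^ tau)"
  proof -
    define p where "p = (1 / norm (m kap)) *\<^sub>R m kap"
    have "m kap = norm (m kap) *\<^sub>R p" using m0 by (simp add: p_def)
    have wpp: "wedge p p = 0" by simp
    have "Yc v = wedge (m kap) (m v)" using a unfolding wedge_kap[symmetric] by (simp add: affine_aut_def)
    also have "\<dots> = norm (m kap) * wedge p u" unfolding mv by (subst \<open>m kap = _\<close>) (rule wedge_scale)
    also have "wedge p u = wedge p (u - p)"
      using wedge_linear[of p 1 u "-1" p] wpp by simp
    finally have "\<bar>Yc v\<bar> = norm (m kap) * \<bar>wedge p (u - p)\<bar>" by (simp add: abs_mult)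
    also have "\<dots> \<le> R * (norm p * norm (u - p))"
      using mn[of kap] wedge_le[of p "u - p"] R by (intro mult_mono) (auto simp: R_def)
    also have "\<dots> \<le> R * (1 * (c / R ^ tau))"
    proof -
      have "norm p = 1" using m0 by (simp add: p_def)
      thus ?thesis using up R unfolding p_def[symmetric] R_def[symmetric] tau_def[symmetric] by (intro mult_left_mono) auto
    qed
    finally show ?thesis by simp
  qed
  \<comment> \<open>As \<open>v\<close> has norm at least \<open>1 / R\<close>, its horizontal part
    is then at least half of that.\<close>
  have Yv2: "\<bar>Yc v\<bar> \<le> 1 / (2 * R)"
  proof -
    have "R * (c / R ^ tau) = c / R ^ (4 * d + 6)" using R by (simp add: tau_def power_add eval_nat_numeral)
    also have "\<dots> \<le> c / R ^ 2" using R c by (intro divide_left_mono power_increasing) auto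
    also have "\<dots> \<le> (R / 2) / R ^ 2" using n(2) R by (intro divide_right_mono) (auto simp: R_def)
    also have "\<dots> = 1 / (2 * R)" using R by (simp add: power2_eq_square)
    finally show ?thesis using Yv by linarith
  qed
  have vloc: "v = kap * Complex (Xc v) (Yc v)" by (rule XY_local)
  have nv: "norm v \<le> \<bar>Xc v\<bar> + \<bar>Yc v\<bar>" and Xn: "\<bar>Xc v\<bar> \<le> norm v"
  proof -
    have "norm v = norm (Complex (Xc v) (Yc v))" by (subst vloc) (simp add: norm_mult)
    thus "norm v \<le> \<bar>Xc v\<bar> + \<bar>Yc v\<bar>" "\<bar>Xc v\<bar> \<le> norm v"
      using cmod_le[of "Complex (Xc v) (Yc v)"] abs_Re_le_cmod[of "Complex (Xc v) (Yc v)"] by auto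
  qed
  have Xv: "1 / (2 * R) \<le> \<bar>Xc v\<bar>"
  proof -
    have "1 / R = 1 / (2 * R) + 1 / (2 * R)" using R by (simp add: field_simps)
    thus ?thesis using nv v1 Yv2 by linarith
  qed
  have X0: "0 < \<bar>Xc v\<bar>" using Xv R by (smt (verit) divide_pos_pos)
  obtain T0 z0 where T0: "2 * wd 0 * R ^ 2 \<le> T0" "T0 \<le> 4 * R ^ (4 * d + 2)"
    and z0: "\<And>j. j + 1 < d \<Longrightarrow> \<bar>T0 - 2 * of_int (z0 j) * wd j\<bar> \<le> 4 / R ^ 2"
    using simultaneous_period[OF n(1)] unfolding R_def by blast
  have w0: "0 < wd 0" using wd_pos[of 0] d_ge by simp
  have T0p: "0 < T0" using T0(1) w0 R by (smt (verit) mult_pos_pos zero_less_power)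
  \<comment> \<open>The time in which the horizontal displacement reaches \<open>T0\<close> in
    absolute value.\<close>
  define Q where "Q = T0 / \<bar>Xc v\<bar>"
  have Q0: "0 < Q" using T0p X0 by (simp add: Q_def)
  have Qge: "2 * wd 0 * R \<le> Q"
  proof -
    have "2 * wd 0 * R * \<bar>Xc v\<bar> \<le> 2 * wd 0 * R * R" using Xn vR w0 R by (intro mult_left_mono) auto
    also have "\<dots> \<le> T0" using T0(1) by (simp add: power2_eq_square mult_ac)
    finally show ?thesis using X0 by (simp add: Q_def field_simps)
  qed
  define z where "z j = (if 0 < Xc v then z0 j else - z0 j)" for j
  have zT: "\<bar>Q * Xc v - 2 * of_int (z j) * wd j\<bar> \<le> 4 / R ^ 2" if j: "j + 1 < d" for j
  proof (cases "0 < Xc v")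
    case True
    thus ?thesis using z0[OF j] by (simp add: Q_def z_def)
  next
    case False
    hence "Q * Xc v = - T0" using X0 by (simp add: Q_def)
    hence "Q * Xc v - 2 * of_int (z j) * wd j = - (T0 - 2 * of_int (z0 j) * wd j)" using False by (simp add: z_def)
    thus ?thesis using z0[OF j] by (simp only: abs_minus_cancel)
  qed
  \<comment> \<open>The exponents: \<open>Q\<close> contributes \<open>4 * d + 3\<close>, the
    vertical speed \<open>1 - tau\<close>, and the leading \<open>R\<close>, for mapping back by
    \<open>m\<close>, one more; the total is \<open>-2\<close>.\<close>
  have QY2: "R * (Q * \<bar>Yc v\<bar>) \<le> 8 * c / R"
  proof -
    have "1 \<le> \<bar>Xc v\<bar> * (2 * R)" using Xv R by (simp add: field_simps)
    hence "T0 * 1 \<le> T0 * (\<bar>Xc v\<bar> * (2 * R))" using T0p by (intro mult_left_mono) auto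
    hence "Q \<le> T0 * (2 * R)" unfolding Q_def using X0 by (simp add: divide_le_eq mult_ac)
    also have "\<dots> \<le> (4 * R ^ (4 * d + 2)) * (2 * R)" using T0(2) R by (intro mult_right_mono) auto
    finally have "R * (Q * \<bar>Yc v\<bar>) \<le> R * (((4 * R ^ (4 * d + 2)) * (2 * R)) * (R * (c / R ^ tau)))"
      using Yv R Q0 by (intro mult_left_mono mult_mono) auto
    also have "\<dots> = 8 * c * (R ^ (4 * d + 2) * R * R * R) / R ^ tau" by (simp add: field_simps)
    also have "R ^ (4 * d + 2) * R * R * R = R ^ (4 * d + 5)" by (simp add: power_add eval_nat_numeral)
    also have "R ^ tau = R ^ (4 * d + 5) * R ^ 2" unfolding tau_def by (simp add: power_add[symmetric] add.commute)
    also have "8 * c * R ^ (4 * d + 5) / (R ^ (4 * d + 5) * R ^ 2) = 8 * c / R ^ 2" using R by simp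
    also have "\<dots> \<le> 8 * c / R ^ 1" using R c by (intro divide_left_mono power_increasing) auto
    finally show ?thesis by simp
  qed
  have QY: "Q * \<bar>Yc v\<bar> \<le> 8 * c / R"
  proof -
    have "1 * (Q * \<bar>Yc v\<bar>) \<le> R * (Q * \<bar>Yc v\<bar>)" using R Q0 by (intro mult_right_mono) auto
    thus ?thesis using QY2 by linarith
  qed
  show ?thesis
  proof (rule that[of Q])
    show "2 * wd 0 * real n \<le> Q" using Qge by (simp add: R_def)
    fix x assume "x \<in> proj d ` inner_part e \<inter> (\<psi> -` (proj d ` off_levels r) \<inter> surface d)"
    then obtain p p' where p: "p \<in> inner_part e" "x = proj d p" and p': "p' \<in> off_levels r" "\<psi> x = proj d p'" and xs: "x \<in> surface d"
      by auto
    have pP0: "p \<in> P0" using p(1) inner_part_P0[OF e(2)] by auto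
    show "\<exists>p\<in>P0. \<exists>q\<in>P0. x = proj d p \<and> linear_flow d u Q x = proj d q \<and> dist p q \<le> e"
    proof (cases "\<exists>\<gamma>. linear_trajectory d u \<gamma> \<and> \<gamma> 0 = x")
      case False
      thus ?thesis using linear_flow_id[OF False, of Q] p pP0 e by (intro bexI[of _ p]) auto
    next
      case True
      then obtain \<gamma> where g: "linear_trajectory d u \<gamma>" "\<gamma> 0 = x" by blast
      obtain j a t where j: "j + 1 < d" and t: "0 < t" "t < 1" "r < t * ht j" "r < (1 - t) * ht j"
        and ha: "\<bar>a\<bar> \<le> hw j t" and pt: "p' = Pt j a t" using off_levels_Pt[OF p'(1) r(2)] .
      have h: "0 < ht j" by (rule ht_pos[OF j])
      have Dx: "\<psi> x = D j a t" using p'(2) pt D_Pt[OF j _ _ ha] t by simp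
      \<comment> \<open>The vertical drift is at most the distance from the cylinder's boundary, so
        the path remains in one cylinder and meets no cone point.\<close>
      have inside: "0 < t + s * (Q * Yc v / ht j) \<and> t + s * (Q * Yc v / ht j) < 1" if s: "0 \<le> s" "s \<le> 1" for s
      proof -
        have "\<bar>s * (Q * Yc v)\<bar> = s * (Q * \<bar>Yc v\<bar>)" using s Q0 by (simp add: abs_mult)
        also have "\<dots> \<le> 1 * (Q * \<bar>Yc v\<bar>)" using s Q0 by (intro mult_right_mono) auto
        also have "\<dots> \<le> r" using QY r(1) by (simp add: R_def)
        finally have b: "- r \<le> s * (Q * Yc v)" "s * (Q * Yc v) \<le> r" by auto
        have e: "(t + s * (Q * Yc v / ht j)) * ht j = t * ht j + s * (Q * Yc v)" using h by (simp add: algebra_simps)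
        have "0 < (t + s * (Q * Yc v / ht j)) * ht j" unfolding e using b t by linarith
        moreover have "(t + s * (Q * Yc v / ht j)) * ht j < 1 * ht j" unfolding e using b t by (simp add: algebra_simps)
        ultimately show ?thesis using h by (simp add: zero_less_mult_iff)
      qed
      have sg: "straight u 0 Q \<gamma>" by (rule linear_trajectory_straight[OF g(1)])
      have s1: "straight v 0 Q (\<lambda>s. \<psi> (\<gamma> s))" unfolding v_def
        by (rule affine_map_straight[OF af(2) sg]) (rule linear_trajectory_noncone[OF g(1)])
      have in2: "0 < t + s * (Yc v / ht j) \<and> t + s * (Yc v / ht j) < 1" if "0 \<le> s" "s \<le> Q" for s
        using inside[of "s / Q"] that Q0 by simp
      have s2: "straight v 0 Q (\<lambda>s. D j (a + s * Xc v) (t + s * (Yc v / ht j)))"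
        by (subst vloc, rule D_straight[OF j]) (use in2 in force)
      have "D j (a + Q * Xc v) (t + Q * (Yc v / ht j)) = \<psi> (\<gamma> Q)"
        by (rule straight_unique[OF s2 s1]) (use in2 D_noncone[OF j] Dx g Q0 in auto)
      hence end1: "\<psi> (\<gamma> Q) = D j (a + Q * Xc v) (t + Q * Yc v / ht j)" by simp
      \<comment> \<open>What remains of the displacement after whole turns around the cylinder have
        been removed.\<close>
      define ex where "ex = Q * Xc v - 2 * of_int (z j) * wd j"
      define ey where "ey = Q * Yc v"
      have tin: "0 \<le> t + Q * Yc v / ht j" "t + Q * Yc v / ht j \<le> 1" using inside[of 1] by auto
      have aq: "a + Q * Xc v = (a + ex) + 2 * of_int (z j) * wd j" by (simp add: ex_def)
      have end2: "\<psi> (\<gamma> Q) = D j (a + ex) (t + ey / ht j)"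
        unfolding end1 ey_def aq by (rule D_period[OF j tin])
      define w where "w = kap * Complex ex ey"
      \<comment> \<open>A short straight path leads from \<open>\<psi> x\<close> to the endpoint.
        Its image under \<open>\<phi>\<close> has velocity \<open>m w\<close> and starts at
        \<open>x\<close>, so it coincides with a segment from \<open>p\<close> inside the
        polygon.\<close>
      have s3: "straight w 0 1 (\<lambda>s. D j (a + s * ex) (t + s * (ey / ht j)))"
        unfolding w_def by (rule D_straight[OF j]) (use inside in \<open>force simp: ey_def\<close>)
      have s4: "straight (m w) 0 1 (\<lambda>s. \<phi> (D j (a + s * ex) (t + s * (ey / ht j))))"
        by (rule affine_map_straight[OF af(1) s3]) (use inside D_noncone[OF j] in \<open>auto simp: ey_def\<close>)
      have nw: "norm (m w) \<le> e"
      proof -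
        have "norm w = norm (Complex ex ey)" by (simp add: w_def norm_mult)
        also have "\<dots> \<le> \<bar>ex\<bar> + \<bar>ey\<bar>" using cmod_le[of "Complex ex ey"] by simp
        finally have "R * norm w \<le> R * \<bar>ex\<bar> + R * \<bar>ey\<bar>" using R by (simp add: distrib_left[symmetric])
        also have "R * \<bar>ex\<bar> \<le> R * (4 / R ^ 2)" unfolding ex_def using zT[OF j] R by (intro mult_left_mono) auto
        also have "\<dots> = 4 / R" using R by (simp add: power2_eq_square)
        also have "R * \<bar>ey\<bar> = R * (Q * \<bar>Yc v\<bar>)" using Q0 by (simp add: ey_def abs_mult)
        also have "\<dots> \<le> 8 * c / R" by (rule QY2)
        finally have "R * norm w \<le> (4 + 8 * c) / R" by (simp add: add_divide_distrib)
        thus ?thesis using mn[of w] e(1) unfolding R_def by linarith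
      qed
      have inP0: "p + s *\<^sub>R m w \<in> P0" if "0 \<le> s" "s \<le> 1" for s
      proof (rule inner_part_move[OF e(2) p(1)])
        have "s * norm (m w) \<le> 1 * norm (m w)" using that by (intro mult_right_mono) auto
        thus "norm (s *\<^sub>R m w) \<le> e" using that nw by simp
      qed
      have s5: "straight (m w) 0 1 (\<lambda>s. proj d (p + s *\<^sub>R m w))"
        by (rule straight_polygon) (use inP0 P0_P in blast)
      have P0V: "y \<notin> V" if "y \<in> P0" for y using P0_nrm[OF that] nrm_vertex_same(1) by (metis imageE order_less_irrefl)
      have "proj d (p + 1 *\<^sub>R m w) = \<phi> (D j (a + 1 * ex) (t + 1 * (ey / ht j)))"
      proof (rule straight_unique[OF s5 s4])
        show "proj d (p + s *\<^sub>R m w) \<notin> cone_points d" if "0 \<le> s" "s < 1" for s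
          using inP0[of s] that P0V P0_P proj_cone_iff by (meson less_imp_le subsetD)
        show "proj d (p + 0 *\<^sub>R m w) = \<phi> (D j (a + 0 * ex) (t + 0 * (ey / ht j)))"
          using inv'[OF xs] Dx p(2) by simp
      qed auto
      also have "\<dots> = \<phi> (\<psi> (\<gamma> Q))" using end2 by simp
      also have "\<dots> = \<gamma> Q" by (rule inv'[OF linear_trajectory_surface[OF g(1)]])
      finally have "proj d (p + m w) = \<gamma> Q" by simp
      hence "linear_flow d u Q x = proj d (p + m w)" using linear_flow_eq[OF g(1), of Q] g(2) by simp
      moreover have "p + m w \<in> P0" using inP0[of 1] by simp
      moreover have "dist p (p + m w) \<le> e" using nw by (simp add: dist_norm)
      ultimately show ?thesis using p(2) pP0 by blast
    qed
  qed
qed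

definition side_directions :: "complex set" where
  "side_directions = {u. norm u = 1 \<and> \<not> transverse u}"

lemma finite_side_directions: "finite side_directions"
proof (rule finite_subset)
  show "side_directions \<subseteq> (\<Union>k<2*d. {\<i> * nrm k, - (\<i> * nrm k)})"
  proof
    fix u assume "u \<in> side_directions"
    then obtain k where u: "norm u = 1" "nrm k \<bullet> u = 0" by (auto simp: side_directions_def transverse_def)
    define i where "i = k mod (2 * d)"
    have i: "i < 2 * d" "nrm i \<bullet> u = 0" using u d_ge by (simp_all add: i_def nrm_mod)
    define w where "w = cnj (nrm i) * u"
    have nn: "nrm i * cnj (nrm i) = 1" by (simp add: nrm_def cis_cnj cis_mult)
    have uw: "u = nrm i * w" unfolding w_def using nn by (simp flip: mult.assoc)
    have "Re w = 0" using i(2) by (simp add: w_def inner_complex_def)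
    moreover have "norm w = 1" using u(1) by (simp add: w_def norm_mult)
    ultimately have "\<bar>Im w\<bar> = 1" by (simp add: cmod_eq_Im)
    hence "w = \<i> \<or> w = - \<i>" using \<open>Re w = 0\<close> by (auto simp: complex_eq_iff abs_if split: if_splits)
    hence "u = \<i> * nrm i \<or> u = - (\<i> * nrm i)" using uw by auto
    thus "u \<in> (\<Union>k<2*d. {\<i> * nrm k, - (\<i> * nrm k)})" using i(1) by blast
  qed
qed simp

lemma approx_norm: "p \<in> approx N \<Longrightarrow> norm p = 1"
  by (auto simp: approx_def)

lemma approx_const_ge: "1 \<le> approx_const"
proof -
  have "sin b ^ 2 \<le> 1" using sin_b_pos by (intro power_le_one) auto
  thus ?thesis using sin_b_pos by (simp add: approx_const_def field_simps)
qed

interpretation ub: ubiquitous approx approx_const "4 * d + 7" side_directions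
  by unfold_locales (auto simp: approx_const_ge finite_side_directions approx_norm approx_ubiquitous)

lemma rigid_direction:
  assumes uG: "u \<in> ub.G" shows "rigid_flow M (linear_flow d u)"
proof -
  interpret prob_space M by (rule prob_space_M)
  define tau where "tau = 4 * d + 7"
  have "u \<in> sphere 0 1 - side_directions" using uG unfolding ub.G_def by blast
  hence u: "norm u = 1" "transverse u" by (auto simp: side_directions_def)
  \<comment> \<open>Compensates rounding \<open>N\<close> up to an integer \<open>n\<close>, which
    is at most \<open>2 * N\<close>.\<close>
  define c :: real where "c = 2 ^ tau"
  have c: "0 \<le> c" by (simp add: c_def)
  define E where "E k = (4 + 8 * c) / real (Suc k)" for k
  have E0: "0 < E k" for k using c by (simp add: E_def add_pos_nonneg)
  have E: "E \<longlonglongrightarrow> 0" unfolding E_def by (rule LIMSEQ_Suc) (rule lim_const_over_n)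
  have ret: "\<exists>\<psi> Q. preserving \<psi> \<and> 2 * wd 0 * real k \<le> Q \<and>
    (\<forall>x \<in> proj d ` inner_part (E k) \<inter> (\<psi> -` (proj d ` off_levels (E k)) \<inter> surface d).
      \<exists>p\<in>P0. \<exists>q\<in>P0. x = proj d p \<and> linear_flow d u Q x = proj d q \<and> dist p q \<le> E k)" for k
  proof -
    \<comment> \<open>Ensures that \<open>n\<close> exceeds both \<open>k\<close> and the threshold
      \<open>2 * c\<close> of the return lemma.\<close>
    define k' where "k' = Suc k + nat \<lceil>2 * c\<rceil>"
    have "u \<in> ub.U k'" using uG by (auto simp: ub.G_def)
    then obtain N p where N: "real k' < N" and p: "p \<in> approx N" "dist p u < 1 / N ^ tau"
      by (auto simp: ub.U_def tau_def)
    obtain m where mV: "m \<in> Veech" and pm: "p = (1 / norm (m kap)) *\<^sub>R m kap" and m0: "m kap \<noteq> 0"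
      and mN: "\<And>z. norm (m z) \<le> N * norm z" using p(1) by (auto simp: approx_def)
    obtain \<phi> m' \<psi> where a: "affine_aut m \<phi> m' \<psi>" using mV by (auto simp: Veech_def)
    define n where "n = nat \<lceil>N\<rceil>"
    have N1: "1 \<le> N" using N by (simp add: k'_def)
    have n: "N \<le> real n" "real n \<le> 2 * N" "0 < n" using N1 unfolding n_def by linarith+
    have kn: "real (Suc k) \<le> real n" "2 * c \<le> real n"
    proof -
      have "real (Suc k) \<le> real k'" "2 * c \<le> real k'" unfolding k'_def by linarith+
      thus "real (Suc k) \<le> real n" "2 * c \<le> real n" using N n(1) by linarith+
    qed
    have mn: "norm (m z) \<le> real n * norm z" for z
      using mN[of z] mult_right_mono[OF n(1), of "norm z"] by simp
    have up: "norm (u - (1 / norm (m kap)) *\<^sub>R m kap) \<le> c / real n ^ (4 * d + 7)"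
    proof -
      have "norm (u - (1 / norm (m kap)) *\<^sub>R m kap) \<le> 1 / N ^ tau"
        using p(2) unfolding pm by (simp add: dist_norm norm_minus_commute)
      also have "\<dots> = 2 ^ tau / (2 * N) ^ tau" using N1 by (simp add: power_mult_distrib)
      also have "\<dots> \<le> 2 ^ tau / real n ^ tau" using n by (intro divide_left_mono power_mono) auto
      finally show ?thesis by (simp add: c_def tau_def)
    qed
    have e: "(4 + 8 * c) / real n \<le> E k" unfolding E_def using kn c by (intro divide_left_mono) auto
    have "8 * c / real n \<le> (4 + 8 * c) / real n" by (intro divide_right_mono) auto
    hence r: "8 * c / real n \<le> E k" using e by linarith
    obtain Q where Q: "2 * wd 0 * real n \<le> Q"
      "\<And>x. x \<in> proj d ` inner_part (E k) \<inter> (\<psi> -` (proj d ` off_levels (E k)) \<inter> surface d) \<Longrightarrow>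
      \<exists>p\<in>P0. \<exists>q\<in>P0. x = proj d p \<and> linear_flow d u Q x = proj d q \<and> dist p q \<le> E k"
      using close_return[OF a n(3) kn(2) c mn m0 u(1) up e E0 r less_imp_le[OF E0]] by blast
    have "2 * wd 0 * real k \<le> 2 * wd 0 * real n" using kn(1) wd_pos[of 0] d_ge by (intro mult_left_mono) auto
    moreover have "preserving \<psi>" using a by (simp add: affine_aut_def)
    ultimately show ?thesis using Q by (meson order_trans)
  qed
  define good_return where "good_return k \<psi> Q \<longleftrightarrow> preserving \<psi> \<and> 2 * wd 0 * real k \<le> Q \<and>
    (\<forall>x \<in> proj d ` inner_part (E k) \<inter> (\<psi> -` (proj d ` off_levels (E k)) \<inter> surface d).
      \<exists>p\<in>P0. \<exists>q\<in>P0. x = proj d p \<and> linear_flow d u Q x = proj d q \<and> dist p q \<le> E k)" for k \<psi> Q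
  have "\<forall>k. \<exists>\<psi> Q. good_return k \<psi> Q" unfolding good_return_def using ret by (rule allI)
  from choice[OF this] obtain \<psi> where "\<forall>k. \<exists>Q. good_return k (\<psi> k) Q" ..
  from choice[OF this] obtain Q where good: "\<forall>k. good_return k (\<psi> k) (Q k)" ..
  have \<psi>: "\<And>k. preserving (\<psi> k)" and Q: "\<And>k. 2 * wd 0 * real k \<le> Q k"
    and ret: "\<And>k x. x \<in> proj d ` inner_part (E k) \<inter> (\<psi> k -` (proj d ` off_levels (E k)) \<inter> surface d) \<Longrightarrow>
      \<exists>p\<in>P0. \<exists>q\<in>P0. x = proj d p \<and> linear_flow d u (Q k) x = proj d q \<and> dist p q \<le> E k"
    using good unfolding good_return_def by blast+
  define A where "A k = proj d ` inner_part (E k)" for k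
  define B where "B k = proj d ` off_levels (E k)" for k
  have A: "A k \<in> sets M" for k unfolding A_def by (rule image_sets[OF inner_part_P0[OF E0] inner_part_borel])
  have B: "B k \<in> sets M" for k unfolding B_def by (rule image_sets) (auto simp: off_levels_def off_levels_borel)
  have fB: "\<psi> k -` B k \<inter> surface d \<in> sets M" "prob (\<psi> k -` B k \<inter> surface d) = prob (B k)" for k
    using measurable_sets[of "\<psi> k" M M "B k"] \<psi>[of k] B[of k] by (auto simp: preserving_def measure_def)
  have limA: "(\<lambda>k. prob (A k)) \<longlonglongrightarrow> 1" unfolding A_def by (rule inner_part_tendsto[OF E E0])
  have limB: "(\<lambda>k. prob (B k)) \<longlonglongrightarrow> 1" unfolding B_def by (rule off_levels_tendsto[OF E E0])
  define Z where "Z k = A k \<inter> (\<psi> k -` B k \<inter> surface d)" for k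
  have Zm: "Z k \<in> sets M" for k unfolding Z_def using A fB by auto
  \<comment> \<open>Two events of probability near 1 meet in an event of probability near 1;
    \<open>\<psi> k\<close> does not change the probability of \<open>B k\<close>.\<close>
  have lower: "prob (A k) + prob (B k) - 1 \<le> prob (Z k)" for k
  proof -
    let ?C = "\<psi> k -` B k \<inter> surface d"
    have "prob (A k \<union> ?C) = prob (A k) + prob (?C - A k)"
      using A fB by (subst finite_measure_Union[symmetric]) (auto simp: Un_Diff_cancel)
    moreover have "prob ?C = prob (?C - A k) + prob (?C \<inter> A k)" using finite_measure_Diff'[OF fB(1) A, of k k] by simp
    moreover have "prob (A k \<union> ?C) \<le> 1" by (rule prob_le_1)
    ultimately show ?thesis using fB(2)[of k] by (simp add: Z_def Int_commute)
  qed
  have "(\<lambda>k. prob (A k) + prob (B k) - 1) \<longlonglongrightarrow> 1 + 1 - 1" by (intro tendsto_intros limA limB)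
  hence limZ: "(\<lambda>k. prob (Z k)) \<longlonglongrightarrow> 1"
    using tendsto_sandwich[of "\<lambda>k. prob (A k) + prob (B k) - 1" "\<lambda>k. prob (Z k)" sequentially "\<lambda>k. 1" 1] lower prob_le_1
    by simp
  have Qlim: "filterlim Q at_top sequentially"
  proof (rule filterlim_at_top_mono[OF _ always_eventually])
    have "0 < 2 * wd 0" using wd_pos[of 0] d_ge by simp
    thus "filterlim (\<lambda>k. 2 * wd 0 * real k) at_top sequentially"
      by (intro filterlim_tendsto_pos_mult_at_top[OF tendsto_const] filterlim_real_sequentially)
  qed (use Q in blast)
  show ?thesis
    by (rule rigid_criterion[OF u(2) Qlim Zm limZ E]) (rule ret, simp add: Z_def A_def B_def)
qed

lemma rigid_directions:
  "\<exists>G. gdelta_in (top_of_set (sphere 0 1)) G \<and> top_of_set (sphere 0 1) closure_of G = sphere 0 1 \<and>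
    hausdorff_dim G > 0 \<and> (\<forall>u\<in>G. rigid_flow M (linear_flow d u))"
  using ub.gdelta_G ub.dense_G ub.dim_G rigid_direction by blast

end

theorem proposition13:
  fixes d :: nat
  assumes "d \<ge> 2"
  shows "\<exists>G :: complex set.
    gdelta_in (top_of_set (sphere 0 1)) G \<and>
    top_of_set (sphere 0 1) closure_of G = sphere 0 1 \<and>
    hausdorff_dim G > 0 \<and>
    (\<forall>u \<in> G. rigid_flow (surface_measure d) (linear_flow d u))"
proof -
  interpret regular_polygon d using assms by unfold_locales
  show ?thesis by (rule rigid_directions)
qed

end
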